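(* Let $\mathbb{F}$ be a field, let $V$ be an infinite-dimensional vector space over $\mathbb{F}$, and let $u\in\mathrm{End}(V)$. Then $u$ is the sum of three square-zero endomorphisms of $V$ if and only if none of the following situations occurs: (i) there exist $\lambda\in\mathbb{F}$ and a finite-rank endomorphism $w\in\mathrm{End}(V)$ such that $\operatorname{tr}w\notin\{0,\lambda\}$ and $u=\lambda\,\mathrm{id}_V+w$; (ii) the characteristic of $\mathbb{F}$ differs from $2$ and $u$ has a non-zero dominant eigenvalue.
   Context: A scalar $\lambda$ is a dominant eigenvalue of $u\in\mathrm{End}(V)$ if $\operatorname{rk}(u-\lambda\,\mathrm{id}_V)<\dim V$. An endomorphism $a$ is square-zero if $a^2=0$. The trace of a finite-rank endomorphism is the usual trace (e.g. the trace of its restriction to any finite-dimensional subspace $W$ with $\operatorname{im}w\subset W$). *)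

theory Defs
  imports Complex_Main
begin

text \<open>Vector space V over a field: carrier type 'b with scalar multiplication
  s :: 'a \<Rightarrow> 'b \<Rightarrow> 'b, assumed to satisfy vector_space s.
  Endomorphisms are the s-linear maps 'b \<Rightarrow> 'b.\<close>

definition infinite_dimensional :: "('a::field \<Rightarrow> 'b::ab_group_add \<Rightarrow> 'b) \<Rightarrow> bool" where
  "infinite_dimensional s \<longleftrightarrow> \<not> (\<exists>S. finite S \<and> module.span s S = UNIV)"

definition is_basis_of :: "('a::field \<Rightarrow> 'b::ab_group_add \<Rightarrow> 'b) \<Rightarrow> 'b set \<Rightarrow> 'b set \<Rightarrow> bool" where
  "is_basis_of s B W \<longleftrightarrow> B \<subseteq> W \<and> \<not> module.dependent s B \<and> module.span s B = W"

text \<open>rk f < dim V as cardinals: a basis of the image of f has strictly smaller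
  cardinality than a basis of V (all bases of a space are equipotent).\<close>
definition rank_less_dim :: "('a::field \<Rightarrow> 'b::ab_group_add \<Rightarrow> 'b) \<Rightarrow> ('b \<Rightarrow> 'b) \<Rightarrow> bool" where
  "rank_less_dim s f \<longleftrightarrow>
     (\<exists>B C. is_basis_of s B (range f) \<and> is_basis_of s C UNIV \<and> (card_of B, card_of C) \<in> ordLess)"

definition dominant_eigenvalue :: "('a::field \<Rightarrow> 'b::ab_group_add \<Rightarrow> 'b) \<Rightarrow> ('b \<Rightarrow> 'b) \<Rightarrow> 'a \<Rightarrow> bool" where
  "dominant_eigenvalue s u l \<longleftrightarrow> rank_less_dim s (\<lambda>x. u x - s l x)"

definition finite_rank :: "('a::field \<Rightarrow> 'b::ab_group_add \<Rightarrow> 'b) \<Rightarrow> ('b \<Rightarrow> 'b) \<Rightarrow> bool" where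
  "finite_rank s w \<longleftrightarrow> (\<exists>S. finite S \<and> module.span s S = range w)"

text \<open>Trace of a finite-rank endomorphism: trace of its restriction to W = im w,
  computed in a (chosen) finite basis of im w.\<close>
definition fr_trace :: "('a::field \<Rightarrow> 'b::ab_group_add \<Rightarrow> 'b) \<Rightarrow> ('b \<Rightarrow> 'b) \<Rightarrow> 'a" where
  "fr_trace s w = (let B = (SOME B. finite B \<and> is_basis_of s B (range w))
                   in \<Sum>b\<in>B. module.representation s B (w b) b)"

definition square_zero :: "('b::zero \<Rightarrow> 'b) \<Rightarrow> bool" where
  "square_zero a \<longleftrightarrow> (\<forall>x. a (a x) = 0)"

end

theory Submission
  imports Defs
begin

text \<open>
  Necessity. Let \<open>a + b + c = l + w\<close> with \<open>a\<close>, \<open>b\<close>, \<open>c\<close> square-zero. Expanding \<open>c\<^sup>2 = 0\<close> gives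
  \<open>a b + b a = 2 l (a + b) - l\<^sup>2\<close> modulo the ideal generated by \<open>w\<close>. If \<open>2 l = 0\<close> and \<open>w\<close> has finite
  rank with image \<open>W\<close>, then \<open>W + a W + b W + a b W\<close> is finite-dimensional and stable under \<open>a\<close>, \<open>b\<close>,
  \<open>c\<close>, and taking traces there yields \<open>tr w \<in> {0, l}\<close>. If \<open>2 l \<noteq> 0\<close>, the relation forces \<open>a b = b a\<close>,
  then \<open>a = b\<close>, \<open>a b = 0\<close> and finally \<open>1 = 0\<close> modulo the ideal, so \<open>w\<close> cannot have small rank.

  Sufficiency. Choose a maximal set \<open>X\<close> such that \<open>X \<union> w X\<close> is independent, first for
  \<open>w = u\<close>. If \<open>X\<close> is small, then \<open>u = l + w\<close> with \<open>w\<close> of small rank and \<open>2 l = 0\<close>, and for the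
  maximal \<open>X\<close> belonging to this \<open>w\<close> the image of \<open>w\<close> lies in the span of \<open>X \<union> w X\<close>. Maps that kill
  \<open>X\<close> and take values in its span are square-zero and can be prescribed freely on a complement
  \<open>N\<close> of the span. If \<open>D\<close> is the compression of \<open>w\<close> to \<open>N\<close> and \<open>\<Omega> \<Theta> - \<Theta> \<Omega> = D\<close> for an isomorphism
  \<open>\<Theta>\<close> of \<open>N\<close> onto the span of \<open>w X\<close>, then such a map \<open>c\<close> can be chosen so that \<open>T = w - c\<close> admits
  a subspace \<open>E\<close> with \<open>V = E \<oplus> T E\<close> and \<open>T\<^sup>2 E \<subseteq> E\<close>; then \<open>T\<close> is odd for a grading and hence a sum
  of two square-zero maps. For infinite \<open>X\<close> a pure shift \<open>\<Theta>\<close> solves the commutator equation; for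
  finite \<open>X\<close> and scalar \<open>D\<close> of trace zero a cyclic permutation does. In the remaining finite-rank
  cases \<open>D\<close> is a sum of a strictly upper and a strictly lower triangular map, up to diagonal entries
  equal to \<open>l\<close>, and a suitable \<open>c\<close> makes \<open>u - c\<close> nilpotent up to blocks of size two with
  eigenvalue \<open>l\<close>.
\<close>

section \<open>Cardinalities\<close>

lemma ordIso_bij: "(card_of A, card_of B) \<in> ordIso \<Longrightarrow> \<exists>f. bij_betw f A B"
  by (rule iffD2[OF card_of_ordIso])

text \<open>An infinite set is equipotent to the disjoint sum of two copies of itself; the images of
  the two copies are the halves.\<close>

lemma infinite_split:
  assumes "infinite A"
  shows "\<exists>P Q. A = P \<union> Q \<and> P \<inter> Q = {} \<and> (card_of P, card_of A) \<in> ordIso \<and> (card_of Q, card_of A) \<in> ordIso"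
proof -
  have "(card_of (A <+> A), card_of A) \<in> ordIso"
    using card_of_Plus_infinite1[OF assms card_of_mono1[OF subset_refl]] .
  from ordIso_bij[OF this] obtain h where h: "bij_betw h (A <+> A) A" ..
  let ?P = "h ` (Inl ` A)" and ?Q = "h ` (Inr ` A)"
  have inj: "inj_on h (A <+> A)" and im: "h ` (A <+> A) = A" using h by (auto simp: bij_betw_def)
  have 1: "A = ?P \<union> ?Q" using im by (simp add: Plus_def image_Un)
  have 2: "?P \<inter> ?Q = {}"
    by (subst inj_on_image_Int[OF inj, symmetric]) auto
  have "bij_betw (\<lambda>x. h (Inl x)) A ?P"
    using inj unfolding bij_betw_def inj_on_def image_image by blast
  from ordIso_symmetric[OF card_of_ordIsoI[OF this]]
  have 3: "(card_of ?P, card_of A) \<in> ordIso" .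
  have "bij_betw (\<lambda>x. h (Inr x)) A ?Q"
    using inj unfolding bij_betw_def inj_on_def image_image by blast
  from ordIso_symmetric[OF card_of_ordIsoI[OF this]]
  have 4: "(card_of ?Q, card_of A) \<in> ordIso" .
  show ?thesis using 1 2 3 4 by blast
qed

lemma ordLeq_Un_infinite:
  assumes "infinite C" "(card_of A, card_of C) \<in> ordLeq" "(card_of B, card_of C) \<in> ordLeq"
  shows "(card_of (A \<union> B), card_of C) \<in> ordLeq"
  by (rule card_of_Un_ordLeq_infinite_Field[OF _ assms(2,3) card_of_Card_order])
    (simp add: assms(1) Field_card_of)

lemma finite_ordLess_infinite_card:
  "finite A \<Longrightarrow> infinite B \<Longrightarrow> (card_of A, card_of B) \<in> ordLess"
  by (rule finite_ordLess_infinite[OF card_of_Well_order card_of_Well_order])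
    (simp_all add: Field_card_of)

lemma finite_ordLeq_infinite_card:
  "finite A \<Longrightarrow> infinite B \<Longrightarrow> (card_of A, card_of B) \<in> ordLeq"
  by (rule ordLess_imp_ordLeq[OF finite_ordLess_infinite_card])

lemma absorb_finite_ordIso:
  assumes "infinite P" "finite A"
  shows "(card_of (A \<union> P), card_of P) \<in> ordIso"
  by (intro iffD2[OF ordIso_iff_ordLeq] conjI
      ordLeq_Un_infinite[OF assms(1) finite_ordLeq_infinite_card[OF assms(2,1)]] card_of_mono1) auto

text \<open>Both halves of \<open>Z\<close> are infinite and of the same size, so each absorbs a
  finite set without changing its cardinality. This lets finitely many exceptional vectors be paired
  off with kernel vectors.\<close>

lemma pairing_exists:
  assumes "infinite Z" "finite A" "finite C"
  shows "\<exists>P Q f. Z = P \<union> Q \<and> P \<inter> Q = {} \<and> bij_betw f (A \<union> P) (C \<union> Q)"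
proof -
  obtain P Q where PQ: "Z = P \<union> Q" "P \<inter> Q = {}" and
    iso: "(card_of P, card_of Z) \<in> ordIso" "(card_of Q, card_of Z) \<in> ordIso"
    using infinite_split[OF assms(1)] by blast
  have iP: "infinite P" and iQ: "infinite Q"
    using card_of_ordIso_finite[OF iso(1)] card_of_ordIso_finite[OF iso(2)] assms(1) by simp_all
  have "(card_of (A \<union> P), card_of Z) \<in> ordIso"
    using ordIso_transitive[OF absorb_finite_ordIso[OF iP assms(2)] iso(1)] .
  moreover have "(card_of (C \<union> Q), card_of Z) \<in> ordIso"
    using ordIso_transitive[OF absorb_finite_ordIso[OF iQ assms(3)] iso(2)] .
  ultimately have "(card_of (A \<union> P), card_of (C \<union> Q)) \<in> ordIso"
    by (rule ordIso_transitive[OF _ ordIso_symmetric])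
  from ordIso_bij[OF this] show ?thesis using PQ by blast
qed

section \<open>Linear maps and gradings\<close>

locale endo_space = vector_space scale
  for scale :: "'a::field \<Rightarrow> 'b::ab_group_add \<Rightarrow> 'b" (infixr "*s" 75)
begin

interpretation P: vector_space_pair scale scale ..

abbreviation lin :: "('b \<Rightarrow> 'b) \<Rightarrow> bool" where
  "lin f \<equiv> Vector_Spaces.linear scale scale f"

section \<open>Rules for linear maps and subspaces\<close>

lemma lin_rules:
  assumes "lin f"
  shows "f (x + y) = f x + f y" "f (x - y) = f x - f y" "f (- x) = - f x"
    "f (r *s x) = r *s f x" "f 0 = 0"
  using P.linear_add[OF assms] P.linear_diff[OF assms] P.linear_neg[OF assms]
    P.linear_scale[OF assms] P.linear_0[OF assms] by auto

lemma linI: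
  assumes "\<And>x y. f (x + y) = f x + f y" "\<And>r x. f (r *s x) = r *s f x"
  shows "lin f"
  using assms vector_space_axioms unfolding Vector_Spaces.linear_iff by blast

lemma lin_compose: "lin f \<Longrightarrow> lin g \<Longrightarrow> lin (\<lambda>x. f (g x))"
  by (rule linI) (simp_all add: lin_rules)

lemma lin_add: "lin f \<Longrightarrow> lin g \<Longrightarrow> lin (\<lambda>x. f x + g x)"
  by (rule linI) (simp_all add: lin_rules algebra_simps)

lemma lin_diff: "lin f \<Longrightarrow> lin g \<Longrightarrow> lin (\<lambda>x. f x - g x)"
  by (rule linI) (simp_all add: lin_rules algebra_simps)

lemma lin_ident: "lin (\<lambda>x. x)"
  by (rule linI) simp_all

lemma lin_scale: "lin f \<Longrightarrow> lin (\<lambda>x. r *s f x)"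
  by (rule linI) (simp_all add: lin_rules scale_right_distrib mult.commute)

lemma lin_zero: "lin (\<lambda>x. 0)"
  by (rule linI) simp_all

lemma lin_funpow: "lin f \<Longrightarrow> lin (f ^^ n)"
proof (induction n)
  case 0
  then show ?case using lin_ident by (simp add: id_def)
next
  case (Suc n)
  then show ?case using lin_compose[of f "f ^^ n"] by (simp add: comp_def)
qed

lemma ex_lin: "independent B \<Longrightarrow> \<exists>f. lin f \<and> (\<forall>b\<in>B. f b = g b)"
  using P.linear_independent_extend[of B g] by blast

lemma lin_span_image: "lin f \<Longrightarrow> x \<in> span S \<Longrightarrow> f x \<in> span (f ` S)"
  using P.linear_span_image[of f S] by blast

lemma lin_span_into:
  assumes "lin f" "subspace W" "\<And>b. b \<in> S \<Longrightarrow> f b \<in> W" "x \<in> span S"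
  shows "f x \<in> W"
proof -
  have "f ` S \<subseteq> W" using assms(3) by blast
  then have "span (f ` S) \<subseteq> W" using assms(2) by (rule span_minimal)
  then show ?thesis using lin_span_image[OF assms(1,4)] by blast
qed

lemma lin_eq_on_span:
  assumes "lin f" "lin g" "\<And>b. b \<in> S \<Longrightarrow> f b = g b" "x \<in> span S"
  shows "f x = g x"
  using P.linear_eq_on_span[OF assms(1,2)] assms(3,4) by blast

lemma subspaceD:
  assumes "subspace W"
  shows "0 \<in> W" "x \<in> W \<Longrightarrow> y \<in> W \<Longrightarrow> x + y \<in> W" "x \<in> W \<Longrightarrow> y \<in> W \<Longrightarrow> x - y \<in> W"
    "x \<in> W \<Longrightarrow> r *s x \<in> W" "x \<in> W \<Longrightarrow> - x \<in> W"
  using subspace_0[OF assms] subspace_add[OF assms] subspace_diff[OF assms]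
    subspace_scale[OF assms] subspace_neg[OF assms] by auto

text \<open>One exponent \<open>k\<close> serves for all of \<open>W\<close>; in infinite dimension
  this is stronger than nilpotency at each single vector.\<close>

definition nilp_on :: "('b \<Rightarrow> 'b) \<Rightarrow> 'b set \<Rightarrow> bool" where
  "nilp_on f W \<longleftrightarrow> (\<exists>k. \<forall>x\<in>W. (f ^^ k) x = 0)"

section \<open>Sums of square-zero maps obtained from gradings\<close>

definition sum_sqz2 :: "('b \<Rightarrow> 'b) \<Rightarrow> bool" where
  "sum_sqz2 u \<longleftrightarrow> (\<exists>a b. lin a \<and> lin b \<and> square_zero a \<and> square_zero b \<and> u = (\<lambda>x. a x + b x))"

definition sum_sqz3 :: "('b \<Rightarrow> 'b) \<Rightarrow> bool" where
  "sum_sqz3 u \<longleftrightarrow> (\<exists>a b c. lin a \<and> lin b \<and> lin c \<and> square_zero a \<and> square_zero b \<and> square_zero c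
     \<and> u = (\<lambda>x. a x + b x + c x))"

lemma sum_sqz3I:
  assumes "lin c" "square_zero c" "sum_sqz2 (\<lambda>x. u x - c x)"
  shows "sum_sqz3 u"
proof -
  from assms(3) obtain a b where "lin a" "lin b" "square_zero a" "square_zero b"
    and eq: "(\<lambda>x. u x - c x) = (\<lambda>x. a x + b x)" unfolding sum_sqz2_def by blast
  moreover have "u = (\<lambda>x. a x + b x + c x)" using fun_cong[OF eq] by (auto simp: algebra_simps)
  ultimately show ?thesis using assms(1,2) unfolding sum_sqz3_def by blast
qed

text \<open>With \<open>p\<close> the projection onto \<open>E\<close> along \<open>F\<close>, the
  map \<open>T\<close> is the sum of \<open>T p\<close> and \<open>T (1 - p)\<close>. Each of them
  kills one of the two summands and takes its values in that same summand, hence has square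
  zero.\<close>

lemma odd_grading_sum_sqz2:
  assumes T: "lin T" and E: "subspace E" and F: "subspace F"
    and disj: "\<And>x. x \<in> E \<Longrightarrow> x \<in> F \<Longrightarrow> x = 0"
    and cover: "\<And>v. \<exists>e\<in>E. \<exists>f\<in>F. v = e + f"
    and TE: "\<And>x. x \<in> E \<Longrightarrow> T x \<in> F" and TF: "\<And>x. x \<in> F \<Longrightarrow> T x \<in> E"
  shows "sum_sqz2 T"
proof -
  from cover have "\<forall>v. \<exists>e. e \<in> E \<and> v - e \<in> F" by (metis add_diff_cancel_left')
  then obtain p where p: "\<And>v. p v \<in> E" "\<And>v. v - p v \<in> F" by metis
  have pu: "p v = e" if "e \<in> E" "v - e \<in> F" for v e
  proof -
    have "p v - e \<in> E" using p(1) that(1) E by (simp add: subspaceD)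
    moreover have "p v - e \<in> F" using subspace_diff[OF F that(2) p(2)[of v]] by simp
    ultimately have "p v - e = 0" using disj by blast
    then show ?thesis by simp
  qed
  have lp: "lin p"
  proof (rule linI)
    fix x y show "p (x + y) = p x + p y"
    proof (rule pu)
      show "p x + p y \<in> E" using p(1) E by (simp add: subspaceD)
      have "(x - p x) + (y - p y) \<in> F" using p(2) F by (simp add: subspaceD)
      then show "x + y - (p x + p y) \<in> F" by (simp add: algebra_simps)
    qed
  next
    fix r x show "p (r *s x) = r *s p x"
    proof (rule pu)
      show "r *s p x \<in> E" using p(1) E by (simp add: subspaceD)
      have "r *s (x - p x) \<in> F" using p(2) F by (simp add: subspaceD)
      then show "r *s x - r *s p x \<in> F" by (simp add: scale_right_diff_distrib)
    qed
  qed
  have pF: "p v = 0" if "v \<in> F" for v using pu[of 0 v] that E by (simp add: subspaceD)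
  have pE: "p v = v" if "v \<in> E" for v using pu[of v v] that F by (simp add: subspaceD)
  let ?a = "\<lambda>x. T (p x)" and ?b = "\<lambda>x. T (x - p x)"
  have la: "lin ?a" using lin_compose[OF T lp] .
  have lb: "lin ?b" using lin_compose[OF T lin_diff[OF lin_ident lp]] .
  have "square_zero ?a" unfolding square_zero_def using pF TE p(1) by (simp add: lin_rules[OF T])
  moreover have "square_zero ?b" unfolding square_zero_def
  proof
    fix x
    show "?b (?b x) = 0" using pE[OF TF[OF p(2)[of x]]] by (simp only: diff_self lin_rules(5)[OF T])
  qed
  moreover have "T = (\<lambda>x. ?a x + ?b x)" by (simp add: lin_rules[OF T])
  ultimately show ?thesis using la lb unfolding sum_sqz2_def by blast
qed

text \<open>If \<open>E \<oplus> T E\<close> is the whole space and \<open>T\<^sup>2\<close> maps \<open>E\<close> into itself, then \<open>T + l\<close> inherits this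
  property whenever \<open>2 l = 0\<close>, because \<open>(T + l)\<^sup>2 = T\<^sup>2 + l\<^sup>2\<close>.\<close>

lemma doubling_sum_sqz2:
  assumes T: "lin T" and E: "subspace E"
    and disj: "\<And>x. x \<in> E \<Longrightarrow> T x \<in> E \<Longrightarrow> x = 0"
    and cover: "\<And>v. \<exists>e\<in>E. \<exists>f\<in>E. v = e + T f"
    and T2: "\<And>x. x \<in> E \<Longrightarrow> T (T x) \<in> E"
    and l: "l + l = 0"
  shows "sum_sqz2 (\<lambda>x. T x + l *s x)"
proof -
  let ?T = "\<lambda>x. T x + l *s x"
  have lT: "lin ?T" using lin_add[OF T lin_scale[OF lin_ident]] .
  have ll: "l *s x + l *s x = 0" for x
    using l by (metis scale_left_distrib scale_zero_left)
  show ?thesis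
  proof (rule odd_grading_sum_sqz2[OF lT E])
    show "subspace (?T ` E)" using P.linear_subspace_image[OF lT E] .
    show "x = 0" if "x \<in> E" "x \<in> ?T ` E" for x
    proof -
      from that obtain e where e: "e \<in> E" "x = T e + l *s e" by blast
      then have "(T e + l *s e) - l *s e \<in> E" using that(1) E by (metis subspaceD(3,4))
      then have "T e \<in> E" by simp
      then have "e = 0" using disj e by blast
      then show ?thesis using e by (simp add: lin_rules[OF T])
    qed
    show "\<exists>e\<in>E. \<exists>f\<in>?T ` E. v = e + f" for v
    proof -
      from cover obtain e f where ef: "e \<in> E" "f \<in> E" "v = e + T f" by blast
      then have "v = (e - l *s f) + ?T f" by (simp add: algebra_simps)
      moreover have "e - l *s f \<in> E" using ef E by (simp add: subspaceD)
      ultimately show ?thesis using ef(2) by blast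
    qed
    show "?T x \<in> ?T ` E" if "x \<in> E" for x using that by blast
    show "?T x \<in> E" if "x \<in> ?T ` E" for x
    proof -
      from that obtain e where e: "e \<in> E" "x = T e + l *s e" by blast
      have "?T x = T (T e) + l *s (l *s e) + (l *s T e + l *s T e)"
        unfolding e(2) by (simp add: lin_rules[OF T] scale_right_distrib algebra_simps)
      also have "\<dots> = T (T e) + l *s (l *s e)" by (simp add: ll)
      finally show ?thesis using T2[OF e(1)] e(1) E by (metis subspaceD(2,4))
    qed
  qed
qed

section \<open>Extensions of independent sets and their cardinalities\<close>

lemma independent_extends:
  assumes "independent S"
  shows "\<exists>Z. independent (S \<union> Z) \<and> S \<inter> Z = {} \<and> span (S \<union> Z) = UNIV"
proof -
  obtain B where B: "S \<subseteq> B" "independent B" "UNIV \<subseteq> span B"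
    using maximal_independent_subset_extend[OF subset_UNIV assms] .
  have "S \<union> (B - S) = B" using B(1) by blast
  then have "independent (S \<union> (B - S)) \<and> S \<inter> (B - S) = {} \<and> span (S \<union> (B - S)) = UNIV"
    using B by auto
  then show ?thesis ..
qed

lemma independent_extends_within:
  assumes "independent S" "S \<subseteq> V" 
  shows "\<exists>Z. Z \<subseteq> V \<and> independent (S \<union> Z) \<and> S \<inter> Z = {} \<and> V \<subseteq> span (S \<union> Z)"
proof -
  obtain B where B: "S \<subseteq> B" "B \<subseteq> V" "independent B" "V \<subseteq> span B"
    using maximal_independent_subset_extend[OF assms(2,1)] .
  have "S \<union> (B - S) = B" using B(1) by blast
  then have "B - S \<subseteq> V \<and> independent (S \<union> (B - S)) \<and> S \<inter> (B - S) = {} \<and> V \<subseteq> span (S \<union> (B - S))"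
    using B by auto
  then show ?thesis ..
qed

text \<open>Extend \<open>T\<close> to a basis \<open>T'\<close> of \<open>span B\<close>. Each
  element of \<open>B\<close> involves finitely many members of \<open>T'\<close>, and those that
  occur already span, so they are all of \<open>T'\<close>: a union of finite sets indexed by
  \<open>B\<close>.\<close>

lemma independent_card_ordLeq:
  assumes T: "independent T" "T \<subseteq> span B" and B: "infinite B"
  shows "(card_of T, card_of B) \<in> ordLeq"
proof -
  obtain T' where T': "T \<subseteq> T'" "T' \<subseteq> span B" "independent T'" "span B \<subseteq> span T'"
    using maximal_independent_subset_extend[OF T(2,1)] .
  have "\<exists>F. finite F \<and> F \<subseteq> T' \<and> b \<in> span F" if "b \<in> B" for b
  proof -
    have "b \<in> span T'" using that T'(4) span_base by blast
    then obtain t r where t: "b = (\<Sum>a\<in>t. r a *s a)" "finite t" "t \<subseteq> T'"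
      unfolding span_explicit by blast
    have "b \<in> span t" unfolding t(1) by (intro span_sum span_scale span_base)
    then show ?thesis using t by blast
  qed
  then obtain F where F: "\<And>b. b \<in> B \<Longrightarrow> finite (F b)" "\<And>b. b \<in> B \<Longrightarrow> F b \<subseteq> T'"
    "\<And>b. b \<in> B \<Longrightarrow> b \<in> span (F b)" by metis
  let ?U = "\<Union>b\<in>B. F b"
  have U: "?U \<subseteq> T'" using F(2) by blast
  have "b \<in> span ?U" if "b \<in> B" for b using F(3)[OF that] span_mono[of "F b" ?U] that by blast
  then have "B \<subseteq> span ?U" by blast
  then have "span B \<subseteq> span ?U" by (simp add: span_minimal)
  then have "T' \<subseteq> span ?U" using T'(2) by blast
  then have "T' = ?U" using spanning_subset_independent[OF U T'(3)] by blast
  moreover have "\<forall>b\<in>B. (card_of (F b), card_of B) \<in> ordLeq"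
    using finite_ordLeq_infinite_card[OF F(1) B] by simp
  then have "(card_of ?U, card_of B) \<in> ordLeq"
    by (rule card_of_UNION_ordLeq_infinite[OF B card_of_mono1[OF subset_refl]])
  ultimately have "(card_of T', card_of B) \<in> ordLeq" by (simp only:)
  then show ?thesis by (rule ordLeq_transitive[OF card_of_mono1[OF T'(1)]])
qed

lemma independent_finite_span:
  "independent T \<Longrightarrow> T \<subseteq> span B \<Longrightarrow> finite B \<Longrightarrow> finite T"
  using independent_span_bound by blast

section \<open>Traces and the finite-rank obstruction\<close>

text \<open>This is the trace of \<open>f\<close> on \<open>span B\<close> when \<open>B\<close> is
  finite and independent and \<open>f\<close> maps \<open>span B\<close> into itself. The basis can
  be chosen to suit the argument, whereas \<open>fr_trace\<close> fixes one by choice.\<close>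

definition tr :: "'b set \<Rightarrow> ('b \<Rightarrow> 'b) \<Rightarrow> 'a" where
  "tr B f = (\<Sum>b\<in>B. representation B (f b) b)"

lemma expand_basis:
  assumes "finite B" "independent B" "x \<in> span B"
  shows "x = (\<Sum>b\<in>B. representation B x b *s b)"
  using sum_representation_eq[OF assms(2,3,1) subset_refl] by simp

lemma lin_sum: "lin f \<Longrightarrow> f (\<Sum>b\<in>B. r b *s g b) = (\<Sum>b\<in>B. r b *s f (g b))"
  by (induction B rule: infinite_finite_induct) (simp_all add: lin_rules)

lemma representation_sum_scale:
  assumes "independent B" "\<And>i. i \<in> I \<Longrightarrow> g i \<in> span B"
  shows "representation B (\<Sum>i\<in>I. r i *s g i) b = (\<Sum>i\<in>I. r i * representation B (g i) b)"
  using assms(2)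
proof (induction I rule: infinite_finite_induct)
  case (insert i I)
  have "(\<Sum>i\<in>I. r i *s g i) \<in> span B" using insert by (intro span_sum span_scale) auto
  moreover have "r i *s g i \<in> span B" using insert by (intro span_scale) auto
  ultimately show ?case using insert
    by (simp add: representation_add[OF assms(1)] representation_scale[OF assms(1)])
qed (simp_all add: representation_zero)

text \<open>Expanding each \<open>b\<close> in \<open>C\<close>, and each \<open>f c\<close> in
  \<open>B\<close>, turns both traces into the same double sum; this is
  \<open>tr (P Q) = tr (Q P)\<close> for the change of basis.\<close>

lemma tr_basis_independent:
  assumes B: "finite B" "independent B" and C: "finite C" "independent C" and eq: "span B = span C"
    and f: "lin f" "\<And>x. x \<in> span B \<Longrightarrow> f x \<in> span B"
  shows "tr B f = tr C f"
proof -
  have fb: "f x \<in> span B" "f x \<in> span C" if "x \<in> B \<or> x \<in> C" for x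
    using that f(2) span_base eq by blast+
  have bC: "b \<in> span C" if "b \<in> B" for b using that span_base eq by blast
  have cB: "c \<in> span B" if "c \<in> C" for c using that span_base eq by blast
  have "tr B f = (\<Sum>b\<in>B. \<Sum>c\<in>C. representation C b c * representation B (f c) b)"
    unfolding tr_def
  proof (rule sum.cong[OF refl])
    fix b assume b: "b \<in> B"
    have "f b = f (\<Sum>c\<in>C. representation C b c *s c)" using expand_basis[OF C bC[OF b]] by simp
    also have "\<dots> = (\<Sum>c\<in>C. representation C b c *s f c)" by (rule lin_sum[OF f(1)])
    finally show "representation B (f b) b = (\<Sum>c\<in>C. representation C b c * representation B (f c) b)"
      using representation_sum_scale[OF B(2), of C f "representation C b" b] fb by simp
  qed
  also have "\<dots> = (\<Sum>c\<in>C. \<Sum>b\<in>B. representation B (f c) b * representation C b c)"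
    by (subst sum.swap) (simp add: mult.commute)
  also have "\<dots> = tr C f" unfolding tr_def
  proof (rule sum.cong[OF refl])
    fix c assume c: "c \<in> C"
    have "f c = (\<Sum>b\<in>B. representation B (f c) b *s b)" using expand_basis[OF B fb(1)] c by blast
    then show "(\<Sum>b\<in>B. representation B (f c) b * representation C b c) = representation C (f c) c"
      using representation_sum_scale[OF C(2), of B "\<lambda>b. b" "representation B (f c)" c] bC by simp
  qed
  finally show ?thesis .
qed

lemma tr_add:
  assumes "independent B" "\<And>b. b \<in> B \<Longrightarrow> f b \<in> span B" "\<And>b. b \<in> B \<Longrightarrow> g b \<in> span B"
  shows "tr B (\<lambda>x. f x + g x) = tr B f + tr B g"
  unfolding tr_def using assms by (simp add: representation_add sum.distrib)

lemma tr_scalar: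
  assumes "independent B"
  shows "tr B (\<lambda>x. r *s x) = of_nat (card B) * r"
  unfolding tr_def using assms
  by (simp add: representation_scale span_base representation_basis)

text \<open>The matrix has no entries in the rows outside \<open>B\<close>, so the additional
  diagonal entries vanish.\<close>

lemma tr_superset:
  assumes "finite C" "independent C" "B \<subseteq> C" "\<And>c. c \<in> C \<Longrightarrow> f c \<in> span B"
  shows "tr C f = tr B f"
proof -
  have iB: "independent B" using independent_mono[OF assms(2,3)] .
  have rep: "representation C (f c) = representation B (f c)" if "c \<in> C" for c
    using representation_extend[OF assms(2) assms(4)[OF that] assms(3)] .
  have "tr C f = (\<Sum>c\<in>C. representation B (f c) c)" unfolding tr_def using rep by simp
  also have "\<dots> = tr B f" unfolding tr_def
  proof (rule sum.mono_neutral_right[OF assms(1,3)])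
    show "\<forall>i\<in>C - B. representation B (f i) i = 0" using representation_ne_zero by blast
  qed
  finally show ?thesis .
qed

text \<open>The basis chosen in \<open>fr_trace\<close> spans only the image. Extending it to a
  basis of \<open>span B\<close> adds zero diagonal entries, and a change of basis then leads to
  \<open>B\<close>.\<close>

lemma fr_trace_eq_tr:
  assumes w: "lin w" and B: "finite B" "independent B" "\<And>x. w x \<in> span B"
  shows "fr_trace scale w = tr B w"
proof -
  obtain A where A: "A \<subseteq> range w" "independent A" "range w \<subseteq> span A"
    by (rule maximal_independent_subset)
  have sA: "span A = range w"
    using A span_minimal[OF A(1) P.linear_subspace_image[OF w subspace_UNIV]] by blast
  have "A \<subseteq> span B" using A(1) B(3) by blast
  then have "finite A" using independent_finite_span[OF A(2) _ B(1)] by blast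
  then have ex: "finite A \<and> is_basis_of scale A (range w)"
    unfolding is_basis_of_def using A sA by blast
  define C where "C = (SOME B. finite B \<and> is_basis_of scale B (range w))"
  have "finite C \<and> is_basis_of scale C (range w)" unfolding C_def by (rule someI[of _ A]) (rule ex)
  then have C: "finite C" "independent C" "span C = range w" unfolding is_basis_of_def by auto
  have fr: "fr_trace scale w = tr C w" unfolding fr_trace_def C_def tr_def Let_def ..
  have CB: "C \<subseteq> span B" using C(3) B(3) span_superset[of C] by auto
  obtain D where D: "C \<subseteq> D" "D \<subseteq> span B" "independent D" "span B \<subseteq> span D"
    using maximal_independent_subset_extend[OF CB C(2)] .
  have fD: "finite D" using independent_finite_span[OF D(3,2) B(1)] .
  have sD: "span D = span B" using D(4) span_minimal[OF D(2)] by blast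
  have "tr D w = tr C w"
    by (rule tr_superset[OF fD D(3,1)]) (simp add: C(3))
  moreover have "tr D w = tr B w"
    by (rule tr_basis_independent[OF fD D(3) B(1,2) sD w]) (simp add: B(3) sD)
  ultimately show ?thesis using fr by simp
qed

text \<open>In a basis extending one of the kernel, the vectors in the kernel contribute nothing and
  the others are mapped into the kernel, so the diagonal is zero.\<close>

lemma tr_square_zero:
  assumes f: "lin f" "square_zero f" and B: "finite B" "independent B" and inv: "\<And>b. b \<in> B \<Longrightarrow> f b \<in> span B"
  shows "tr B f = 0"
proof -
  have finv: "f x \<in> span B" if "x \<in> span B" for x using lin_span_into[OF f(1) subspace_span inv that] .
  let ?K = "{x \<in> span B. f x = 0}"
  obtain A where A: "A \<subseteq> ?K" "independent A" "?K \<subseteq> span A"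
    by (rule maximal_independent_subset)
  have AB: "A \<subseteq> span B" using A(1) by blast
  obtain D where D: "A \<subseteq> D" "D \<subseteq> span B" "independent D" "span B \<subseteq> span D"
    using maximal_independent_subset_extend[OF AB A(2)] .
  have fD: "finite D" using independent_finite_span[OF D(3,2) B(1)] .
  have sD: "span D = span B" using D(4) span_minimal[OF D(2)] by blast
  have "tr B f = tr D f"
    by (rule tr_basis_independent[OF B fD D(3) sD[symmetric] f(1) finv])
  also have "\<dots> = 0" unfolding tr_def
  proof (rule sum.neutral, rule ballI)
    fix d assume d: "d \<in> D"
    show "representation D (f d) d = 0"
    proof (cases "d \<in> A")
      case True
      then have "f d = 0" using A(1) by blast
      then show ?thesis by (simp add: representation_zero)
    next
      case False
      have "f d \<in> ?K" using f(2) finv[of d] D(2) d unfolding square_zero_def by auto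
      then have "f d \<in> span A" using A(3) by blast
      then have "representation D (f d) = representation A (f d)"
        using representation_extend[OF D(3) _ D(1)] by blast
      then show ?thesis using False representation_ne_zero by metis
    qed
  qed
  finally show ?thesis .
qed

lemma tr_conv_if_two_zero:
  assumes "l + l = (0::'a)"
  shows "of_nat n * l \<in> {0, l}"
proof (induction n)
  case (Suc n)
  then show ?case using assms by (auto simp: algebra_simps)
qed simp

lemma sum_sqz3_trace:
  assumes w: "lin w" and S0: "finite S0" "\<And>x. w x \<in> span S0" and l: "l + l = 0"
    and s: "sum_sqz3 (\<lambda>x. l *s x + w x)"
  shows "fr_trace scale w \<in> {0, l}"
proof -
  obtain a b c where a: "lin a" "square_zero a" and b: "lin b" "square_zero b" and c: "lin c" "square_zero c"
    and eq: "(\<lambda>x. l *s x + w x) = (\<lambda>x. a x + b x + c x)" using s unfolding sum_sqz3_def by blast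
  have c_eq: "c x = l *s x + w x - a x - b x" for x using fun_cong[OF eq, of x] by (simp add: algebra_simps)
  have aa: "a (a x) = 0" and bb: "b (b x) = 0" and cc: "c (c x) = 0" for x
    using a b c unfolding square_zero_def by auto
  have ll: "l *s x + l *s x = 0" for x using l by (metis scale_left_distrib scale_zero_left)
  \<comment> \<open>Expansion of \<open>c (c x) = 0\<close>: up to terms passing through
    \<open>w\<close>, the product \<open>b a\<close> equals \<open>- a b - l^2\<close>, the mixed
    terms with factor \<open>2 l\<close> being zero. This is why no products \<open>b a\<close> have
    to be added to \<open>S\<close> below.\<close>
  have ba: "b (a x) = w (a x) + w (b x) + a (w x) + b (w x) - a (b x) - l *s (l *s x) - l *s w x - w (l *s x + w x)" for x
  proof -
    have "0 = l *s c x + w (c x) - a (c x) - b (c x)" using cc[of x] c_eq[of "c x"] by simp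
    also have "\<dots> = l *s (l *s x) + l *s w x + w (l *s x + w x) - w (a x) - w (b x) - a (w x) - b (w x) + a (b x) + b (a x)
       - (l *s a x + l *s a x) - (l *s b x + l *s b x)"
      unfolding c_eq[of x]
      by (simp add: lin_rules[OF a(1)] lin_rules[OF b(1)] lin_rules[OF w] aa bb
          scale_right_distrib scale_right_diff_distrib algebra_simps)
    finally show ?thesis by (simp add: ll algebra_simps)
  qed
  define S where "S = S0 \<union> a ` S0 \<union> b ` S0 \<union> (\<lambda>x. a (b x)) ` S0"
  have fS: "finite S" unfolding S_def using S0(1) by simp
  have in0: "x \<in> span S" if "x \<in> span S0" for x
    using that span_mono[of S0 S] unfolding S_def by blast
  have ina: "a x \<in> span S" if "x \<in> span S0" for x
    by (rule lin_span_into[OF a(1) subspace_span _ that]) (auto simp: S_def intro: span_base)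
  have inb: "b x \<in> span S" if "x \<in> span S0" for x
    by (rule lin_span_into[OF b(1) subspace_span _ that]) (auto simp: S_def intro: span_base)
  have inab: "a (b x) \<in> span S" if "x \<in> span S0" for x
    by (rule lin_span_into[OF lin_compose[OF a(1) b(1)] subspace_span _ that]) (auto simp: S_def intro: span_base)
  have wS: "w x \<in> span S" for x using in0 S0(2) by blast
  note mem = span_add span_diff span_scale wS in0 ina inb inab S0(2)
  have aS: "a x \<in> span S" if "x \<in> S" for x
    using that unfolding S_def by (auto intro: ina inab span_base simp: aa span_zero)
  \<comment> \<open>Only \<open>b\<close> applied to \<open>a y\<close> and to
    \<open>a (b y)\<close> needs the relation \<open>ba\<close>, taken at \<open>y\<close> and at
    \<open>b y\<close>.\<close>
  have bS: "b x \<in> span S" if xS: "x \<in> S" for x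
  proof -
    consider "x \<in> S0" | y where "y \<in> S0" "x = a y" | y where "y \<in> S0" "x = b y" | y where "y \<in> S0" "x = a (b y)"
      using xS unfolding S_def by blast
    then show ?thesis
    proof cases
      case 1 then show ?thesis by (simp add: inb span_base)
    next
      case (2 y)
      then have y: "y \<in> span S0" by (simp add: span_base)
      show ?thesis unfolding 2(2) ba by (intro mem y)
    next
      case (3 y) then show ?thesis by (simp add: bb span_zero)
    next
      case (4 y)
      then have y: "y \<in> span S0" by (simp add: span_base)
      show ?thesis unfolding 4(2) ba bb lin_rules(5)[OF a(1)] by (intro mem y span_zero)
    qed
  qed
  obtain B where B: "B \<subseteq> S" "independent B" "S \<subseteq> span B"
    by (rule maximal_independent_subset)
  have fB: "finite B" using B(1) fS finite_subset by blast
  have sB: "span B = span S" using span_minimal[OF B(3)] span_mono[OF B(1)] by auto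
  have aB: "a x \<in> span B" and bB: "b x \<in> span B" and wB: "w x \<in> span B" if "x \<in> B" for x
    using that B(1) aS bS wS unfolding sB by blast+
  have lB: "l *s x \<in> span B" if "x \<in> B" for x using that by (intro span_scale span_base)
  have cB: "c x \<in> span B" if "x \<in> B" for x
    unfolding c_eq using that by (intro span_add span_diff lB aB bB wB)
  have "tr B (\<lambda>x. l *s x + w x) = tr B (\<lambda>x. l *s x) + tr B w"
    by (rule tr_add[OF B(2) lB wB])
  moreover have "tr B (\<lambda>x. a x + b x + c x) = (tr B a + tr B b) + tr B c"
    using tr_add[OF B(2), of "\<lambda>x. a x + b x" c] tr_add[OF B(2) aB bB] cB span_add[OF aB bB] by simp
  moreover have "tr B a = 0" "tr B b = 0" "tr B c = 0"
    using tr_square_zero[OF a fB B(2) aB] tr_square_zero[OF b fB B(2) bB] tr_square_zero[OF c fB B(2) cB] by auto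
  ultimately have "of_nat (card B) * l + tr B w = 0" using tr_scalar[OF B(2), of l] eq by simp
  \<comment> \<open>Since \<open>2 l = 0\<close>, the sign in \<open>tr w = - n l\<close> is
    immaterial, and only the parity of \<open>n\<close> matters.\<close>
  moreover have "of_nat (card B) * l + of_nat (card B) * l = 0"
    using l by (metis distrib_left mult_zero_right)
  ultimately have "tr B w = of_nat (card B) * l" by (metis add_left_imp_eq)
  moreover have "fr_trace scale w = tr B w"
    by (rule fr_trace_eq_tr[OF w fB B(2)]) (simp add: sB wS)
  ultimately show ?thesis using tr_conv_if_two_zero[OF l] by simp
qed

section \<open>The obstruction by dominant eigenvalues\<close>

lemma span_cong_scaled: "subspace W \<Longrightarrow> r \<noteq> 0 \<Longrightarrow> r *s x \<in> W \<Longrightarrow> x \<in> W"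
  using subspace_scale[of W "r *s x" "inverse r"] by simp

text \<open>When \<open>2 l\<close> is nonzero, \<open>a\<close> and \<open>b\<close> are forced to
  vanish modulo a subspace generated from the image of \<open>w\<close>, and then so does every
  vector. Four closure steps under \<open>a\<close> and \<open>b\<close> suffice, so the spanning
  set is finite or no larger than \<open>S0\<close>.\<close>

lemma sum_sqz3_spanning_set:
  assumes w: "lin w" and S0: "\<And>x. w x \<in> span S0" and l: "l \<noteq> 0" "(2::'a) \<noteq> 0"
    and s: "sum_sqz3 (\<lambda>x. l *s x + w x)"
  shows "\<exists>S. span S = UNIV \<and> (finite S0 \<longrightarrow> finite S) \<and> (infinite S0 \<longrightarrow> (card_of S, card_of S0) \<in> ordLeq)"
proof -
  obtain a b c where a: "lin a" "square_zero a" and b: "lin b" "square_zero b" and c: "lin c" "square_zero c"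
    and eq: "(\<lambda>x. l *s x + w x) = (\<lambda>x. a x + b x + c x)" using s unfolding sum_sqz3_def by blast
  have c_eq: "c x = l *s x + w x - a x - b x" for x using fun_cong[OF eq, of x] by (simp add: algebra_simps)
  have aa: "a (a x) = 0" and bb: "b (b x) = 0" and cc: "c (c x) = 0" for x
    using a b c unfolding square_zero_def by auto
  define step where "step = (\<lambda>B. B \<union> a ` B \<union> b ` B)"
  have stepD: "step B = B \<union> a ` B \<union> b ` B" for B by (simp add: step_def)
  \<comment> \<open>\<open>W i\<close> is spanned by the words of length at most \<open>i\<close> in
    \<open>a\<close> and \<open>b\<close>, applied to \<open>S0\<close>. Computing modulo increasing
    \<open>W i\<close> replaces a passage to a quotient and keeps control of the size.\<close>
  define W where "W = (\<lambda>i. span ((step ^^ i) S0))"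
  have sub: "subspace (W i)" for i unfolding W_def by simp
  have Suc: "x \<in> W (Suc i)" "a x \<in> W (Suc i)" "b x \<in> W (Suc i)" if x: "x \<in> W i" for x i
  proof -
    have x': "x \<in> span ((step ^^ i) S0)" using x unfolding W_def .
    show "x \<in> W (Suc i)" using x' span_mono[of "(step ^^ i) S0" "step ((step ^^ i) S0)"]
      unfolding W_def step_def by auto
    show "a x \<in> W (Suc i)" unfolding W_def
      by (rule lin_span_into[OF a(1) subspace_span _ x']) (auto simp: step_def intro: span_base)
    show "b x \<in> W (Suc i)" unfolding W_def
      by (rule lin_span_into[OF b(1) subspace_span _ x']) (auto simp: step_def intro: span_base)
  qed
  note mem = subspaceD[OF sub]
  note rules = lin_rules[OF a(1)] lin_rules[OF b(1)] lin_rules[OF w] aa bb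
    scale_right_distrib scale_right_diff_distrib
  have wW: "w x \<in> W 0" for x using S0 unfolding W_def by simp
  define t where "t = l + l"
  have t: "t \<noteq> 0" using l unfolding t_def by (metis mult_2 mult_eq_0_iff)
  \<comment> \<open>Expansion of \<open>c (c v) = 0\<close> modulo \<open>W 1\<close>, which
    contains the image of \<open>w\<close> together with \<open>a (w v)\<close> and
    \<open>b (w v)\<close>.\<close>
  have rel: "l *s (l *s v) - t *s a v - t *s b v + a (b v) + b (a v) \<in> W 1" for v
  proof -
    have "0 = l *s c v + w (c v) - a (c v) - b (c v)" using cc[of v] c_eq[of "c v"] by simp
    also have "l *s c v + w (c v) - a (c v) - b (c v)
      = (l *s (l *s v) - t *s a v - t *s b v + a (b v) + b (a v)) + (l *s w v + w (c v) - a (w v) - b (w v))"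
      unfolding t_def scale_left_distrib
      by (simp add: c_eq[of v] rules algebra_simps)
    finally have "l *s (l *s v) - t *s a v - t *s b v + a (b v) + b (a v)
        = - (l *s w v + w (c v) - a (w v) - b (w v))" by (metis eq_neg_iff_add_eq_0)
    moreover have "l *s w v + w (c v) - a (w v) - b (w v) \<in> W 1"
      using Suc[OF wW] by (intro mem) simp_all
    ultimately show ?thesis by (simp only: mem(5))
  qed
  \<comment> \<open>Compare \<open>a\<close> applied to the relation at \<open>v\<close> with the
    relation at \<open>a v\<close>. Both contain \<open>l^2 a\<close> and \<open>a b a\<close>; the
    difference is \<open>t (a b - b a)\<close>.\<close>
  have comm: "a (b v) - b (a v) \<in> W 2" for v
  proof -
    have "a (l *s (l *s v) - t *s a v - t *s b v + a (b v) + b (a v)) \<in> W 2"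
      using Suc(2)[OF rel[of v]] by (simp add: numeral_2_eq_2)
    moreover have "l *s (l *s a v) - t *s a (a v) - t *s b (a v) + a (b (a v)) + b (a (a v)) \<in> W 2"
      using Suc(1)[OF rel[of "a v"]] by (simp add: numeral_2_eq_2)
    ultimately have "(l *s (l *s a v) - t *s a (a v) - t *s b (a v) + a (b (a v)) + b (a (a v)))
       - a (l *s (l *s v) - t *s a v - t *s b v + a (b v) + b (a v)) \<in> W 2" by (rule mem(3)[rotated])
    also have "(l *s (l *s a v) - t *s a (a v) - t *s b (a v) + a (b (a v)) + b (a (a v)))
       - a (l *s (l *s v) - t *s a v - t *s b v + a (b v) + b (a v)) = t *s (a (b v) - b (a v))"
      by (simp add: rules algebra_simps)
    finally show ?thesis by (rule span_cong_scaled[OF sub t])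
  qed
  have one: "W i \<subseteq> W j" if "i \<le> j" for i j
    using that by (induction rule: dec_induct) (use Suc(1) in auto)
  \<comment> \<open>Commutation allows the relation to be written with \<open>2 a b\<close> alone or
    with \<open>2 b a\<close> alone.\<close>
  have half_ab: "l *s (l *s v) - t *s a v - t *s b v + (a (b v) + a (b v)) \<in> W 2"
    and half_ba: "l *s (l *s v) - t *s a v - t *s b v + (b (a v) + b (a v)) \<in> W 2" for v
  proof -
    have r: "l *s (l *s v) - t *s a v - t *s b v + a (b v) + b (a v) \<in> W 2" using rel one[of 1 2] by auto
    show "l *s (l *s v) - t *s a v - t *s b v + (a (b v) + a (b v)) \<in> W 2"
      using mem(2)[OF r comm[of v]] by (simp add: algebra_simps)
    show "l *s (l *s v) - t *s a v - t *s b v + (b (a v) + b (a v)) \<in> W 2"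
      using mem(3)[OF r comm[of v]] by (simp add: algebra_simps)
  qed
  \<comment> \<open>Applying \<open>a\<close> removes the terms that begin with \<open>a\<close>,
    and \<open>t = 2 l\<close> lets a factor \<open>l\<close> be cancelled.\<close>
  have av: "l *s a v - (a (b v) + a (b v)) \<in> W 3" for v
  proof -
    have "a (l *s (l *s v) - t *s a v - t *s b v + (a (b v) + a (b v))) \<in> W 3"
      using Suc(2)[OF half_ab[of v]] by (simp add: numeral_eq_Suc)
    also have "a (l *s (l *s v) - t *s a v - t *s b v + (a (b v) + a (b v))) = l *s (l *s a v - (a (b v) + a (b v)))"
      unfolding t_def scale_left_distrib by (simp add: rules algebra_simps)
    finally show ?thesis by (rule span_cong_scaled[OF sub l(1)])
  qed
  have bv: "l *s b v - (b (a v) + b (a v)) \<in> W 3" for v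
  proof -
    have "b (l *s (l *s v) - t *s a v - t *s b v + (b (a v) + b (a v))) \<in> W 3"
      using Suc(3)[OF half_ba[of v]] by (simp add: numeral_eq_Suc)
    also have "b (l *s (l *s v) - t *s a v - t *s b v + (b (a v) + b (a v))) = l *s (l *s b v - (b (a v) + b (a v)))"
      unfolding t_def scale_left_distrib by (simp add: rules algebra_simps)
    finally show ?thesis by (rule span_cong_scaled[OF sub l(1)])
  qed
  have diff: "a v - b v \<in> W 3" for v
  proof -
    have c3: "a (b v) - b (a v) \<in> W 3" using comm one[of 2 3] by auto
    have "(l *s a v - (a (b v) + a (b v))) - (l *s b v - (b (a v) + b (a v)))
       + ((a (b v) - b (a v)) + (a (b v) - b (a v))) \<in> W 3"
      by (rule mem(2)[OF mem(3)[OF av bv] mem(2)[OF c3 c3]])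
    then have "l *s (a v - b v) \<in> W 3" by (simp add: scale_right_diff_distrib algebra_simps)
    then show ?thesis by (rule span_cong_scaled[OF sub l(1)])
  qed
  \<comment> \<open>Applying \<open>a\<close> to \<open>a v - b v\<close> leaves
    \<open>- a (b v)\<close>. From here \<open>a v\<close>, \<open>b v\<close> and finally
    \<open>l^2 v\<close> are seen to lie in \<open>W 4\<close>.\<close>
  have ab: "a (b v) \<in> W 4" for v
    using mem(5)[OF Suc(2)[OF diff[of v]]] by (simp add: rules numeral_eq_Suc)
  have a4: "a v \<in> W 4" for v
  proof -
    have "l *s a v - (a (b v) + a (b v)) \<in> W 4" using av one[of 3 4] by auto
    then have "l *s a v - (a (b v) + a (b v)) + (a (b v) + a (b v)) \<in> W 4"
      by (rule mem(2)[OF _ mem(2)[OF ab ab]])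
    then have "l *s a v \<in> W 4" by simp
    then show ?thesis by (rule span_cong_scaled[OF sub l(1)])
  qed
  have b4: "b v \<in> W 4" for v
  proof -
    have "a v - b v \<in> W 4" using diff one[of 3 4] by auto
    then have "a v - (a v - b v) \<in> W 4" by (rule mem(3)[OF a4])
    then show ?thesis by simp
  qed
  have all: "v \<in> W 4" for v
  proof -
    have "l *s (l *s v) - t *s a v - t *s b v + (a (b v) + a (b v)) \<in> W 4" using half_ab one[of 2 4] by auto
    then have "l *s (l *s v) - t *s a v - t *s b v + (a (b v) + a (b v))
      - (a (b v) + a (b v)) + t *s b v + t *s a v \<in> W 4"
      by (intro mem(2)[OF mem(2)[OF mem(3)[OF _ mem(2)[OF ab ab]] mem(4)[OF b4]] mem(4)[OF a4]])
    then have "l *s (l *s v) \<in> W 4" by simp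
    then show ?thesis using span_cong_scaled[OF sub l(1)] by blast
  qed
  have fin: "finite S0 \<longrightarrow> finite ((step ^^ i) S0)" for i
    by (induction i) (auto simp: step_def)
  have inf: "infinite S0 \<longrightarrow> (card_of ((step ^^ i) S0), card_of S0) \<in> ordLeq" for i
  proof (induction i)
    case 0 then show ?case using card_of_mono1[of S0 S0] by simp
  next
    case (Suc i)
    show ?case
    proof
      assume i: "infinite S0"
      then have S: "(card_of ((step ^^ i) S0), card_of S0) \<in> ordLeq" using Suc by simp
      have im: "(card_of (f ` ((step ^^ i) S0)), card_of S0) \<in> ordLeq" for f :: "'b \<Rightarrow> 'b"
        by (rule ordLeq_transitive[OF card_of_image S])
      show "(card_of ((step ^^ Suc i) S0), card_of S0) \<in> ordLeq"
        by (simp add: stepD ordLeq_Un_infinite[OF i] S im)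
    qed
  qed
  show ?thesis using all fin inf unfolding W_def by (intro exI[of _ "(step ^^ 4) S0"]) blast
qed

section \<open>Nilpotent endomorphisms\<close>

text \<open>The linear map that kills \<open>S\<close> and fixes \<open>Z\<close> sends
  \<open>x\<close> both to zero and to \<open>x\<close>.\<close>

lemma independent_span_disjoint:
  assumes "independent (S \<union> Z)" "S \<inter> Z = {}" "x \<in> span S" "x \<in> span Z"
  shows "x = 0"
proof -
  obtain f where f: "lin f" "\<And>b. b \<in> S \<union> Z \<Longrightarrow> f b = (if b \<in> S then 0 else b)"
    using ex_lin[OF assms(1), of "\<lambda>b. if b \<in> S then 0 else b"] by blast
  have "f x = 0" by (rule lin_eq_on_span[OF f(1) lin_zero _ assms(3)]) (simp add: f(2))
  moreover have "f x = x" by (rule lin_eq_on_span[OF f(1) lin_ident _ assms(4)]) (use f(2) assms(2) in auto)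
  ultimately show ?thesis by simp
qed

text \<open>Add to \<open>A\<close> a complement of \<open>A + C\<close> in \<open>B\<close>. This
  enlarges \<open>A\<close> until it spans \<open>B\<close> together with \<open>C\<close>, without
  gaining any vector of \<open>C\<close>.\<close>

lemma relative_complement:
  assumes A: "subspace A" "A \<subseteq> B" and C: "subspace C" "C \<subseteq> B" and B: "subspace B"
  shows "\<exists>A'. subspace A' \<and> A \<subseteq> A' \<and> A' \<subseteq> B \<and> A' \<inter> C \<subseteq> A \<and> (\<forall>b\<in>B. \<exists>a\<in>A'. \<exists>c\<in>C. b = a + c)"
proof -
  obtain S where S: "S \<subseteq> span (A \<union> C)" "independent S" "span (A \<union> C) \<subseteq> span S"
    by (rule maximal_independent_subset)
  have sS: "span S = span (A \<union> C)" using S(3) span_minimal[OF S(1) subspace_span] by blast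
  have AC: "span (A \<union> C) \<subseteq> B" by (rule span_minimal[OF _ B]) (use A C in blast)
  have SB: "S \<subseteq> B" using S(1) AC by (rule subset_trans)
  obtain Z where Z: "Z \<subseteq> B" "independent (S \<union> Z)" "S \<inter> Z = {}" "B \<subseteq> span (S \<union> Z)"
    using independent_extends_within[OF S(2) SB] by blast
  let ?A = "span (A \<union> Z)"
  have sA: "span A = A" and sC: "span C = C" using A(1) C(1) by simp_all
  have "A \<subseteq> ?A" using span_superset[of "A \<union> Z"] by blast
  moreover have "?A \<subseteq> B" by (rule span_minimal[OF _ B]) (use A(2) Z(1) in blast)
  moreover have "?A \<inter> C \<subseteq> A"
  proof
    fix x assume x: "x \<in> ?A \<inter> C"
    then obtain p z where pz: "x = p + z" "p \<in> A" "z \<in> span Z" unfolding span_Un sA by blast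
    have "x \<in> span (A \<union> C)" "p \<in> span (A \<union> C)" using x pz by (auto intro: span_base)
    then have "x - p \<in> span S" unfolding sS by (rule span_diff)
    then have "z \<in> span S" using pz by simp
    then have "z = 0" using independent_span_disjoint[OF Z(2,3)] pz(3) by blast
    then show "x \<in> A" using pz by simp
  qed
  moreover have "\<exists>a\<in>?A. \<exists>c\<in>C. b = a + c" if "b \<in> B" for b
  proof -
    have "b \<in> span (S \<union> Z)" using that Z(4) by blast
    then obtain s z where sz: "b = s + z" "s \<in> span S" "z \<in> span Z" unfolding span_Un by blast
    from sz(2) obtain p q where pq: "s = p + q" "p \<in> A" "q \<in> C" unfolding sS span_Un sA sC by blast
    have "p + z \<in> ?A" unfolding span_Un sA using pq(2) sz(3) by blast
    moreover have "b = (p + z) + q" using sz pq by simp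
    ultimately show ?thesis using pq(3) by blast
  qed
  ultimately show ?thesis using subspace_span by blast
qed

text \<open>Induction on the nilpotency index, in place of a Jordan basis. The grading of the image
  of \<open>W\<close> is pulled back along \<open>T\<close> with parities switched; the kernel lies
  in both preimages and has to be divided between the two parts.\<close>

lemma nilpotent_odd_grading:
  assumes T: "lin T"
  shows "subspace W \<Longrightarrow> T ` W \<subseteq> W \<Longrightarrow> \<forall>x\<in>W. (T ^^ k) x = 0 \<Longrightarrow>
    \<exists>W0 W1. subspace W0 \<and> subspace W1 \<and> W0 \<subseteq> W \<and> W1 \<subseteq> W \<and> W0 \<inter> W1 \<subseteq> {0} \<and>
      (\<forall>x\<in>W. \<exists>p\<in>W0. \<exists>q\<in>W1. x = p + q) \<and> T ` W0 \<subseteq> W1 \<and> T ` W1 \<subseteq> W0"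
proof (induction k arbitrary: W)
  case 0
  then have "W \<subseteq> {0}" by auto
  then show ?case using 0 by (intro exI[of _ W]) (force simp: subspaceD)
next
  case (Suc k)
  note W = Suc.prems(1,2)
  have TT: "T x \<in> T ` W" if "x \<in> W" for x using that by blast
  have "\<forall>x\<in>T ` W. (T ^^ k) x = 0" using Suc.prems(3) by (simp add: funpow_swap1)
  moreover have "subspace (T ` W)" using P.linear_subspace_image[OF T W(1)] .
  moreover have "T ` (T ` W) \<subseteq> T ` W" using W(2) by blast
  ultimately obtain W0 W1 where sub: "subspace W0" "subspace W1" and le: "W0 \<subseteq> T ` W" "W1 \<subseteq> T ` W"
    and dis: "W0 \<inter> W1 \<subseteq> {0}" and cov: "\<And>x. x \<in> T ` W \<Longrightarrow> \<exists>p\<in>W0. \<exists>q\<in>W1. x = p + q"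
    and im: "T ` W0 \<subseteq> W1" "T ` W1 \<subseteq> W0"
    using Suc.IH[of "T ` W"] by metis
  note sD = subspaceD[OF W(1)] and s0 = subspaceD[OF sub(1)] and s1 = subspaceD[OF sub(2)]
  let ?K = "{x \<in> W. T x = 0}" and ?V0 = "{x \<in> W. T x \<in> W1}" and ?V1 = "{x \<in> W. T x \<in> W0}"
  have sK: "subspace ?K" by (rule subspaceI) (auto simp: lin_rules[OF T] sD)
  have sV0: "subspace ?V0" by (rule subspaceI) (auto simp: lin_rules[OF T] sD s1)
  have sV1: "subspace ?V1" by (rule subspaceI) (auto simp: lin_rules[OF T] sD s0)
  have KV: "?K \<subseteq> ?V0" "?K \<subseteq> ?V1" using s0(1) s1(1) by auto
  have WV: "W0 \<subseteq> ?V0" "W1 \<subseteq> ?V1" using le im W(2) by blast+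
  \<comment> \<open>Division of the kernel: \<open>W1 \<inter> ?K\<close> is to be odd, and
    \<open>K0\<close>, which contains \<open>W0 \<inter> ?K\<close>, is to be even.\<close>
  obtain K0 where K0: "subspace K0" "W0 \<inter> ?K \<subseteq> K0" "K0 \<subseteq> ?K" "K0 \<inter> (W1 \<inter> ?K) \<subseteq> W0 \<inter> ?K"
    "\<And>x. x \<in> ?K \<Longrightarrow> \<exists>p\<in>K0. \<exists>q\<in>W1 \<inter> ?K. x = p + q"
    using relative_complement[OF subspace_inter[OF sub(1) sK] Int_lower2 subspace_inter[OF sub(2) sK] Int_lower2 sK]
    by blast
  let ?A0 = "span (W0 \<union> K0)"
  have A0: "?A0 \<subseteq> ?V0" by (rule span_minimal[OF _ sV0]) (use WV(1) K0(3) KV(1) in blast)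
  \<comment> \<open>\<open>?V0\<close> and \<open>?V1\<close> are cut down until their kernel
    vectors lie in \<open>span (W0 \<union> K0)\<close> and in \<open>W1\<close>. Only kernel
    vectors are lost, so \<open>T\<close> takes the same values on the smaller spaces.\<close>
  obtain V0 where V0: "subspace V0" "?A0 \<subseteq> V0" "V0 \<subseteq> ?V0" "V0 \<inter> ?K \<subseteq> ?A0"
    "\<And>x. x \<in> ?V0 \<Longrightarrow> \<exists>p\<in>V0. \<exists>q\<in>?K. x = p + q"
    using relative_complement[OF subspace_span A0 sK KV(1) sV0] by blast
  obtain V1 where V1: "subspace V1" "W1 \<subseteq> V1" "V1 \<subseteq> ?V1" "V1 \<inter> ?K \<subseteq> W1"
    "\<And>x. x \<in> ?V1 \<Longrightarrow> \<exists>p\<in>V1. \<exists>q\<in>?K. x = p + q"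
    using relative_complement[OF sub(2) WV(2) sK KV(2) sV1] by blast
  have V0K: "x \<in> K0" if "x \<in> V0" "x \<in> ?K" for x
  proof -
    have "x \<in> ?A0" using V0(4) that by blast
    moreover have "span W0 = W0" "span K0 = K0" using sub(1) K0(1) by simp_all
    ultimately obtain p q where pq: "x = p + q" "p \<in> W0" "q \<in> K0" unfolding span_Un by blast
    have "x - q \<in> ?K" using that(2) pq(3) K0(3) by (intro subspace_diff[OF sK]) auto
    then have "p \<in> ?K" using pq(1) by simp
    then have "p \<in> K0" using pq(2) K0(2) by blast
    then show ?thesis using pq subspace_add[OF K0(1)] by blast
  qed
  have "V0 \<inter> V1 \<subseteq> {0}"
  proof
    fix x assume x: "x \<in> V0 \<inter> V1"
    then have "T x \<in> W0 \<inter> W1" "x \<in> W" using V0(3) V1(3) by auto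
    then have xK: "x \<in> ?K" using dis by blast
    then have "x \<in> K0" "x \<in> W1" using V0K V1(4) x by blast+
    then show "x \<in> {0}" using xK K0(4) dis by blast
  qed
  moreover have "\<exists>p\<in>V0. \<exists>q\<in>V1. x = p + q" if x: "x \<in> W" for x
  proof -
    \<comment> \<open>Lift the two components of \<open>T x\<close>. The remaining error
      \<open>k0 + k1\<close> lies in the kernel and splits by the choice of
      \<open>K0\<close>.\<close>
    obtain w0 w1 where w: "w0 \<in> W0" "w1 \<in> W1" "T x = w0 + w1" using cov[OF TT[OF x]] by blast
    then obtain y where y: "y \<in> W" "T y = w0" using le by blast
    then have "y \<in> ?V1" using w by simp
    then obtain v1 k1 where v1: "v1 \<in> V1" "k1 \<in> ?K" "y = v1 + k1" using V1(5) by blast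
    have "x - y \<in> ?V0" using x y w by (simp add: lin_rules[OF T] sD)
    then obtain v0 k0 where v0: "v0 \<in> V0" "k0 \<in> ?K" "x - y = v0 + k0" using V0(5) by blast
    have "k0 + k1 \<in> ?K" using v0 v1 subspace_add[OF sK] by blast
    then obtain p q where pq: "p \<in> K0" "q \<in> W1" "k0 + k1 = p + q" using K0(5) by blast
    have "x = (x - y) + y" by simp
    also have "\<dots> = (v0 + v1) + (k0 + k1)" unfolding v0(3) by (simp add: v1(3))
    also have "\<dots> = (v0 + p) + (v1 + q)" unfolding pq(3) by simp
    finally have "x = (v0 + p) + (v1 + q)" .
    moreover have "v0 + p \<in> V0" using v0(1) pq(1) V0(2) span_superset[of "W0 \<union> K0"]
      by (intro subspace_add[OF V0(1)]) auto
    moreover have "v1 + q \<in> V1" using v1(1) pq(2) V1(2) by (intro subspace_add[OF V1(1)]) auto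
    ultimately show ?thesis by blast
  qed
  moreover have "T ` V0 \<subseteq> V1" using V0(3) V1(2) by blast
  moreover have "T ` V1 \<subseteq> V0" using V1(3) V0(2) span_superset[of "W0 \<union> K0"] by blast
  moreover have "V0 \<subseteq> W" "V1 \<subseteq> W" using V0(3) V1(3) by blast+
  ultimately show ?case using V0(1) V1(1)
    by (intro exI[of _ V0] exI[of _ V1] conjI ballI) auto
qed

lemma nilpotent_sum_sqz2:
  assumes "lin T" "nilp_on T UNIV"
  shows "sum_sqz2 T"
proof -
  from assms(2) obtain k where "\<forall>x\<in>UNIV. (T ^^ k) x = 0" unfolding nilp_on_def by blast
  from nilpotent_odd_grading[OF assms(1) subspace_UNIV subset_UNIV this]
  obtain W0 W1 where *: "subspace W0" "subspace W1" "W0 \<inter> W1 \<subseteq> {0}"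
    "\<forall>x\<in>UNIV. \<exists>p\<in>W0. \<exists>q\<in>W1. x = p + q" "T ` W0 \<subseteq> W1" "T ` W1 \<subseteq> W0" by metis
  show ?thesis by (rule odd_grading_sum_sqz2[OF assms(1) *(1,2)]) (use * in blast)+
qed

section \<open>The commutator construction\<close>

text \<open>The map \<open>c\<close> is designed so that \<open>T = w - c\<close> satisfies
  \<open>T (e n) = e (\<sigma> n) + h n\<close> and \<open>T (h n) = \<Theta> n\<close>. Since
  \<open>\<phi> \<Theta> = h \<sigma>\<close>, this gives
  \<open>T^2 e = e (\<sigma>^2 + \<Theta>)\<close> on \<open>N\<close>, while \<open>T\<close> sends
  \<open>K1\<close> bijectively to \<open>K2\<close> and \<open>K2\<close> to zero. So
  \<open>E = e N + K1\<close> is preserved by \<open>T^2\<close>, and bijectivity of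
  \<open>\<Theta>\<close> makes the whole space the direct sum of \<open>E\<close> and
  \<open>T E\<close>.\<close>

lemma commutator_sum_sqz3:
  assumes w: "lin w" and injw: "inj_on w X" and wX: "w ` X \<subseteq> N"
    and ind: "independent (X \<union> N \<union> (K1 \<union> K2))" and sp: "span (X \<union> N \<union> (K1 \<union> K2)) = UNIV"
    and d1: "X \<inter> N = {}" and d2: "(X \<union> N) \<inter> (K1 \<union> K2) = {}" and d3: "K1 \<inter> K2 = {}"
    and \<kappa>: "bij_betw \<kappa> K1 K2"
    and wK1: "\<And>k. k \<in> K1 \<Longrightarrow> w k \<in> span X" and wK2: "\<And>k. k \<in> K2 \<Longrightarrow> w k = 0"
    and \<Theta>: "lin \<Theta>" "bij_betw \<Theta> N (w ` X)"
    and \<Omega>: "lin \<Omega>" "\<And>n. n \<in> N \<Longrightarrow> \<Omega> n \<in> span N"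
    and comm: "\<And>n. n \<in> N \<Longrightarrow> w n - (\<Omega> (\<Theta> n) - \<Theta> (\<Omega> n)) \<in> span X"
    and l: "l + l = 0"
  shows "sum_sqz3 (\<lambda>x. l *s x + w x)"
proof -
  let ?B = "X \<union> N \<union> (K1 \<union> K2)"
  have ind': "independent A" if "A \<subseteq> ?B" for A using independent_mono[OF ind that] .
  \<comment> \<open>On the span of the image of \<open>X\<close>, the map \<open>\<xi>\<close>
    inverts \<open>w\<close>.\<close>
  obtain \<xi> where \<xi>: "lin \<xi>" "\<And>y. y \<in> ?B \<Longrightarrow> \<xi> y = inv_into X w y"
    using ex_lin[OF ind, of "inv_into X w"] by blast
  have \<xi>w: "\<xi> (w x) = x" if "x \<in> X" for x
    using \<xi>(2)[of "w x"] wX inv_into_f_f[OF injw that] that by auto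
  have \<Theta>N: "\<Theta> n \<in> span (w ` X)" if "n \<in> span N" for n
    by (rule lin_span_into[OF \<Theta>(1) subspace_span _ that]) (use bij_betwE[OF \<Theta>(2)] in \<open>blast intro: span_base\<close>)
  have wXN: "span (w ` X) \<subseteq> span N" by (rule span_mono[OF wX])
  have \<Omega>N: "\<Omega> n \<in> span N" if "n \<in> span N" for n
    by (rule lin_span_into[OF \<Omega>(1) subspace_span \<Omega>(2) that])
  have \<xi>X: "\<xi> y \<in> span X" if "y \<in> span (w ` X)" for y
    by (rule lin_span_into[OF \<xi>(1) subspace_span _ that]) (auto simp: \<xi>w intro: span_base)
  have w\<xi>: "w (\<xi> y) = y" if "y \<in> span (w ` X)" for y
    by (rule lin_eq_on_span[OF lin_compose[OF w \<xi>(1)] lin_ident _ that]) (auto simp: \<xi>w)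
  \<comment> \<open>\<open>e\<close> is the identity perturbed by a map into \<open>span X\<close>.
    The perturbation contributes \<open>w (\<phi> n) = \<Theta> (\<Omega> n)\<close>, the half of
    the commutator that \<open>\<sigma> = \<Omega> \<Theta>\<close> lacks.\<close>
  define \<phi> where "\<phi> = (\<lambda>v. \<xi> (\<Theta> (\<Omega> v)))"
  define e where "e = (\<lambda>v. v + \<phi> v)"
  define \<sigma> where "\<sigma> = (\<lambda>v. \<Omega> (\<Theta> v))"
  define h where "h = (\<lambda>v. \<xi> (\<Theta> v))"
  have lin\<phi>: "lin \<phi>" unfolding \<phi>_def by (rule lin_compose[OF \<xi>(1) lin_compose[OF \<Theta>(1) \<Omega>(1)]])
  have lin': "lin \<phi>" "lin e" "lin \<sigma>" "lin h"
    unfolding e_def \<sigma>_def h_def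
    by (rule lin\<phi> lin_add[OF lin_ident lin\<phi>] lin_compose[OF \<Omega>(1) \<Theta>(1)] lin_compose[OF \<xi>(1) \<Theta>(1)])+
  have \<phi>X: "\<phi> n \<in> span X" if "n \<in> span N" for n unfolding \<phi>_def using \<Omega>N \<Theta>N \<xi>X that by blast
  have hX: "h n \<in> span X" if "n \<in> span N" for n unfolding h_def using \<Theta>N \<xi>X that by blast
  have \<sigma>N: "\<sigma> n \<in> span N" if "n \<in> span N" for n unfolding \<sigma>_def using \<Theta>N \<Omega>N wXN that by blast
  \<comment> \<open>On \<open>N\<close> and \<open>K1\<close> the values are read off from the
    wanted equations \<open>T (e n) = e (\<sigma> n) + h n\<close> and
    \<open>T k = \<kappa> k\<close>.\<close>
  obtain c where c: "lin c" "\<And>b. b \<in> ?B \<Longrightarrow> c b = (if b \<in> N then w (e b) - e (\<sigma> b) - h b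
      else if b \<in> K1 then w b - \<kappa> b else 0)"
    using ex_lin[OF ind, of "\<lambda>b. if b \<in> N then w (e b) - e (\<sigma> b) - h b
      else if b \<in> K1 then w b - \<kappa> b else 0"] by blast
  have cX: "c x = 0" if "x \<in> span X" for x
    by (rule lin_eq_on_span[OF c(1) lin_zero _ that]) (use c(2) d1 d2 in auto)
  have cN: "c n = w (e n) - e (\<sigma> n) - h n" if "n \<in> span N" for n
    by (rule lin_eq_on_span[OF c(1) lin_diff[OF lin_diff[OF lin_compose[OF w lin'(2)] lin_compose[OF lin'(2,3)]] lin'(4)] _ that])
      (use c(2) in auto)
  have cK1: "c k = w k - \<kappa> k" if "k \<in> K1" for k using that c(2)[of k] d2 by auto
  have cK2: "c k = 0" if "k \<in> K2" for k using that c(2)[of k] d2 d3 by auto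
  \<comment> \<open>The commutator equation enters here: it puts \<open>c n\<close> into
    \<open>span X\<close>, where \<open>c\<close> vanishes.\<close>
  have cNX: "c n \<in> span X" if n: "n \<in> N" for n
  proof -
    have n': "n \<in> span N" using n by (rule span_base)
    have "w (e n) = w n + \<Theta> (\<Omega> n)" unfolding e_def \<phi>_def lin_rules(1)[OF w]
      using w\<xi>[OF \<Theta>N[OF \<Omega>N[OF n']]] by simp
    then have "c n = (w n - (\<Omega> (\<Theta> n) - \<Theta> (\<Omega> n))) - \<phi> (\<sigma> n) - h n"
      unfolding cN[OF n'] e_def by (simp add: \<sigma>_def)
    then show ?thesis using comm[OF n] \<phi>X[OF \<sigma>N[OF n']] hX[OF n'] by (simp add: span_diff)
  qed
  have cc: "c (c b) = 0" if bB: "b \<in> ?B" for b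
  proof -
    consider "b \<in> X" | "b \<in> N" | "b \<in> K1" | "b \<in> K2" using bB by blast
    then show ?thesis
    proof cases
      case 1 then show ?thesis using cX[OF span_base] by (simp add: lin_rules[OF c(1)])
    next
      case 2 then show ?thesis using cX[OF cNX] by simp
    next
      case 3
      then have "\<kappa> b \<in> K2" using \<kappa> by (auto simp: bij_betw_def)
      then show ?thesis using 3 cX[OF wK1[OF 3]] cK2 by (simp add: cK1 lin_rules[OF c(1)])
    next
      case 4 then show ?thesis by (simp add: cK2 lin_rules[OF c(1)])
    qed
  qed
  have sq: "square_zero c" unfolding square_zero_def
  proof
    fix x
    have "x \<in> span ?B" using sp by simp
    from lin_eq_on_span[OF lin_compose[OF c(1) c(1)] lin_zero cc this] show "c (c x) = 0" .
  qed
  define T where "T = (\<lambda>x. w x - c x)"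
  have T: "lin T" unfolding T_def by (rule lin_diff[OF w c(1)])
  have Te: "T (e n) = e (\<sigma> n) + h n" if n: "n \<in> span N" for n
  proof -
    have "c (e n) = c n" unfolding e_def using cX[OF \<phi>X[OF n]] by (simp add: lin_rules[OF c(1)])
    then show ?thesis unfolding T_def cN[OF n] by simp
  qed
  have Th: "T (h n) = \<Theta> n" if n: "n \<in> span N" for n
    unfolding T_def using cX[OF hX[OF n]] w\<xi>[OF \<Theta>N[OF n]] by (simp add: h_def)
  have TTe: "T (T (e n)) = e (\<sigma> (\<sigma> n) + \<Theta> n)" if n: "n \<in> span N" for n
  proof -
    have "T (T (e n)) = e (\<sigma> (\<sigma> n)) + (h (\<sigma> n) + \<Theta> n)"
      using Te[OF n] Te[OF \<sigma>N[OF n]] Th[OF n] by (simp add: lin_rules[OF T])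
    also have "h (\<sigma> n) + \<Theta> n = e (\<Theta> n)" by (simp add: e_def \<phi>_def h_def \<sigma>_def)
    finally show ?thesis by (simp add: lin_rules[OF lin'(2)])
  qed
  have Tk: "T k = \<kappa> k" if "k \<in> K1" for k unfolding T_def using cK1[OF that] by simp
  have TK2: "T k = 0" if "k \<in> span K2" for k
    by (rule lin_eq_on_span[OF T lin_zero _ that]) (simp add: T_def wK2 cK2)
  have TkK2: "T k \<in> span K2" if "k \<in> span K1" for k
    by (rule lin_span_into[OF T subspace_span _ that]) (use \<kappa> in \<open>auto simp: Tk bij_betw_def intro: span_base\<close>)
  define E where "E = span (e ` N \<union> K1)"
  have E_iff: "v \<in> E \<longleftrightarrow> (\<exists>n\<in>span N. \<exists>k\<in>span K1. v = e n + k)" for v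
    unfolding E_def span_Un P.linear_span_image[OF lin'(2)] by blast
  have EI: "e n \<in> E" if "n \<in> span N" for n unfolding E_iff using that span_zero[of K1] by force
  have KI: "k \<in> E" if "k \<in> span K1" for k unfolding E_iff
    using that span_zero[of N] lin_rules(5)[OF lin'(2)] by force
  have sE: "subspace E" unfolding E_def by simp
  obtain \<kappa>' where \<kappa>': "lin \<kappa>'" "\<And>b. b \<in> K2 \<Longrightarrow> \<kappa>' b = inv_into K1 \<kappa> b"
    using ex_lin[OF ind'[of K2], of "inv_into K1 \<kappa>"] by blast
  have \<kappa>'T: "\<kappa>' (T k) = k" if "k \<in> span K1" for k
    by (rule lin_eq_on_span[OF lin_compose[OF \<kappa>'(1) T] lin_ident _ that])
      (simp only: Tk \<kappa>'(2)[OF bij_betw_apply[OF \<kappa>]] bij_betw_inv_into_left[OF \<kappa>])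
  obtain \<theta>' where \<theta>': "lin \<theta>'" "\<And>b. b \<in> w ` X \<Longrightarrow> \<theta>' b = inv_into N \<Theta> b"
    using ex_lin[OF ind'[of "w ` X"], of "inv_into N \<Theta>"] wX by blast
  have \<theta>'\<Theta>: "\<theta>' (\<Theta> n) = n" if "n \<in> span N" for n
    by (rule lin_eq_on_span[OF lin_compose[OF \<theta>'(1) \<Theta>(1)] lin_ident _ that])
      (simp only: \<theta>'(2)[OF bij_betw_apply[OF \<Theta>(2)]] bij_betw_inv_into_left[OF \<Theta>(2)])
  \<comment> \<open>Compare the components along \<open>K2\<close>, \<open>K1\<close>,
    \<open>N\<close> and \<open>X\<close> in turn. The last one gives \<open>h n = 0\<close>, hence
    \<open>n = 0\<close> because \<open>\<Theta>\<close> is injective.\<close>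
  have disj: "x = 0" if x: "x \<in> E" and Tx: "T x \<in> E" for x
  proof -
    obtain n k where nk: "n \<in> span N" "k \<in> span K1" "x = e n + k" using x E_iff by blast
    obtain m j where mj: "m \<in> span N" "j \<in> span K1" "T x = e m + j" using Tx E_iff by blast
    have eq: "e (\<sigma> n) + h n + T k = e m + j" using mj(3) Te[OF nk(1)] unfolding nk(3) by (simp add: lin_rules[OF T])
    have up: "span X \<subseteq> span (X \<union> N)" "span N \<subseteq> span (X \<union> N)"
      "span (X \<union> N) \<subseteq> span (X \<union> N \<union> K1)" "span K1 \<subseteq> span (X \<union> N \<union> K1)" by (auto intro!: span_mono)
    have eXN: "e v \<in> span (X \<union> N)" if "v \<in> span N" for v
      unfolding e_def using that \<phi>X up by (intro span_add) auto
    have hXN: "h n \<in> span (X \<union> N)" using hX[OF nk(1)] up by auto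
    have "T k = (e m - e (\<sigma> n) - h n) + j" using eq by (simp add: algebra_simps)
    moreover have a: "e m - e (\<sigma> n) - h n \<in> span (X \<union> N)"
      using eXN[OF mj(1)] eXN[OF \<sigma>N[OF nk(1)]] hXN by (intro span_diff)
    ultimately have "T k \<in> span (X \<union> N \<union> K1)" using mj(2) up by (auto intro: span_add)
    then have "T k = 0" using independent_span_disjoint[of "X \<union> N \<union> K1" K2 "T k"] TkK2[OF nk(2)] ind d2 d3
      by (auto simp: Un_assoc)
    then have k0: "k = 0" using \<kappa>'T[OF nk(2)] by (simp add: lin_rules[OF \<kappa>'(1)])
    have "j = - (e m - e (\<sigma> n) - h n)" using eq \<open>T k = 0\<close> by (simp add: algebra_simps)
    then have "j \<in> span (X \<union> N)" using a span_neg by metis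
    moreover have "(X \<union> N) \<inter> K1 = {}" using d2 by blast
    ultimately have j0: "j = 0"
      using independent_span_disjoint[of "X \<union> N" K1 j] mj(2) ind'[of "X \<union> N \<union> K1"] by blast
    have eq2: "\<sigma> n - m = \<phi> m - \<phi> (\<sigma> n) - h n"
      using eq \<open>T k = 0\<close> j0 unfolding e_def by (simp add: algebra_simps)
    have "\<phi> m - \<phi> (\<sigma> n) - h n \<in> span X" using \<phi>X[OF mj(1)] \<phi>X[OF \<sigma>N[OF nk(1)]] hX[OF nk(1)] by (intro span_diff)
    moreover have "\<sigma> n - m \<in> span N" using \<sigma>N[OF nk(1)] mj(1) by (intro span_diff)
    ultimately have "\<sigma> n - m = 0"
      using independent_span_disjoint[of X N "\<sigma> n - m"] d1 ind'[of "X \<union> N"] eq2 by auto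
    then have "h n = 0" using eq2 by simp
    then have "\<Theta> n = 0" using Th[OF nk(1)] by (simp add: lin_rules[OF T])
    then have "n = 0" using \<theta>'\<Theta>[OF nk(1)] by (simp add: lin_rules[OF \<theta>'(1)])
    then show ?thesis using k0 nk(3) by (simp add: lin_rules[OF lin'(2)])
  qed
  have cover: "\<exists>p\<in>E. \<exists>q\<in>E. v = p + T q" for v
  proof -
    let ?R = "span (E \<union> T ` E)"
    have inE: "p \<in> ?R" and inT: "T p \<in> ?R" if "p \<in> E" for p using that by (auto intro: span_base)
    \<comment> \<open>Each \<open>x\<close> is \<open>h n\<close> for the \<open>n\<close> with
      \<open>\<Theta> n = w x\<close>, and \<open>h n\<close> is the difference of
      \<open>T (e n)\<close> and \<open>e (\<sigma> n)\<close>.\<close>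
    have RX: "x \<in> ?R" if "x \<in> X" for x
    proof -
      have "w x \<in> \<Theta> ` N" using \<Theta>(2) that by (auto simp: bij_betw_def)
      then obtain n where n: "n \<in> N" "w x = \<Theta> n" by blast
      then have n': "n \<in> span N" by (simp add: span_base)
      have "x = h n" using \<xi>w[OF that] n(2) by (simp add: h_def)
      then have "x = T (e n) - e (\<sigma> n)" using Te[OF n'] by simp
      then show ?thesis using inT[OF EI[OF n']] inE[OF EI[OF \<sigma>N[OF n']]] by (simp add: span_diff)
    qed
    have RX': "span X \<subseteq> ?R" by (rule span_minimal) (use RX in auto)
    have "b \<in> ?R" if "b \<in> ?B" for b
    proof -
      consider "b \<in> X" | "b \<in> N" | "b \<in> K1" | "b \<in> K2" using \<open>b \<in> ?B\<close> by blast
      then show ?thesis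
      proof cases
        case 1 then show ?thesis by (rule RX)
      next
        case 2
        then have b: "b \<in> span N" by (rule span_base)
        have "b = e b - \<phi> b" by (simp add: e_def)
        then show ?thesis using inE[OF EI[OF b]] RX' \<phi>X[OF b] by (metis span_diff subsetD)
      next
        case 3 then show ?thesis using inE[OF KI] span_base by blast
      next
        case 4
        then obtain k where "k \<in> K1" "b = \<kappa> k" using \<kappa> by (auto simp: bij_betw_def)
        then show ?thesis using inT[OF KI[OF span_base]] Tk by simp
      qed
    qed
    then have "span ?B \<subseteq> ?R" by (intro span_minimal) auto
    then have "v \<in> ?R" using sp by auto
    moreover have "span E = E" "span (T ` E) = T ` E"
      using sE P.linear_subspace_image[OF T sE] by simp_all
    ultimately show ?thesis unfolding span_Un by auto
  qed
  have TT: "T (T x) \<in> E" if x: "x \<in> E" for x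
  proof -
    obtain n k where nk: "n \<in> span N" "k \<in> span K1" "x = e n + k" using x E_iff by blast
    have "T (T x) = e (\<sigma> (\<sigma> n) + \<Theta> n)"
      using TTe[OF nk(1)] TK2[OF TkK2[OF nk(2)]] unfolding nk(3) by (simp add: lin_rules[OF T])
    moreover have "\<sigma> (\<sigma> n) + \<Theta> n \<in> span N" using \<sigma>N \<Theta>N wXN nk(1) by (intro span_add) auto
    ultimately show ?thesis using EI by simp
  qed
  have "sum_sqz2 (\<lambda>x. T x + l *s x)" by (rule doubling_sum_sqz2[OF T sE disj cover TT l])
  moreover have "(\<lambda>x. T x + l *s x) = (\<lambda>x. (l *s x + w x) - c x)" by (auto simp: T_def)
  ultimately show ?thesis using sum_sqz3I[OF c(1) sq] by simp
qed

lemma ex_compression: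
  assumes w: "lin w" and ind: "independent (X \<union> N)" and im: "\<And>n. n \<in> N \<Longrightarrow> w n \<in> span (X \<union> N)"
  shows "\<exists>D. lin D \<and> (\<forall>n\<in>N. D n \<in> span N \<and> w n - D n \<in> span X)"
proof -
  have "\<forall>n\<in>N. \<exists>d. d \<in> span N \<and> w n - d \<in> span X"
  proof
    fix n assume "n \<in> N"
    then obtain p q where "p \<in> span X" "q \<in> span N" "w n = p + q" using im unfolding span_Un by blast
    then show "\<exists>d. d \<in> span N \<and> w n - d \<in> span X" by (intro exI[of _ q]) simp
  qed
  then obtain d where d: "\<And>n. n \<in> N \<Longrightarrow> d n \<in> span N \<and> w n - d n \<in> span X" by metis
  obtain D where "lin D" "\<And>n. n \<in> N \<Longrightarrow> D n = d n"
    using ex_lin[OF independent_mono[OF ind, of N], of d] by auto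
  then show ?thesis using d by auto
qed

text \<open>\<open>\<Theta>\<close> is a pure shift with wandering basis \<open>Z\<close>, so \<open>\<Omega> \<Theta> - \<Theta> \<Omega> = D\<close> can be solved
  recursively for every \<open>D\<close>.\<close>

lemma shift_sum_sqz3:
  assumes w: "lin w" and injw: "inj_on w X"
    and ind: "independent (X \<union> (w ` X \<union> Z) \<union> (K1 \<union> K2))" and sp: "span (X \<union> (w ` X \<union> Z) \<union> (K1 \<union> K2)) = UNIV"
    and d1: "X \<inter> (w ` X \<union> Z) = {}" and dZ: "w ` X \<inter> Z = {}"
    and d2: "(X \<union> (w ` X \<union> Z)) \<inter> (K1 \<union> K2) = {}" and d3: "K1 \<inter> K2 = {}"
    and \<kappa>: "bij_betw \<kappa> K1 K2"
    and wK: "\<And>k. k \<in> K1 \<union> K2 \<Longrightarrow> w k = 0"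
    and wN: "\<And>n. n \<in> w ` X \<union> Z \<Longrightarrow> w n \<in> span (X \<union> (w ` X \<union> Z))"
    and g: "bij_betw g (Z \<times> (UNIV :: nat set)) (w ` X)"
    and l: "l + l = 0"
  shows "sum_sqz3 (\<lambda>x. l *s x + w x)"
proof -
  let ?N = "w ` X \<union> Z"
  have indN: "independent ?N" "independent (X \<union> ?N)" using independent_mono[OF ind] by auto
  obtain D where D: "lin D" "\<And>n. n \<in> ?N \<Longrightarrow> D n \<in> span ?N \<and> w n - D n \<in> span X"
    using ex_compression[OF w indN(2) wN] by blast
  \<comment> \<open>Each \<open>z\<close> in \<open>Z\<close> starts a chain
    \<open>z, g (z, 0), g (z, 1), ...\<close>. The chains are disjoint and exhaust
    \<open>?N\<close>, and moving one place along them carries \<open>?N\<close> onto the image of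
    \<open>X\<close>.\<close>
  define f where "f = (\<lambda>z n. case n of 0 \<Rightarrow> z | Suc m \<Rightarrow> g (z, m))"
  have f0: "f z 0 = z" and fS: "f z (Suc n) = g (z, n)" for z n by (simp_all add: f_def)
  have gi: "inj_on g (Z \<times> UNIV)" and gim: "g ` (Z \<times> UNIV) = w ` X" using g by (auto simp: bij_betw_def)
  have fSX: "f z (Suc n) \<in> w ` X" if "z \<in> Z" for z n using gim that unfolding fS by blast
  have fN: "f z n \<in> ?N" if "z \<in> Z" for z n using fSX[OF that] that f0 by (cases n) auto
  have fcov: "\<exists>z\<in>Z. \<exists>n. y = f z n" if "y \<in> ?N" for y
  proof (cases "y \<in> Z")
    case True then show ?thesis using f0[of y] by metis
  next
    case False
    then have "y \<in> g ` (Z \<times> UNIV)" using that gim by blast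
    then obtain z n where "z \<in> Z" "y = g (z, n)" by blast
    then show ?thesis using fS[of z n] by metis
  qed
  have finj: "z = z' \<and> n = n'" if "z \<in> Z" "z' \<in> Z" "f z n = f z' n'" for z z' n n'
  proof (cases n; cases n')
    fix m m' assume n: "n = Suc m" "n' = Suc m'"
    have "(z, m) = (z', m')" using inj_onD[OF gi, of "(z, m)" "(z', m')"] that n by (simp add: fS)
    then show ?thesis using n by simp
  next
    fix m assume n: "n = 0" "n' = Suc m"
    then show ?thesis using fSX[OF that(2), of m] that f0[of z] dZ by auto
  next
    fix m assume n: "n = Suc m" "n' = 0"
    then show ?thesis using fSX[OF that(1), of m] that f0[of z'] dZ by auto
  qed (use that f0 in auto)
  define ix where "ix = (\<lambda>y. SOME p. fst p \<in> Z \<and> y = f (fst p) (snd p))"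
  have ix: "ix (f z n) = (z, n)" if "z \<in> Z" for z n
  proof -
    have "fst (ix (f z n)) \<in> Z \<and> f z n = f (fst (ix (f z n))) (snd (ix (f z n)))"
      unfolding ix_def by (rule someI[of _ "(z, n)"]) (simp add: that)
    then have "z = fst (ix (f z n)) \<and> n = snd (ix (f z n))" by (intro finj that) auto
    then show ?thesis by (metis prod.collapse)
  qed
  obtain \<Theta> where \<Theta>: "lin \<Theta>" "\<And>y. y \<in> ?N \<Longrightarrow> \<Theta> y = f (fst (ix y)) (Suc (snd (ix y)))"
    using ex_lin[OF indN(1), of "\<lambda>y. f (fst (ix y)) (Suc (snd (ix y)))"] by blast
  have \<Theta>f: "\<Theta> (f z n) = f z (Suc n)" if "z \<in> Z" for z n using \<Theta>(2)[OF fN[OF that]] ix[OF that] by simp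
  \<comment> \<open>The equation \<open>\<Omega> \<Theta> = \<Theta> \<Omega> + D\<close> read along
    a chain, started at \<open>0\<close>. The chains never close up, so no consistency condition
    arises.\<close>
  define om where "om = (\<lambda>z. rec_nat 0 (\<lambda>n r. \<Theta> r + D (f z n)))"
  have om0: "om z 0 = 0" and omS: "om z (Suc n) = \<Theta> (om z n) + D (f z n)" for z n by (simp_all add: om_def)
  obtain \<Omega> where \<Omega>: "lin \<Omega>" "\<And>y. y \<in> ?N \<Longrightarrow> \<Omega> y = om (fst (ix y)) (snd (ix y))"
    using ex_lin[OF indN(1), of "\<lambda>y. om (fst (ix y)) (snd (ix y))"] by blast
  have \<Omega>f: "\<Omega> (f z n) = om z n" if "z \<in> Z" for z n using \<Omega>(2)[OF fN[OF that]] ix[OF that] by simp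
  have \<Theta>N: "\<Theta> v \<in> span ?N" if "v \<in> span ?N" for v
  proof (rule lin_span_into[OF \<Theta>(1) subspace_span _ that])
    fix b assume "b \<in> ?N"
    then obtain z n where "z \<in> Z" "b = f z n" using fcov by blast
    then show "\<Theta> b \<in> span ?N" using \<Theta>f fN span_base by metis
  qed
  have omN: "om z n \<in> span ?N" if "z \<in> Z" for z n
    by (induction n) (use D(2)[OF fN[OF that]] in \<open>auto simp: om0 omS span_zero intro: span_add \<Theta>N\<close>)
  have bij: "bij_betw \<Theta> ?N (w ` X)"
  proof -
    have "inj_on \<Theta> ?N"
    proof
      fix x y assume "x \<in> ?N" "y \<in> ?N" and eq: "\<Theta> x = \<Theta> y"
      then obtain z n z' n' where *: "z \<in> Z" "x = f z n" "z' \<in> Z" "y = f z' n'" using fcov by meson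
      then have "f z (Suc n) = f z' (Suc n')" using eq \<Theta>f by simp
      then show "x = y" using finj[OF *(1,3)] * by blast
    qed
    moreover have "\<Theta> ` ?N = w ` X"
    proof
      show "\<Theta> ` ?N \<subseteq> w ` X" proof
        fix v assume "v \<in> \<Theta> ` ?N"
        then obtain n where n: "n \<in> ?N" "v = \<Theta> n" by blast
        then obtain z m where "z \<in> Z" "n = f z m" using fcov by blast
        then show "v \<in> w ` X" using \<Theta>f fSX n(2) by simp
      qed
      show "w ` X \<subseteq> \<Theta> ` ?N"
      proof
        fix y assume "y \<in> w ` X"
        then obtain z n where "z \<in> Z" "y = g (z, n)" using gim by force
        then have "y = \<Theta> (f z n)" using \<Theta>f fS by simp
        then show "y \<in> \<Theta> ` ?N" using fN[OF \<open>z \<in> Z\<close>] by blast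
      qed
    qed
    ultimately show ?thesis by (simp add: bij_betw_def)
  qed
  show ?thesis
  proof (rule commutator_sum_sqz3[OF w injw _ ind sp d1 d2 d3 \<kappa> _ _ \<Theta>(1) bij \<Omega>(1) _ _ l])
    show "w ` X \<subseteq> ?N" by blast
    show "w k \<in> span X" if "k \<in> K1" for k using wK that by (simp add: span_zero)
    show "w k = 0" if "k \<in> K2" for k using wK that by simp
    fix n assume "n \<in> ?N"
    then obtain z m where z: "z \<in> Z" "n = f z m" using fcov by blast
    show "\<Omega> n \<in> span ?N" using \<Omega>f omN z by simp
    have "\<Omega> (\<Theta> n) - \<Theta> (\<Omega> n) = D n" using z by (simp add: \<Theta>f \<Omega>f omS)
    then show "w n - (\<Omega> (\<Theta> n) - \<Theta> (\<Omega> n)) \<in> span X" using D(2)[OF \<open>n \<in> ?N\<close>] by simp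
  qed
qed

text \<open>Modelled on differentiation and multiplication by a variable: with
  \<open>\<Theta>\<close> the cyclic shift of an enumeration \<open>y\<close> and
  \<open>\<Omega>\<close> sending \<open>y j\<close> to \<open>j \<mu>\<close> times its
  predecessor, the commutator is multiplication by \<open>\<mu>\<close>.\<close>

lemma scalar_compression_sum_sqz3:
  assumes w: "lin w" and injw: "inj_on w X" and X: "finite X"
    and ind: "independent (X \<union> w ` X \<union> (K1 \<union> K2))" and sp: "span (X \<union> w ` X \<union> (K1 \<union> K2)) = UNIV"
    and d1: "X \<inter> w ` X = {}" and d2: "(X \<union> w ` X) \<inter> (K1 \<union> K2) = {}" and d3: "K1 \<inter> K2 = {}"
    and \<kappa>: "bij_betw \<kappa> K1 K2"
    and wK1: "\<And>k. k \<in> K1 \<Longrightarrow> w k \<in> span X" and wK2: "\<And>k. k \<in> K2 \<Longrightarrow> w k = 0"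
    and \<mu>: "\<And>n. n \<in> w ` X \<Longrightarrow> w n - \<mu> *s n \<in> span X" "of_nat (card X) * \<mu> = 0"
    and l: "l + l = 0"
  shows "sum_sqz3 (\<lambda>x. l *s x + w x)"
proof -
  define m where "m = card X"
  have "card (w ` X) = m" using card_image[OF injw] by (simp add: m_def)
  then obtain y where y: "bij_betw y {0..<m} (w ` X)"
    using ex_bij_betw_nat_finite[of "w ` X"] X by auto
  have yi: "inj_on y {0..<m}" and yim: "y ` {0..<m} = w ` X" using y by (auto simp: bij_betw_def)
  define ix where "ix = inv_into {0..<m} y"
  have ix: "ix (y j) = j" if "j < m" for j using inv_into_f_f[OF yi] that by (simp add: ix_def)
  have cov: "\<exists>j<m. n = y j" if "n \<in> w ` X" for n using that yim by force
  have yX: "y j \<in> w ` X" if "j < m" for j using that yim by force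
  have indN: "independent (w ` X)" using independent_mono[OF ind] by auto
  obtain \<Theta> where \<Theta>: "lin \<Theta>" "\<And>n. n \<in> w ` X \<Longrightarrow> \<Theta> n = y (Suc (ix n) mod m)"
    using ex_lin[OF indN, of "\<lambda>n. y (Suc (ix n) mod m)"] by blast
  have \<Theta>y: "\<Theta> (y j) = y (Suc j mod m)" if "j < m" for j using \<Theta>(2)[OF yX] ix that by simp
  obtain \<Omega> where \<Omega>: "lin \<Omega>" "\<And>n. n \<in> w ` X \<Longrightarrow> \<Omega> n = (of_nat (ix n) * \<mu>) *s y (ix n - 1)"
    using ex_lin[OF indN, of "\<lambda>n. (of_nat (ix n) * \<mu>) *s y (ix n - 1)"] by blast
  have \<Omega>y: "\<Omega> (y j) = (of_nat j * \<mu>) *s y (j - 1)" if "j < m" for j using \<Omega>(2)[OF yX] ix that by simp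
  have bij: "bij_betw \<Theta> (w ` X) (w ` X)"
  proof -
    have "\<Theta> ` (w ` X) = w ` X"
    proof
      show "\<Theta> ` (w ` X) \<subseteq> w ` X"
      proof
        fix v assume "v \<in> \<Theta> ` (w ` X)"
        then obtain n where n: "n \<in> w ` X" "v = \<Theta> n" by blast
        then obtain j where j: "j < m" "n = y j" using cov by blast
        then have "v = y (Suc j mod m)" using n \<Theta>y by simp
        then show "v \<in> w ` X" using yX j(1) by simp
      qed
      show "w ` X \<subseteq> \<Theta> ` (w ` X)"
      proof
        fix v assume "v \<in> w ` X"
        then obtain j where j: "j < m" "v = y j" using cov by blast
        have "v = \<Theta> (y (if j = 0 then m - 1 else j - 1))" using j by (auto simp: \<Theta>y)
        moreover have "(if j = 0 then m - 1 else j - 1) < m" using j by auto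
        ultimately show "v \<in> \<Theta> ` (w ` X)" using yX by blast
      qed
    qed
    moreover from this have "inj_on \<Theta> (w ` X)" using X by (intro finite_surj_inj) auto
    ultimately show ?thesis by (simp add: bij_betw_def)
  qed
  show ?thesis
  proof (rule commutator_sum_sqz3[OF w injw subset_refl ind sp d1 d2 d3 \<kappa> wK1 wK2 \<Theta>(1) bij \<Omega>(1) _ _ l])
    fix n assume n: "n \<in> w ` X"
    then obtain j where j: "j < m" "n = y j" using cov by blast
    show "\<Omega> n \<in> span (w ` X)" unfolding j(2) \<Omega>y[OF j(1)]
      using j(1) by (intro span_scale span_base yX) simp
    \<comment> \<open>At the last index the shift wraps around to \<open>y 0\<close>, which
      \<open>\<Omega>\<close> kills; this agrees with the general formula because the trace
      \<open>m \<mu>\<close> is zero.\<close>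
    have 1: "\<Omega> (\<Theta> n) = (of_nat (Suc j) * \<mu>) *s y j"
    proof (cases "Suc j = m")
      case True
      then have "\<Omega> (\<Theta> n) = 0" using j \<Omega>y[of 0] by (simp add: \<Theta>y)
      then show ?thesis using True \<mu>(2) unfolding m_def by simp
    next
      case False
      then show ?thesis using j \<Omega>y[of "Suc j"] by (simp add: \<Theta>y)
    qed
    \<comment> \<open>For \<open>j = 0\<close> the truncated predecessor is harmless, its
      coefficient being zero.\<close>
    have 2: "\<Theta> (\<Omega> n) = (of_nat j * \<mu>) *s y j"
      unfolding j(2) \<Omega>y[OF j(1)] lin_rules(4)[OF \<Theta>(1)]
      using j(1) by (cases j) (auto simp: \<Theta>y)
    have "\<Omega> (\<Theta> n) - \<Theta> (\<Omega> n) = \<mu> *s n"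
      unfolding 1 2 unfolding j(2) by (simp add: scale_left_diff_distrib[symmetric] algebra_simps del: scale_left_diff_distrib)
    then show "w n - (\<Omega> (\<Theta> n) - \<Theta> (\<Omega> n)) \<in> span X" using \<mu>(1)[OF n] by simp
  qed
qed

section \<open>Splitting a compression into nilpotent parts\<close>

text \<open>A coordinate-free form of a splitting into upper and lower triangular parts:
  \<open>L\<close> is nilpotent, and \<open>U\<close> is nilpotent on \<open>span A\<close> and acts
  as \<open>t\<close> on the quotient of \<open>W\<close> by \<open>span A\<close>, which has basis
  \<open>C\<close>. In use, \<open>C\<close> is empty, a single vector or a whole basis.\<close>

definition nil_split :: "'b set \<Rightarrow> ('b \<Rightarrow> 'b) \<Rightarrow> 'b set \<Rightarrow> 'b set \<Rightarrow> ('b \<Rightarrow> 'b) \<Rightarrow> ('b \<Rightarrow> 'b) \<Rightarrow> 'a \<Rightarrow> bool" where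
  "nil_split W D A C U L t \<longleftrightarrow> lin U \<and> lin L \<and> A \<inter> C = {} \<and> independent (A \<union> C) \<and> span (A \<union> C) = W \<and>
     (\<forall>v\<in>W. D v = U v + L v \<and> U v \<in> W \<and> L v \<in> W) \<and> nilp_on L W \<and>
     (\<forall>v\<in>span A. U v \<in> span A) \<and> nilp_on U (span A) \<and> (\<forall>v\<in>C. U v - t *s v \<in> span A)"

text \<open>Put \<open>b\<close> in front of the basis. As \<open>D b\<close> has no component along
  \<open>b\<close>, the diagonal entry at \<open>b\<close> is zero; the column of \<open>b\<close>
  goes to \<open>L\<close>, the row of \<open>b\<close> goes to \<open>U\<close>, and the rest is
  the splitting of the compression \<open>p D\<close>.\<close>

lemma nil_split_insert:
  assumes b: "b \<notin> span B" and B: "independent B" and D: "lin D" "\<And>v. v \<in> span (insert b B) \<Longrightarrow> D v \<in> span (insert b B)"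
    and Db: "D b \<in> span B" and p: "lin p" "p b = 0" "\<And>v. v \<in> B \<Longrightarrow> p v = v"
    and s: "nil_split (span B) (\<lambda>v. p (D v)) A C U1 L1 t"
  shows "\<exists>U L. nil_split (span (insert b B)) D (insert b A) C U L t"
proof -
  let ?W = "span (insert b B)" and ?H = "span B"
  have U1: "lin U1" and L1: "lin L1" and AC: "A \<inter> C = {}" "independent (A \<union> C)" "span (A \<union> C) = ?H"
    and dec: "\<And>v. v \<in> ?H \<Longrightarrow> p (D v) = U1 v + L1 v" "\<And>v. v \<in> ?H \<Longrightarrow> U1 v \<in> ?H" "\<And>v. v \<in> ?H \<Longrightarrow> L1 v \<in> ?H"
    and L1n: "nilp_on L1 ?H" and UA: "\<And>v. v \<in> span A \<Longrightarrow> U1 v \<in> span A" and U1n: "nilp_on U1 (span A)"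
    and UC: "\<And>v. v \<in> C \<Longrightarrow> U1 v - t *s v \<in> span A"
    using s unfolding nil_split_def by auto
  have pH: "p h = h" if "h \<in> ?H" for h
    by (rule lin_eq_on_span[OF p(1) lin_ident p(3) that])
  have HW: "?H \<subseteq> ?W" by (rule span_mono) blast
  have pW: "p v \<in> ?H" "v - p v \<in> span {b}" if v: "v \<in> ?W" for v
  proof -
    obtain r where r: "v - r *s b \<in> ?H" using v span_breakdown_eq by blast
    have "p v = p (v - r *s b)" by (simp add: lin_rules[OF p(1)] p(2))
    then have pv: "p v = v - r *s b" using pH[OF r] by simp
    then show "p v \<in> ?H" using r by simp
    show "v - p v \<in> span {b}" using pv by (simp add: span_scale span_base)
  qed
  define U where "U = (\<lambda>v. (D (p v) - p (D (p v))) + U1 (p v))"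
  define L where "L = (\<lambda>v. L1 (p v) + D (v - p v))"
  have Dp: "lin (\<lambda>v. D (p v))" by (rule lin_compose[OF D(1) p(1)])
  have lU: "lin U" unfolding U_def
    by (rule lin_add[OF lin_diff[OF Dp lin_compose[OF p(1) Dp]] lin_compose[OF U1 p(1)]])
  have lL: "lin L" unfolding L_def
    by (rule lin_add[OF lin_compose[OF L1 p(1)] lin_compose[OF D(1) lin_diff[OF lin_ident p(1)]]])
  have Ubspan: "D h - p (D h) \<in> span {b}" if "h \<in> ?H" for h using pW(2)[OF D(2)] HW that by blast
  have LH: "L v \<in> ?H" if v: "v \<in> ?W" for v
  proof -
    have "D (v - p v) \<in> ?H"
      by (rule lin_span_into[OF D(1) subspace_span _ pW(2)[OF v]]) (simp add: Db)
    then show ?thesis unfolding L_def using dec(3)[OF pW(1)[OF v]] by (intro span_add)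
  qed
  have bW: "span {b} \<subseteq> ?W" by (rule span_mono) blast
  have UW: "U v \<in> ?W" if v: "v \<in> ?W" for v
    unfolding U_def using Ubspan[OF pW(1)[OF v]] dec(2)[OF pW(1)[OF v]] bW HW by (intro span_add) auto
  have DUL: "D v = U v + L v" if v: "v \<in> ?W" for v
    unfolding U_def L_def using dec(1)[OF pW(1)[OF v]] by (simp add: lin_rules[OF D(1)])
  have pU: "p (U v) = U1 (p v)" if v: "v \<in> ?W" for v
  proof -
    have "p v \<in> ?H" using pW(1)[OF v] .
    then have "p (D (p v)) \<in> ?H" "U1 (p v) \<in> ?H" using pW(1)[OF D(2)] HW dec(2) by blast+
    then show ?thesis unfolding U_def by (simp add: lin_rules[OF p(1)] pH)
  qed
  have AH: "span A \<subseteq> ?H" unfolding AC(3)[symmetric] by (rule span_mono) blast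
  have bA: "span {b} \<subseteq> span (insert b A)" "span A \<subseteq> span (insert b A)" by (rule span_mono; blast)+
  have bAW: "span (insert b A) \<subseteq> ?W"
  proof (rule span_minimal)
    show "insert b A \<subseteq> ?W" using AH HW span_superset[of A] span_base[of b "insert b B"] by blast
  qed simp
  have pA: "p v \<in> span A" if v: "v \<in> span (insert b A)" for v
  proof (rule lin_span_into[OF p(1) subspace_span _ v])
    fix a assume "a \<in> insert b A"
    then show "p a \<in> span A" using p(2) pH AH span_base[of a A] span_zero[of A] by auto
  qed
  have UinA: "U v \<in> span (insert b A)" if v: "v \<in> span (insert b A)" for v
  proof -
    have "p v \<in> ?H" using pA[OF v] AH by blast
    then show ?thesis unfolding U_def using Ubspan[of "p v"] UA[OF pA[OF v]] bA by (intro span_add) auto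
  qed
  have Uiter: "(U ^^ j) v \<in> span (insert b A) \<and> p ((U ^^ j) v) = (U1 ^^ j) (p v)" if v: "v \<in> span (insert b A)" for v j
  proof (induction j)
    case (Suc j)
    have "(U ^^ j) v \<in> ?W" using Suc bAW by blast
    then show ?case using Suc UinA pU by simp
  qed (simp add: v)
  \<comment> \<open>Modulo \<open>b\<close> the map \<open>U\<close> is \<open>U1\<close>, and
    \<open>U\<close> kills \<open>b\<close>, so one further power suffices.\<close>
  have "nilp_on U (span (insert b A))"
  proof -
    obtain k where k: "\<And>v. v \<in> span A \<Longrightarrow> (U1 ^^ k) v = 0" using U1n unfolding nilp_on_def by blast
    have "(U ^^ Suc k) v = 0" if v: "v \<in> span (insert b A)" for v
    proof -
      have "p ((U ^^ k) v) = 0" using Uiter[OF v] k[OF pA[OF v]] by simp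
      then show ?thesis by (simp add: U_def lin_rules[OF D(1)] lin_rules[OF p(1)] lin_rules[OF U1])
    qed
    then show ?thesis unfolding nilp_on_def by blast
  qed
  \<comment> \<open>\<open>L\<close> maps everything into \<open>span B\<close>, where it coincides
    with \<open>L1\<close>.\<close>
  moreover have "nilp_on L ?W"
  proof -
    obtain k where k: "\<And>v. v \<in> ?H \<Longrightarrow> (L1 ^^ k) v = 0" using L1n unfolding nilp_on_def by blast
    have it: "(L ^^ j) h = (L1 ^^ j) h \<and> (L1 ^^ j) h \<in> ?H" if h: "h \<in> ?H" for h j
    proof (induction j)
      case (Suc j)
      have "p ((L1 ^^ j) h) = (L1 ^^ j) h" using Suc pH by blast
      then have "L ((L1 ^^ j) h) = L1 ((L1 ^^ j) h)" unfolding L_def by (simp add: lin_rules[OF D(1)])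
      then show ?case using Suc dec(3) by simp
    qed (simp add: h)
    have "(L ^^ Suc k) v = 0" if v: "v \<in> ?W" for v
      using it[OF LH[OF v], of k] k[OF LH[OF v]] by (simp add: funpow_swap1)
    then show ?thesis unfolding nilp_on_def by blast
  qed
  moreover have "U v - t *s v \<in> span (insert b A)" if v: "v \<in> C" for v
  proof -
    have vH: "v \<in> ?H" unfolding AC(3)[symmetric] using v by (simp add: span_base)
    have "U v - t *s v = (D v - p (D v)) + (U1 v - t *s v)" unfolding U_def pH[OF vH] by simp
    moreover have "\<dots> \<in> span (insert b A)"
      using Ubspan[OF vH] UC[OF v] bA by (intro span_add) blast+
    ultimately show ?thesis by (simp only:)
  qed
  moreover have "independent (insert b A \<union> C)" "insert b A \<inter> C = {}"
  proof -
    have nb: "b \<notin> span (A \<union> C)" using b AC(3) by simp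
    show "independent (insert b A \<union> C)" using independent_insertI[OF nb AC(2)] by simp
    show "insert b A \<inter> C = {}" using AC(1) nb span_base[of b "A \<union> C"] by blast
  qed
  moreover have "span (insert b A \<union> C) = ?W"
    using AC(3) by (simp add: span_insert)
  ultimately have "nil_split ?W D (insert b A) C U L t"
    unfolding nil_split_def using lU lL DUL UW LH HW UinA by auto
  then show ?thesis by blast
qed

text \<open>If \<open>v\<close> is not a multiple of \<open>b\<close>, comparing the factors at
  \<open>v\<close>, \<open>b\<close> and \<open>v + b\<close> makes them equal; multiples of
  \<open>b\<close> inherit the factor of \<open>b\<close>.\<close>

lemma pointwise_scalar_imp_scalar:
  assumes D: "lin D" and W: "subspace W" and ev: "\<And>v. v \<in> W \<Longrightarrow> \<exists>r. D v = r *s v"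
  shows "\<exists>r. \<forall>v\<in>W. D v = r *s v"
proof (cases "W \<subseteq> {0}")
  case True then show ?thesis using ev by (metis subsetD singletonD scale_zero_right)
next
  case False
  then obtain b where b: "b \<in> W" "b \<noteq> 0" by blast
  obtain m where m: "D b = m *s b" using ev[OF b(1)] by blast
  have "D v = m *s v" if v: "v \<in> W" for v
  proof -
    obtain q where q: "D v = q *s v" using ev[OF v] by blast
    obtain r where r: "D (v + b) = r *s (v + b)" using ev subspace_add[OF W v b(1)] by blast
    have eq: "(r - q) *s v = (m - r) *s b"
      using r q m by (simp add: lin_rules[OF D] scale_right_distrib scale_left_diff_distrib algebra_simps)
    show ?thesis
    proof (cases "r = q")
      case True
      then have "m = r" using eq b(2) by simp
      then show ?thesis using True q by simp
    next
      case False
      then have "v = inverse (r - q) *s ((r - q) *s v)" by simp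
      then have "v = (inverse (r - q) * (m - r)) *s b" unfolding eq by simp
      then obtain s where s: "v = s *s b" by blast
      show ?thesis unfolding s by (simp add: lin_rules[OF D] m mult.commute)
    qed
  qed
  then show ?thesis by blast
qed

text \<open>A non-scalar endomorphism of a finite-dimensional space has, in a suitable basis, all diagonal
  entries zero but the last one.\<close>

lemma nonscalar_nil_split:
  assumes "finite B" "independent B" "B \<noteq> {}" "lin D" "\<And>v. v \<in> span B \<Longrightarrow> D v \<in> span B"
    and "card B \<le> 1 \<or> \<not> (\<exists>r. \<forall>v\<in>span B. D v = r *s v)"
  shows "\<exists>A x U L t. nil_split (span B) D A {x} U L t"
  using assms
proof (induction "card B" arbitrary: B D rule: less_induct)
  case less
  note D = less.prems(4) and inv = less.prems(5)
  show ?case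
  proof (cases "card B \<le> 1")
    case True
    then have "card B = 1" using less.prems(1,3) by (metis One_nat_def card_gt_0_iff le_antisym Suc_leI)
    then obtain x where x: "B = {x}" using card_1_singletonE by blast
    have "D x \<in> span {x}" using inv[of x] x span_base[of x "{x}"] by simp
    then obtain t where t: "D x = t *s x" unfolding span_singleton by blast
    have "nil_split (span B) D {} {x} D (\<lambda>v. 0) t"
      unfolding nil_split_def x using D lin_zero less.prems(2) inv t x
      by (auto simp: span_zero lin_rules[OF D] nilp_on_def intro: exI[of _ 1] exI[of _ 0])
    then show ?thesis by blast
  next
    case False
    then have "\<not> (\<exists>r. \<forall>v\<in>span B. D v = r *s v)" using less.prems(6) by blast
    \<comment> \<open>For a vector \<open>b\<close> that is not an eigenvector, \<open>D b\<close>
      can be taken as a further basis vector, which makes the diagonal entry at \<open>b\<close>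
      zero.\<close>
    then obtain b where b: "b \<in> span B" "\<And>r. D b \<noteq> r *s b"
      using pointwise_scalar_imp_scalar[OF D subspace_span] by blast
    have b0: "b \<noteq> 0" using b(2)[of 0] by (auto simp: lin_rules[OF D])
    have Dbb: "D b \<notin> span {b}" using b(2) unfolding span_singleton by blast
    have ind2: "independent {D b, b}"
      using independent_insertI[OF Dbb] b0 by simp
    have sub2: "{D b, b} \<subseteq> span B" using b(1) inv by simp
    obtain R where R: "R \<subseteq> span B" "independent ({D b, b} \<union> R)" "{D b, b} \<inter> R = {}" "span B \<subseteq> span ({D b, b} \<union> R)"
      using independent_extends_within[OF ind2 sub2] by blast
    let ?C = "{D b, b} \<union> R"
    have sC: "span ?C = span B"
      using R(4) span_minimal[of ?C "span B"] R(1) sub2 by simp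
    have fC: "finite ?C" using independent_finite_span[OF R(2) _ less.prems(1)] R(1) sub2 by blast
    have bne: "b \<noteq> D b" using b(2)[of 1] by auto
    \<comment> \<open>The induction step for any basis \<open>E\<close> of a complement of
      \<open>b\<close> that contains \<open>D b\<close>, provided that \<open>E\<close> is a single
      vector or the compression to its span is again not scalar.\<close>
    have key: ?thesis if E: "finite E" "independent (insert b E)" "b \<notin> E" "span (insert b E) = span B" "D b \<in> E"
      and ns: "\<And>p. lin p \<Longrightarrow> p b = 0 \<Longrightarrow> (\<forall>v\<in>E. p v = v) \<Longrightarrow>
         card E \<le> 1 \<or> \<not> (\<exists>r. \<forall>v\<in>span E. p (D v) = r *s v)" for E
    proof -
      obtain p where p: "lin p" "\<And>v. v \<in> insert b E \<Longrightarrow> p v = (if v = b then 0 else v)"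
        using ex_lin[OF E(2), of "\<lambda>v. if v = b then 0 else v"] by blast
      have pb: "p b = 0" and pE: "\<And>v. v \<in> E \<Longrightarrow> p v = v" using p(2) E(3) by auto
      have iE: "independent E" using independent_mono[OF E(2)] by blast
      have bE: "b \<notin> span E" using E(2,3) independent_insert by metis
      have "card (insert b E) = card B"
        using dim_span_eq_card_independent[OF E(2)] dim_span_eq_card_independent[OF less.prems(2)] E(4) by metis
      then have less': "card E < card B" using E(1,3) by simp
      have EB: "span E \<subseteq> span B" unfolding E(4)[symmetric] by (rule span_mono) blast
      have pD: "p (D v) \<in> span E" if "v \<in> span E" for v
      proof (rule lin_span_into[OF p(1) subspace_span])
        show "D v \<in> span (insert b E)" using inv EB that E(4) by blast
        show "p a \<in> span E" if "a \<in> insert b E" for a using that pb pE span_base span_zero by force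
      qed
      have "\<exists>A x U L t. nil_split (span E) (\<lambda>v. p (D v)) A {x} U L t"
        by (rule less.hyps[OF less' E(1) iE _ lin_compose[OF p(1) D] pD ns[OF p(1) pb]])
          (use E(5) pE in auto)
      then obtain A x U L t where s: "nil_split (span E) (\<lambda>v. p (D v)) A {x} U L t" by blast
      have "\<exists>U L. nil_split (span (insert b E)) D (insert b A) {x} U L t"
        by (rule nil_split_insert[OF bE iE D _ span_base[OF E(5)] p(1) pb pE s]) (use inv E(4) in blast)+
      then show ?thesis unfolding E(4) by blast
    qed
    let ?E = "insert (D b) R"
    have CE: "insert b ?E = ?C" by blast
    have bE: "b \<notin> ?E" using R(3) bne by blast
    have fE: "finite ?E" using fC by simp
    obtain p0 where p0: "lin p0" "\<And>v. v \<in> ?C \<Longrightarrow> p0 v = (if v = b then 0 else v)"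
      using ex_lin[OF R(2), of "\<lambda>v. if v = b then 0 else v"] by blast
    have p0b: "p0 b = 0" and p0E: "\<And>v. v \<in> ?E \<Longrightarrow> p0 v = v" using p0(2) bE by auto
    show ?thesis
    proof (cases "card ?E \<le> 1 \<or> \<not> (\<exists>r. \<forall>v\<in>span ?E. p0 (D v) = r *s v)")
      case True
      show ?thesis
      proof (rule key[OF fE])
        show "independent (insert b ?E)" "span (insert b ?E) = span B" unfolding CE using R(2) sC by auto
        show "b \<notin> ?E" by (rule bE)
        show "D b \<in> ?E" by simp
        fix p assume p: "lin p" "p b = 0" "\<forall>v\<in>?E. p v = v"
        have "p (D v) = p0 (D v)" if "v \<in> span ?E" for v
        proof (rule lin_eq_on_span[OF p(1) p0(1)])
          have "v \<in> span ?C" using that span_mono[of ?E ?C] by blast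
          then show "D v \<in> span ?C" using inv sC by simp
          show "p a = p0 a" if "a \<in> ?C" for a using that p p0b p0E CE by (metis insertE)
        qed
        then show "card ?E \<le> 1 \<or> \<not> (\<exists>r. \<forall>v\<in>span ?E. p (D v) = r *s v)" using True by simp
      qed
    next
      case scalar: False
      then obtain r where r: "\<And>v. v \<in> span ?E \<Longrightarrow> p0 (D v) = r *s v" by blast
      have "R \<noteq> {}" using scalar by auto
      then obtain b3 where b3: "b3 \<in> R" by blast
      have b3C: "b3 \<in> ?C" "b3 \<noteq> b" "b3 \<noteq> D b" using b3 R(3) by auto
      \<comment> \<open>The first complement has a scalar compression. The shear \<open>f\<close>,
        with inverse \<open>g\<close>, replaces \<open>b3\<close> by \<open>b3 + b\<close>; this
        tilts the complement and adds \<open>D b\<close> to the compressed value there, so the new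
        compression is not scalar.\<close>
      obtain f where f: "lin f" "\<And>v. v \<in> ?C \<Longrightarrow> f v = (if v = b3 then b3 + b else v)"
        using ex_lin[OF R(2), of "\<lambda>v. if v = b3 then b3 + b else v"] by blast
      obtain g where g: "lin g" "\<And>v. v \<in> ?C \<Longrightarrow> g v = (if v = b3 then b3 - b else v)"
        using ex_lin[OF R(2), of "\<lambda>v. if v = b3 then b3 - b else v"] by blast
      have gf: "g (f v) = v" if "v \<in> span ?C" for v
        by (rule lin_eq_on_span[OF lin_compose[OF g(1) f(1)] lin_ident _ that])
          (use f(2) g(2) b3C in \<open>auto simp: lin_rules[OF g(1)]\<close>)
      have "inj_on f (span ?C)" using gf by (metis inj_onI)
      then have indf: "independent (f ` ?C)" using P.linear_independent_injective_image[OF f(1) R(2)] by blast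
      let ?F = "insert (D b) (insert (b3 + b) (R - {b3}))"
      have fim: "f ` ?C = insert b ?F"
      proof -
        have "f ` ?C = f ` {D b, b} \<union> f ` (R - {b3}) \<union> {f b3}" using b3 by blast
        moreover have "f ` (R - {b3}) = R - {b3}" using f(2) by force
        moreover have "f ` {D b, b} = {D b, b}" "f b3 = b3 + b" using f(2) b3C by auto
        ultimately have "f ` ?C = {D b, b} \<union> (R - {b3}) \<union> {b3 + b}" by (simp only:)
        then show ?thesis by blast
      qed
      have b3B: "b3 + b \<in> span B" using R(1) b3 b(1) by (intro span_add) auto
      have bF: "b \<notin> ?F"
      proof -
        have "b3 \<noteq> 0"
        proof
          assume "b3 = 0"
          then have "0 \<in> ?C" using b3C(1) by simp
          from dependent_zero[OF this] show False using R(2) by simp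
        qed
        then have "b \<noteq> b3 + b" by simp
        moreover have "b \<notin> R - {b3}" using bE by blast
        ultimately show ?thesis using bne by blast
      qed
      show ?thesis
      proof (rule key[of ?F])
        show "finite ?F" using fE by simp
        show "independent (insert b ?F)" using indf fim by simp
        show "b \<notin> ?F" by (rule bF)
        show "span (insert b ?F) = span B"
        proof
          show "span (insert b ?F) \<subseteq> span B"
            by (rule span_minimal) (use b(1) inv b3B R(1) in auto)
          have "b3 \<in> span (insert b ?F)"
            using span_diff[of "b3 + b" "insert b ?F" b] by (simp add: span_base)
          then have "?C \<subseteq> span (insert b ?F)" by (auto intro: span_base)
          then have "span ?C \<subseteq> span (insert b ?F)" by (rule span_minimal) simp
          then show "span B \<subseteq> span (insert b ?F)" using sC by simp
        qed
        show "D b \<in> ?F" by simp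
        fix p assume p: "lin p" "p b = 0" "\<forall>v\<in>?F. p v = v"
        have "\<not> (\<exists>q. \<forall>v\<in>span ?F. p (D v) = q *s v)"
        proof
          assume "\<exists>q. \<forall>v\<in>span ?F. p (D v) = q *s v"
          then obtain q where q: "p (D (b3 + b)) = q *s (b3 + b)" using span_base[of "b3 + b" ?F] by blast
          have "b3 \<in> span ?E" using b3 by (simp add: span_base)
          then have p03: "p0 (D b3) = r *s b3" by (rule r)
          have D3: "D b3 \<in> span (insert b ?E)" unfolding CE using inv R(1) b3 sC by auto
          obtain s where s: "D b3 - s *s b \<in> span ?E" using D3 span_breakdown_eq by blast
          have "p0 (D b3 - s *s b) = D b3 - s *s b"
            by (rule lin_eq_on_span[OF p0(1) lin_ident p0E s])
          then have "D b3 = r *s b3 + s *s b" using p03 p0b by (simp add: lin_rules[OF p0(1)] algebra_simps)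
          then have "D (b3 + b) = r *s (b3 + b) + (s - r) *s b + D b"
            by (simp add: lin_rules[OF D] scale_right_distrib scale_left_diff_distrib algebra_simps)
          then have "p (D (b3 + b)) = r *s (b3 + b) + D b" using p by (simp add: lin_rules[OF p(1)] del: scale_right_distrib)
          then have "D b = q *s (b3 + b) - r *s (b3 + b)" using q by simp
          also have "\<dots> = (q - r) *s (b3 + b)" by (simp only: scale_left_diff_distrib)
          also have "\<dots> \<in> span {b3, b}" by (intro span_scale span_add span_base) auto
          finally have "D b \<in> span {b3, b}" .
          moreover have "independent {D b, b3, b}" using independent_mono[OF R(2)] b3 by auto
          moreover have "D b \<notin> {b3, b}" using b3C bne by auto
          ultimately show False using independent_insert[of "D b" "{b3, b}"] by auto
        qed
        then show "card ?F \<le> 1 \<or> \<not> (\<exists>r. \<forall>v\<in>span ?F. p (D v) = r *s v)" ..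
      qed
    qed
  qed
qed

section \<open>Finite-rank perturbations of scalars\<close>

lemma funpow_in: "(\<And>v. v \<in> W \<Longrightarrow> f v \<in> W) \<Longrightarrow> v \<in> W \<Longrightarrow> (f ^^ k) v \<in> W"
  by (induction k) auto

lemma nilp_on_extend:
  assumes T: "lin T" and n: "nilp_on T W" and im: "\<And>v. v \<in> V \<Longrightarrow> T v \<in> W"
  shows "nilp_on T V"
proof -
  obtain k where k: "\<And>v. v \<in> W \<Longrightarrow> (T ^^ k) v = 0" using n unfolding nilp_on_def by blast
  have "(T ^^ Suc k) v = 0" if "v \<in> V" for v using k[OF im[OF that]] by (simp add: funpow_swap1)
  then show ?thesis unfolding nilp_on_def by blast
qed

text \<open>\<open>T\<close> acts as \<open>L\<close> on the image of \<open>W\<close> under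
  \<open>y\<close>, and as \<open>U\<close> on \<open>A\<close> modulo that image. A power of
  \<open>T\<close> carries \<open>A\<close> into the image, and a further power kills it.\<close>

lemma block_triangular_nilp_on:
  assumes T: "lin T" and y: "lin y" and U: "lin U"
    and A: "subspace A" "A \<subseteq> W" and W: "subspace W"
    and TA: "\<And>v. v \<in> A \<Longrightarrow> T v = U v + y v" and Ty: "\<And>v. v \<in> W \<Longrightarrow> T (y v) = y (L v)"
    and UA: "\<And>v. v \<in> A \<Longrightarrow> U v \<in> A" "nilp_on U A" and LW: "\<And>v. v \<in> W \<Longrightarrow> L v \<in> W" "nilp_on L W"
  shows "nilp_on T (span (A \<union> y ` W))" "\<And>v. v \<in> span (A \<union> y ` W) \<Longrightarrow> T v \<in> span (A \<union> y ` W)"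
proof -
  obtain k1 where k1: "\<And>v. v \<in> A \<Longrightarrow> (U ^^ k1) v = 0" using UA(2) unfolding nilp_on_def by blast
  obtain k2 where k2: "\<And>v. v \<in> W \<Longrightarrow> (L ^^ k2) v = 0" using LW(2) unfolding nilp_on_def by blast
  have Tyj: "(T ^^ j) (y v) = y ((L ^^ j) v)" if v: "v \<in> W" for v j
    using funpow_in[of W L, OF LW(1) v] by (induction j) (auto simp: Ty)
  have TAj: "(T ^^ j) v - (U ^^ j) v \<in> y ` W" if v: "v \<in> A" for v j
  proof (induction j)
    case 0
    have "0 \<in> W" using subspace_0[OF W] .
    then show ?case using lin_rules(5)[OF y] by force
  next
    case (Suc j)
    then obtain q where q: "q \<in> W" "(T ^^ j) v - (U ^^ j) v = y q" by blast
    have u: "(U ^^ j) v \<in> A" using funpow_in[of A U, OF UA(1) v] .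
    have "(T ^^ j) v = (U ^^ j) v + y q" using q(2) by (simp add: algebra_simps)
    then have "(T ^^ Suc j) v - (U ^^ Suc j) v = y ((U ^^ j) v + L q)"
      using TA[OF u] Ty[OF q(1)] by (simp add: lin_rules[OF T] lin_rules[OF y])
    moreover have "(U ^^ j) v + L q \<in> W" using u A(2) LW(1)[OF q(1)] by (intro subspace_add[OF W]) auto
    ultimately show ?case by blast
  qed
  have sy: "span (y ` W) = y ` W" using P.linear_subspace_image[OF y W] by simp
  have sA: "span A = A" using A(1) by simp
  have "(T ^^ (k2 + k1)) v = 0" if v: "v \<in> span (A \<union> y ` W)" for v
  proof -
    obtain a q where aq: "a \<in> A" "q \<in> W" "v = a + y q" using v unfolding span_Un sy sA by blast
    note lT = lin_funpow[OF T]
    have y0: "(T ^^ (k2 + j)) (y q') = 0" if q': "q' \<in> W" for q' j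
    proof -
      have "(T ^^ j) (y q') = y ((L ^^ j) q')" "(L ^^ j) q' \<in> W"
        using Tyj[OF q'] funpow_in[of W L, OF LW(1) q'] by auto
      then have "(T ^^ (k2 + j)) (y q') = y ((L ^^ k2) ((L ^^ j) q'))" using Tyj by (simp add: funpow_add)
      then show ?thesis using k2[of "(L ^^ j) q'"] funpow_in[of W L, OF LW(1) q'] by (simp add: lin_rules[OF y])
    qed
    obtain q' where q': "q' \<in> W" "(T ^^ k1) a = y q'" using TAj[OF aq(1), of k1] k1[OF aq(1)] by auto
    have "(T ^^ (k2 + k1)) a = 0" using y0[OF q'(1), of 0] q'(2) by (simp add: funpow_add)
    then show ?thesis unfolding aq(3) lin_rules(1)[OF lT] using y0[OF aq(2)] by simp
  qed
  then show "nilp_on T (span (A \<union> y ` W))" unfolding nilp_on_def by blast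
  show "T v \<in> span (A \<union> y ` W)" if v: "v \<in> span (A \<union> y ` W)" for v
  proof (rule lin_span_into[OF T subspace_span _ v])
    fix b assume "b \<in> A \<union> y ` W"
    then consider "b \<in> A" | q where "q \<in> W" "b = y q" by blast
    then show "T b \<in> span (A \<union> y ` W)"
    proof cases
      case 1
      then show ?thesis unfolding TA[OF 1] using UA(1) A(2) by (intro span_add span_base) auto
    next
      case 2
      then show ?thesis using Ty LW(1) by (auto intro: span_base)
    qed
  qed
qed

text \<open>For \<open>x\<close> in the span of \<open>X\<close> put \<open>y x = w x - R x\<close>. Changing \<open>w\<close> by a suitable square-zero
  endomorphism makes the complement \<open>y (span X)\<close> of \<open>span X\<close> invariant.\<close>

lemma ex_square_zero_correction:
  assumes w: "lin w" and injw: "inj_on w X"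
    and ind: "independent (X \<union> w ` X \<union> Z)" and sp: "span (X \<union> w ` X \<union> Z) = UNIV"
    and d1: "X \<inter> w ` X = {}" and d2: "(X \<union> w ` X) \<inter> Z = {}"
    and D: "\<And>x. x \<in> span X \<Longrightarrow> w (w x) - w (D x) \<in> span X"
    and R: "lin R" and S: "lin S"
    and RS: "\<And>x. x \<in> span X \<Longrightarrow> D x = R x + S x \<and> R x \<in> span X \<and> S x \<in> span X"
    and g: "Z0 \<subseteq> Z" "\<And>z. z \<in> Z \<Longrightarrow> g z \<in> span (X \<union> Z0)" "\<And>z. z \<in> Z0 \<Longrightarrow> g z = 0"
  shows "\<exists>c. lin c \<and> square_zero c \<and> (\<forall>x\<in>span X. c x = 0) \<and>
     (\<forall>x\<in>span X. w (w x - R x) - c (w x - R x) = w (S x) - R (S x)) \<and> (\<forall>z\<in>Z. c z = g z)"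
proof -
  let ?B = "X \<union> w ` X \<union> Z"
  \<comment> \<open>With \<open>c (w x) = q x\<close> and \<open>c\<close> zero on
    \<open>span X\<close>, the map \<open>w - c\<close> sends \<open>y x\<close> to
    \<open>y (S x)\<close>. The values \<open>q x\<close> lie in \<open>span X\<close> because
    \<open>D = R + S\<close> and \<open>w (w x)\<close> equals \<open>w (D x)\<close> modulo
    \<open>span X\<close>.\<close>
  define q where "q = (\<lambda>x. w (w x - R x) - (w (S x) - R (S x)))"
  have lq: "lin q" unfolding q_def
    by (rule lin_diff[OF lin_compose[OF w lin_diff[OF w R]]
          lin_diff[OF lin_compose[OF w S] lin_compose[OF R S]]])
  obtain c where c: "lin c" "\<And>b. b \<in> ?B \<Longrightarrow> c b = (if b \<in> X then 0 else if b \<in> Z then g b else q (inv_into X w b))"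
    using ex_lin[OF ind, of "\<lambda>b. if b \<in> X then 0 else if b \<in> Z then g b else q (inv_into X w b)"] by blast
  have cX: "c x = 0" if "x \<in> span X" for x
    by (rule lin_eq_on_span[OF c(1) lin_zero _ that]) (simp add: c(2))
  have cZ: "c z = g z" if "z \<in> Z" for z using c(2)[of z] that d2 by auto
  have cw: "c (w x) = q x" if "x \<in> span X" for x
  proof (rule lin_eq_on_span[OF lin_compose[OF c(1) w] lq _ that])
    fix b assume b: "b \<in> X"
    then have "w b \<notin> X" "w b \<notin> Z" using d1 d2 by auto
    then show "c (w b) = q b" using c(2)[of "w b"] b inv_into_f_f[OF injw b] by simp
  qed
  have qX: "q x \<in> span X" if x: "x \<in> span X" for x
  proof -
    have "q x = (w (w x) - w (D x)) + R (S x)"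
      unfolding q_def using RS[OF x] by (simp add: lin_rules[OF w])
    then show ?thesis using D[OF x] RS[of "S x"] RS[OF x] by (simp add: span_add)
  qed
  \<comment> \<open>This span contains all values of \<open>c\<close>, including the prescribed
    \<open>g z\<close>, so its being killed gives square zero.\<close>
  have c0: "c v = 0" if "v \<in> span (X \<union> Z0)" for v
  proof (rule lin_eq_on_span[OF c(1) lin_zero _ that])
    fix b assume "b \<in> X \<union> Z0"
    then show "c b = 0" using cX[OF span_base[of b X]] cZ[of b] g(1,3) by auto
  qed
  have XZ: "span X \<subseteq> span (X \<union> Z0)" by (rule span_mono) blast
  have "c (c b) = 0" if "b \<in> ?B" for b
  proof -
    from that consider "b \<in> X" | x where "x \<in> X" "b = w x" | "b \<in> Z" by blast
    then show ?thesis
    proof cases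
      case 1 then show ?thesis using cX[OF span_base[OF 1]] by (simp add: lin_rules[OF c(1)])
    next
      case 2 then show ?thesis using cw[OF span_base] cX[OF qX[OF span_base]] by simp
    next
      case 3 then show ?thesis using c0[OF g(2)] cZ by simp
    qed
  qed
  then have "c (c v) = 0" for v
    using lin_eq_on_span[OF lin_compose[OF c(1) c(1)] lin_zero, of ?B v] sp by simp
  then have "square_zero c" unfolding square_zero_def by blast
  moreover have "w (w x - R x) - c (w x - R x) = w (S x) - R (S x)" if x: "x \<in> span X" for x
  proof -
    have "c (w x - R x) = q x" using cw[OF x] cX RS[OF x] by (simp add: lin_rules[OF c(1)])
    then show ?thesis by (simp add: q_def)
  qed
  ultimately show ?thesis using c(1) cX cZ by blast
qed

section \<open>From nilpotent splittings to sums of square-zero maps\<close>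

lemma nil_splitD:
  assumes "nil_split W D A C U L t"
  shows "lin U" "lin L" "A \<inter> C = {}" "independent (A \<union> C)" "span (A \<union> C) = W"
    "v \<in> W \<Longrightarrow> D v = U v + L v" "v \<in> W \<Longrightarrow> U v \<in> W" "v \<in> W \<Longrightarrow> L v \<in> W" "nilp_on L W"
    "v \<in> span A \<Longrightarrow> U v \<in> span A" "nilp_on U (span A)" "v \<in> C \<Longrightarrow> U v - t *s v \<in> span A"
  using assms unfolding nil_split_def by auto

text \<open>\<open>p\<close> carries the diagonal part of the splitting. Once it is removed,
  \<open>U\<close> becomes the nilpotent map \<open>V = U - \<rho>\<close>, and the correcting map
  \<open>c\<close> makes \<open>w - p - c\<close> nilpotent. For empty \<open>C\<close> nothing is
  removed; for general \<open>C\<close> this serves to compute the trace.\<close>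

lemma nil_split_sum_sqz3_diff:
  assumes w: "lin w" and injw: "inj_on w X"
    and ind: "independent (X \<union> w ` X \<union> Z)" and sp: "span (X \<union> w ` X \<union> Z) = UNIV"
    and d1: "X \<inter> w ` X = {}" and d2: "(X \<union> w ` X) \<inter> Z = {}"
    and wim: "\<And>v. w v \<in> span (X \<union> w ` X)"
    and D: "\<And>x. x \<in> span X \<Longrightarrow> w (w x) - w (D x) \<in> span X"
    and s: "nil_split (span X) D A C U L t"
  shows "\<exists>p. lin p \<and> (\<forall>v. p v \<in> span C) \<and> (\<forall>v\<in>C. p v = t *s v) \<and> sum_sqz3 (\<lambda>v. w v - p v)"
proof -
  note s = nil_splitD[OF s]
  let ?B = "X \<union> w ` X \<union> Z"
  obtain \<rho> where \<rho>: "lin \<rho>" "\<And>b. b \<in> A \<union> C \<Longrightarrow> \<rho> b = (if b \<in> A then 0 else t *s b)"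
    using ex_lin[OF s(4), of "\<lambda>b. if b \<in> A then 0 else t *s b"] by blast
  have \<rho>A: "\<rho> v = 0" if "v \<in> span A" for v
    by (rule lin_eq_on_span[OF \<rho>(1) lin_zero _ that]) (simp add: \<rho>(2))
  have \<rho>C: "\<rho> v = t *s v" if "v \<in> C" for v using \<rho>(2)[of v] that s(3) by auto
  have \<rho>X: "\<rho> v \<in> span C" if v: "v \<in> span X" for v
  proof (rule lin_span_into[OF \<rho>(1) subspace_span])
    show "v \<in> span (A \<union> C)" using v s(5) by simp
    show "\<rho> b \<in> span C" if "b \<in> A \<union> C" for b using \<rho>(2)[OF that] that by (auto intro: span_scale span_base span_zero)
  qed
  have CX: "span C \<subseteq> span X" unfolding s(5)[symmetric] by (rule span_mono) blast
  \<comment> \<open>The value at \<open>w x\<close> is chosen so that \<open>p\<close> kills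
    \<open>y x = w x - U x\<close>.\<close>
  obtain p where p: "lin p" "\<And>b. b \<in> ?B \<Longrightarrow> p b = (if b \<in> X then \<rho> b else if b \<in> Z then 0 else \<rho> (U (inv_into X w b)))"
    using ex_lin[OF ind, of "\<lambda>b. if b \<in> X then \<rho> b else if b \<in> Z then 0 else \<rho> (U (inv_into X w b))"] by blast
  have pX: "p x = \<rho> x" if "x \<in> span X" for x
    by (rule lin_eq_on_span[OF p(1) \<rho>(1) _ that]) (simp add: p(2))
  have pw: "p (w x) = \<rho> (U x)" if "x \<in> span X" for x
  proof (rule lin_eq_on_span[OF lin_compose[OF p(1) w] lin_compose[OF \<rho>(1) s(1)] _ that])
    fix b assume b: "b \<in> X"
    then have "w b \<notin> X" "w b \<notin> Z" using d1 d2 by auto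
    then show "p (w b) = \<rho> (U b)" using p(2)[of "w b"] b inv_into_f_f[OF injw b] by simp
  qed
  have pZ: "p z = 0" if "z \<in> Z" for z using p(2)[of z] that d2 by auto
  have pC: "p v \<in> span C" for v
  proof -
    have "p b \<in> span C" if b: "b \<in> ?B" for b
    proof -
      from b consider "b \<in> X" | x where "x \<in> X" "b = w x" | "b \<in> Z" by blast
      then show ?thesis
      proof cases
        case 1 then show ?thesis using pX \<rho>X span_base by simp
      next
        case 2 then show ?thesis using pw \<rho>X s(7) span_base by simp
      next
        case 3 then show ?thesis using pZ span_zero by simp
      qed
    qed
    then show ?thesis using lin_span_into[OF p(1) subspace_span, of ?B C v] sp by simp
  qed
  define w' where "w' = (\<lambda>v. w v - p v)"
  have lw': "lin w'" unfolding w'_def by (rule lin_diff[OF w p(1)])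
  obtain c where c: "lin c" "square_zero c" "\<And>x. x \<in> span X \<Longrightarrow> c x = 0"
    "\<And>x. x \<in> span X \<Longrightarrow> w (w x - U x) - c (w x - U x) = w (L x) - U (L x)" "\<And>z. z \<in> Z \<Longrightarrow> c z = 0"
    using ex_square_zero_correction[OF w injw ind sp d1 d2 D s(1,2), of Z "\<lambda>_. 0"] s(6-8)
    by (auto simp: span_zero)
  define T where "T = (\<lambda>v. w' v - c v)"
  have T: "lin T" unfolding T_def by (rule lin_diff[OF lw' c(1)])
  define y where "y = (\<lambda>x. w x - U x)"
  have y: "lin y" unfolding y_def by (rule lin_diff[OF w s(1)])
  define V where "V = (\<lambda>x. U x - \<rho> x)"
  have V: "lin V" unfolding V_def by (rule lin_diff[OF s(1) \<rho>(1)])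
  have AX: "span A \<subseteq> span X" unfolding s(5)[symmetric] by (rule span_mono) blast
  \<comment> \<open>\<open>\<rho>\<close> cancels the factor \<open>t\<close> on \<open>C\<close>,
    so \<open>V\<close> maps all of \<open>span X\<close> into \<open>span A\<close>, where it
    coincides with \<open>U\<close>.\<close>
  have VA: "V v \<in> span A" if v: "v \<in> span X" for v
  proof (rule lin_span_into[OF V subspace_span])
    show "v \<in> span (A \<union> C)" using v s(5) by simp
    fix b assume b: "b \<in> A \<union> C"
    show "V b \<in> span A"
    proof (cases "b \<in> A")
      case True then show ?thesis unfolding V_def using s(10) \<rho>A span_base by simp
    next
      case False then show ?thesis unfolding V_def using s(12) \<rho>C b by auto
    qed
  qed
  have "(V ^^ k) v = (U ^^ k) v" if v: "v \<in> span A" for v k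
    using funpow_in[of "span A" U, OF s(10) v] by (induction k) (auto simp: V_def \<rho>A)
  then have "nilp_on V (span A)" using s(11) unfolding nilp_on_def by simp
  then have nV: "nilp_on V (span X)" using nilp_on_extend[OF V _ VA] by blast
  have TX: "T v = V v + y v" if "v \<in> span X" for v
    unfolding T_def w'_def V_def y_def using c(3) pX that by simp
  have py: "p (y v) = 0" if "v \<in> span X" for v
    unfolding y_def using pw[OF that] pX[OF s(7)[OF that]] by (simp add: lin_rules[OF p(1)])
  have Ty: "T (y v) = y (L v)" if v: "v \<in> span X" for v
    using c(4)[OF v] py[OF v] unfolding T_def w'_def y_def by simp
  have nil: "nilp_on T (span (span X \<union> y ` span X))"
  proof (rule block_triangular_nilp_on(1)[OF T y V subspace_span subset_refl subspace_span TX Ty _ nV _ s(9)])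
    show "V v \<in> span X" if "v \<in> span X" for v using VA[OF that] AX by blast
  qed (use s(8) in auto)
  have Tim: "T v \<in> span (span X \<union> y ` span X)" for v
  proof -
    let ?S = "span (span X \<union> y ` span X)"
    have in1: "x \<in> ?S" if "x \<in> span X" for x using that by (simp add: span_base)
    have in2: "y x \<in> ?S" if "x \<in> span X" for x using that by (simp add: span_base)
    have inw: "w x \<in> ?S" if x: "x \<in> span X" for x
    proof -
      have "w x = y x + U x" by (simp add: y_def)
      then show ?thesis using span_add[OF in2[OF x] in1[OF s(7)[OF x]]] by simp
    qed
    have "span (X \<union> w ` X) \<subseteq> ?S"
      by (rule span_minimal) (use in1 inw span_base in auto)
    then have wS: "w v \<in> ?S" for v using wim by blast
    have "T b \<in> ?S" if b: "b \<in> ?B" for b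
    proof -
      from b consider "b \<in> X" | x where "x \<in> X" "b = w x" | "b \<in> Z" by blast
      then show ?thesis
      proof cases
        case 1
        then have b': "b \<in> span X" by (rule span_base)
        show ?thesis unfolding TX[OF b'] using VA[OF b'] AX in1 in2[OF b'] by (intro span_add) auto
      next
        case 2
        then have x: "x \<in> span X" by (simp add: span_base)
        have "b = y x + U x" using 2 by (simp add: y_def)
        then have "T b = y (L x) + (V (U x) + y (U x))" using Ty[OF x] TX[OF s(7)[OF x]] by (simp add: lin_rules[OF T])
        also have "\<dots> \<in> ?S" using in2 in1 VA[OF s(7)[OF x]] AX s(7,8)[OF x] by (intro span_add) auto
        finally show ?thesis .
      next
        case 3 then show ?thesis unfolding T_def w'_def using pZ c(5) wS by simp
      qed
    qed
    then show ?thesis using lin_span_into[OF T subspace_span, of ?B] sp by simp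
  qed
  have "nilp_on T UNIV" using nilp_on_extend[OF T nil Tim] by blast
  then have "sum_sqz2 (\<lambda>v. w' v - c v)" using nilpotent_sum_sqz2[OF T] unfolding T_def by blast
  from sum_sqz3I[OF c(1,2) this] have "sum_sqz3 (\<lambda>v. w v - p v)" unfolding w'_def .
  moreover have "p v = t *s v" if "v \<in> C" for v
    using \<rho>C[OF that] pX CX span_base[OF that] by auto
  ultimately show ?thesis using p(1) pC by blast
qed

text \<open>\<open>w - p\<close> has finite rank and is a sum of three square-zero maps, so the
  trace obstruction with \<open>l = 0\<close> makes its trace zero. Hence \<open>w\<close> has the
  trace of \<open>p\<close>, which is \<open>t\<close> on each vector of \<open>C\<close>.\<close>

lemma nil_split_trace:
  assumes w: "lin w" and injw: "inj_on w X" and X: "finite X"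
    and ind: "independent (X \<union> w ` X \<union> Z)" and sp: "span (X \<union> w ` X \<union> Z) = UNIV"
    and d1: "X \<inter> w ` X = {}" and d2: "(X \<union> w ` X) \<inter> Z = {}"
    and wim: "\<And>v. w v \<in> span (X \<union> w ` X)"
    and D: "\<And>x. x \<in> span X \<Longrightarrow> w (w x) - w (D x) \<in> span X"
    and s: "nil_split (span X) D A C U L t"
  shows "fr_trace scale w = of_nat (card C) * t"
proof -
  note s' = nil_splitD[OF s]
  obtain p where p: "lin p" "\<And>v. p v \<in> span C" "\<And>v. v \<in> C \<Longrightarrow> p v = t *s v"
    and sum3: "sum_sqz3 (\<lambda>v. w v - p v)"
    using nil_split_sum_sqz3_diff[OF w injw ind sp d1 d2 wim D s] by blast
  define w' where "w' = (\<lambda>v. w v - p v)"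
  have lw': "lin w'" unfolding w'_def by (rule lin_diff[OF w p(1)])
  let ?B = "X \<union> w ` X"
  have CX: "span C \<subseteq> span X" unfolding s'(5)[symmetric] by (rule span_mono) blast
  have fB: "finite ?B" and iB: "independent ?B" using X independent_mono[OF ind] by auto
  have iC: "independent C" using independent_mono[OF s'(4)] by blast
  have fC: "finite C" using independent_finite_span[OF iC _ X] CX span_superset[of C] by blast
  have pB: "p v \<in> span ?B" for v using p(2) CX span_mono[of X ?B] by blast
  have wim': "w' v \<in> span ?B" for v unfolding w'_def by (rule span_diff[OF wim pB])
  have "sum_sqz3 (\<lambda>v. 0 *s v + w' v)" using sum3 by (simp add: w'_def)
  then have tw': "fr_trace scale w' = 0" using sum_sqz3_trace[OF lw' fB wim', of 0] by simp
  have "fr_trace scale w = tr ?B (\<lambda>v. w' v + p v)"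
    using fr_trace_eq_tr[OF w fB iB wim] by (simp add: w'_def)
  also have "\<dots> = tr ?B w' + tr ?B p" by (rule tr_add[OF iB wim' pB])
  also have "tr ?B w' = 0" using fr_trace_eq_tr[OF lw' fB iB wim'] tw' by simp
  also have "tr ?B p = tr C p"
    using fr_trace_eq_tr[OF p(1) fB iB pB] fr_trace_eq_tr[OF p(1) fC iC p(2)] by simp
  also have "tr C p = (\<Sum>b\<in>C. t)" unfolding tr_def
  proof (rule sum.cong[OF refl])
    fix b assume b: "b \<in> C"
    then show "representation C (p b) b = t"
      using iC p(3) by (simp add: representation_scale span_base representation_basis)
  qed
  finally show ?thesis by simp
qed

text \<open>Modulo \<open>S\<close>, each pair \<open>p\<close>, \<open>f p\<close> is a block of
  size two with eigenvalue \<open>l\<close>, so \<open>T^2 - l^2\<close> maps \<open>p\<close> into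
  \<open>S\<close> because \<open>2 l = 0\<close>. As \<open>T\<close> is nilpotent on
  \<open>S\<close>, this operator is onto there, and \<open>p\<close> can be corrected within
  \<open>S\<close> until \<open>T^2\<close> acts on it as \<open>l^2\<close>. The corrected vectors
  become even and their images odd, next to a grading of \<open>S\<close> for which \<open>T\<close>
  is odd.\<close>

lemma nilpotent_plus_pairs_sum_sqz2:
  assumes T: "lin T" and S: "subspace S" and TS: "\<And>v. v \<in> S \<Longrightarrow> T v \<in> S" and nS: "nilp_on T S"
    and l: "l \<noteq> 0" "l + l = 0"
    and Tp: "\<And>p. p \<in> Q \<Longrightarrow> T p - l *s p - f p \<in> S" and Tf: "\<And>p. p \<in> Q \<Longrightarrow> T (f p) - l *s f p \<in> S"
    and Q: "independent Q" and sp: "span (S \<union> Q \<union> f ` Q) = UNIV"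
    and r1: "lin r1" "\<And>v. v \<in> S \<Longrightarrow> r1 v = 0" "\<And>p. p \<in> Q \<Longrightarrow> r1 p = p"
    and r2: "lin r2" "\<And>v. v \<in> S \<Longrightarrow> r2 v = 0" "\<And>p. p \<in> Q \<Longrightarrow> r2 p = 0" "\<And>p. p \<in> Q \<Longrightarrow> r2 (f p) = p"
  shows "sum_sqz2 T"
proof -
  note sS = subspaceD[OF S]
  have ll: "l *s v + l *s v = 0" for v using l(2) by (metis scale_left_distrib scale_zero_left)
  obtain k where k: "\<forall>v\<in>S. (T ^^ k) v = 0" using nS unfolding nilp_on_def by blast
  \<comment> \<open>If \<open>t\<close> solves the equation for \<open>T (T s)\<close>, which dies
    after fewer steps, then \<open>(t - s) / l^2\<close> solves it for \<open>s\<close>.\<close>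
  have surj: "\<exists>t\<in>S. T (T t) - l *s (l *s t) = s" if "s \<in> S" "(T ^^ j) s = 0" for s j
    using that
  proof (induction j arbitrary: s)
    case 0
    then show ?case using sS(1) by (intro bexI[of _ 0]) (auto simp: lin_rules[OF T])
  next
    case (Suc j)
    have "(T ^^ j) (T (T s)) = T ((T ^^ Suc j) s)" by (simp add: funpow_swap1)
    then have "(T ^^ j) (T (T s)) = 0" using Suc.prems(2) by (simp add: lin_rules[OF T])
    then obtain t where t: "t \<in> S" "T (T t) - l *s (l *s t) = T (T s)"
      using Suc.IH[of "T (T s)"] TS Suc.prems(1) by blast
    let ?m = "inverse (l * l)"
    have m: "?m * (l * l) = 1" by (rule left_inverse) (simp add: l(1))
    have "T (T (?m *s (t - s))) - l *s (l *s (?m *s (t - s)))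
       = ?m *s ((T (T t) - l *s (l *s t)) - T (T s)) + (?m * (l * l)) *s s"
      by (simp add: lin_rules[OF T] scale_right_diff_distrib scale_right_distrib algebra_simps)
    also have "\<dots> = s" unfolding t(2) m by simp
    finally show ?case using t(1) Suc.prems(1) sS by blast
  qed
  have ex: "\<exists>t\<in>S. T (T (p - t)) = l *s (l *s (p - t))" if p: "p \<in> Q" for p
  proof -
    define s where "s = T p - l *s p - f p"
    define s' where "s' = T (f p) - l *s f p"
    have ss: "s \<in> S" "s' \<in> S" using Tp[OF p] Tf[OF p] by (auto simp: s_def s'_def)
    have Tps: "T p = l *s p + f p + s" and Tfs: "T (f p) = l *s f p + s'" by (simp_all add: s_def s'_def)
    have "T (T p) - l *s (l *s p) = (l *s f p + l *s f p) + (l *s s + s' + T s)"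
      by (simp add: Tps Tfs lin_rules[OF T] scale_right_distrib algebra_simps)
    then have "T (T p) - l *s (l *s p) = l *s s + s' + T s" by (simp add: ll)
    moreover have "l *s s + s' + T s \<in> S" using ss TS by (intro sS)
    ultimately obtain t where "t \<in> S" "T (T t) - l *s (l *s t) = T (T p) - l *s (l *s p)"
      using surj[OF _ k[rule_format]] by metis
    then show ?thesis by (intro bexI[of _ t]) (simp_all add: lin_rules[OF T] scale_right_diff_distrib algebra_simps)
  qed
  then obtain t where t: "\<And>p. p \<in> Q \<Longrightarrow> t p \<in> S" "\<And>p. p \<in> Q \<Longrightarrow> T (T (p - t p)) = l *s (l *s (p - t p))"
    by metis
  obtain g where g: "lin g" "\<And>p. p \<in> Q \<Longrightarrow> g p = p - t p"
    using ex_lin[OF Q, of "\<lambda>p. p - t p"] by blast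
  have TTg: "T (T (g a)) = l *s (l *s g a)" if "a \<in> span Q" for a
    by (rule lin_eq_on_span[OF lin_compose[OF T lin_compose[OF T g(1)]] lin_scale[OF lin_scale[OF g(1)]] _ that])
      (simp add: g(2) t(2))
  \<comment> \<open>\<open>r1\<close> recovers \<open>a\<close> from \<open>g a\<close>, while
    \<open>r2\<close> kills \<open>g a\<close> and recovers \<open>a\<close> from
    \<open>T (g a)\<close>; this makes the sum of the two graded parts direct.\<close>
  have r1g: "r1 (g a) = a" if "a \<in> span Q" for a
    by (rule lin_eq_on_span[OF lin_compose[OF r1(1) g(1)] lin_ident _ that])
      (simp add: g(2) lin_rules[OF r1(1)] r1 t(1))
  have r2g: "r2 (g a) = 0" if "a \<in> span Q" for a
    by (rule lin_eq_on_span[OF lin_compose[OF r2(1) g(1)] lin_zero _ that])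
      (simp add: g(2) lin_rules[OF r2(1)] r2 t(1))
  have r2Tg: "r2 (T (g a)) = a" if "a \<in> span Q" for a
  proof (rule lin_eq_on_span[OF lin_compose[OF r2(1) lin_compose[OF T g(1)]] lin_ident _ that])
    fix p assume p: "p \<in> Q"
    have "T p = (T p - l *s p - f p) + l *s p + f p" by simp
    then have "r2 (T p) = r2 (T p - l *s p - f p) + l *s r2 p + r2 (f p)" using lin_rules(1,4)[OF r2(1)] by metis
    then have "r2 (T p) = p" using r2(2)[OF Tp[OF p]] r2(3,4)[OF p] by simp
    then show "r2 (T (g p)) = p" using r2(2)[OF TS[OF t(1)[OF p]]] g(2)[OF p]
      by (simp add: lin_rules[OF T] lin_rules[OF r2(1)])
  qed
  have "T ` S \<subseteq> S" using TS by blast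
  from nilpotent_odd_grading[OF T S this k] obtain W0 W1 where W: "subspace W0" "subspace W1" "W0 \<subseteq> S" "W1 \<subseteq> S"
    "W0 \<inter> W1 \<subseteq> {0}" "\<forall>x\<in>S. \<exists>p\<in>W0. \<exists>q\<in>W1. x = p + q" "T ` W0 \<subseteq> W1" "T ` W1 \<subseteq> W0" by metis
  let ?G = "g ` span Q" and ?H = "(\<lambda>a. T (g a)) ` span Q"
  have sG: "subspace ?G" using P.linear_subspace_image[OF g(1) subspace_span] .
  have sH: "subspace ?H" using P.linear_subspace_image[OF lin_compose[OF T g(1)] subspace_span] .
  have W0: "span W0 = W0" and W1: "span W1 = W1" and G: "span ?G = ?G" and H: "span ?H = ?H"
    using W(1,2) sG sH by simp_all
  have E: "x \<in> span (W0 \<union> ?G) \<longleftrightarrow> (\<exists>p\<in>W0. \<exists>a\<in>span Q. x = p + g a)" for x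
    unfolding span_Un W0 G by blast
  have F: "x \<in> span (W1 \<union> ?H) \<longleftrightarrow> (\<exists>p\<in>W1. \<exists>a\<in>span Q. x = p + T (g a))" for x
    unfolding span_Un W1 H by blast
  show ?thesis
  proof (rule odd_grading_sum_sqz2[OF T subspace_span subspace_span])
    fix x assume xE: "x \<in> span (W0 \<union> ?G)" and xF: "x \<in> span (W1 \<union> ?H)"
    obtain p a where a: "p \<in> W0" "a \<in> span Q" "x = p + g a" using xE E by blast
    obtain q b where b: "q \<in> W1" "b \<in> span Q" "x = q + T (g b)" using xF F by blast
    have pS: "p \<in> S" and qS: "q \<in> S" using a(1) b(1) W by blast+
    have "r2 x = 0" using r2(2)[OF pS] r2g[OF a(2)] unfolding a(3) by (simp add: lin_rules[OF r2(1)])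
    moreover have "r2 x = b" using r2(2)[OF qS] r2Tg[OF b(2)] unfolding b(3) by (simp add: lin_rules[OF r2(1)])
    ultimately have "x = q" using b by (simp add: lin_rules[OF g(1)] lin_rules[OF T])
    then have "r1 x = 0" using r1(2)[OF qS] by simp
    moreover have "r1 x = a" using r1(2)[OF pS] r1g[OF a(2)] unfolding a(3) by (simp add: lin_rules[OF r1(1)])
    ultimately have "x = p" using a by (simp add: lin_rules[OF g(1)])
    then show "x = 0" using \<open>x = q\<close> a(1) b(1) W(5) by blast
  next
    fix v
    let ?R = "span (span (W0 \<union> ?G) \<union> span (W1 \<union> ?H))"
    have inE: "x \<in> ?R" if "x \<in> W0 \<or> x \<in> ?G" for x using that by (auto intro!: span_base)
    have inF: "x \<in> ?R" if "x \<in> W1 \<or> x \<in> ?H" for x using that by (auto intro!: span_base)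
    have RS: "x \<in> ?R" if x: "x \<in> S" for x
    proof -
      obtain p q where pq: "p \<in> W0" "q \<in> W1" "x = p + q" using W(6) x by blast
      show ?thesis unfolding pq(3) using inE[of p] inF[of q] pq by (intro span_add) auto
    qed
    have RQ: "p \<in> ?R" "f p \<in> ?R" if p: "p \<in> Q" for p
    proof -
      have p': "p \<in> span Q" using p by (rule span_base)
      have gp: "g p \<in> ?R" "T (g p) \<in> ?R" using inE[of "g p"] inF[of "T (g p)"] p' by blast+
      have "p = g p + t p" using g(2)[OF p] by simp
      then show pR: "p \<in> ?R" using span_add[OF gp(1) RS[OF t(1)[OF p]]] by simp
      have "f p = T (g p) + T (t p) - l *s p - (T p - l *s p - f p)"
        using g(2)[OF p] by (simp add: lin_rules[OF T])
      moreover have "\<dots> \<in> ?R"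
        by (intro span_diff[OF span_diff[OF span_add[OF gp(2) RS[OF TS[OF t(1)[OF p]]]] span_scale[OF pR]] RS[OF Tp[OF p]]])
      ultimately show "f p \<in> ?R" by metis
    qed
    have "span (S \<union> Q \<union> f ` Q) \<subseteq> ?R" by (rule span_minimal) (use RS RQ in auto)
    then have "v \<in> ?R" using sp by auto
    then show "\<exists>e\<in>span (W0 \<union> ?G). \<exists>f\<in>span (W1 \<union> ?H). v = e + f"
      unfolding span_Un[of "span (W0 \<union> ?G)"] span_span by blast
  next
    fix x assume "x \<in> span (W0 \<union> ?G)"
    then obtain p a where a: "p \<in> W0" "a \<in> span Q" "x = p + g a" using E by blast
    then have "T x = T p + T (g a)" "T p \<in> W1" using W(7) by (auto simp: lin_rules[OF T])
    then show "T x \<in> span (W1 \<union> ?H)" using F a(2) by blast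
  next
    fix x assume "x \<in> span (W1 \<union> ?H)"
    then obtain p a where a: "p \<in> W1" "a \<in> span Q" "x = p + T (g a)" using F by blast
    then have "T x = T p + g ((l * l) *s a)" "T p \<in> W0" using W(8) TTg[OF a(2)] by (auto simp: lin_rules[OF T] lin_rules[OF g(1)])
    moreover have "(l * l) *s a \<in> span Q" using a(2) by (rule span_scale)
    ultimately show "T x \<in> span (W0 \<union> ?G)" using E by blast
  qed
qed

text \<open>If \<open>w v = p + w q\<close> with \<open>p\<close> and \<open>q\<close> in
  \<open>span X\<close>, then \<open>w\<close> maps \<open>v - q\<close> into \<open>span X\<close>;
  so only such vectors are needed besides \<open>X\<close> and its image. Those in the kernel are
  chosen first, which makes \<open>w\<close> injective on the span of the rest and allows the size
  of \<open>Z1\<close> to be bounded through \<open>span X\<close>.\<close>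

lemma ex_adapted_basis:
  assumes w: "lin w" and ind: "independent (X \<union> w ` X)" and wim: "\<And>v. w v \<in> span (X \<union> w ` X)"
  shows "\<exists>Z1 Z2. independent (X \<union> w ` X \<union> (Z1 \<union> Z2)) \<and> span (X \<union> w ` X \<union> (Z1 \<union> Z2)) = UNIV \<and>
     (X \<union> w ` X) \<inter> (Z1 \<union> Z2) = {} \<and> Z1 \<inter> Z2 = {} \<and> (\<forall>z\<in>Z1. w z \<in> span X) \<and> (\<forall>z\<in>Z2. w z = 0) \<and>
     independent (w ` Z1) \<and> inj_on w Z1"
proof -
  let ?S = "X \<union> w ` X"
  obtain Z2 where Z2: "Z2 \<subseteq> ?S \<union> {v. w v = 0}" "independent (?S \<union> Z2)" "?S \<inter> Z2 = {}"
    "?S \<union> {v. w v = 0} \<subseteq> span (?S \<union> Z2)"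
    using independent_extends_within[OF ind, of "?S \<union> {v. w v = 0}"] by blast
  have sub: "?S \<union> Z2 \<subseteq> ?S \<union> Z2 \<union> {v. w v \<in> span X}" by blast
  obtain Z1 where Z1: "Z1 \<subseteq> ?S \<union> Z2 \<union> {v. w v \<in> span X}" "independent (?S \<union> Z2 \<union> Z1)" "(?S \<union> Z2) \<inter> Z1 = {}"
    "?S \<union> Z2 \<union> {v. w v \<in> span X} \<subseteq> span (?S \<union> Z2 \<union> Z1)"
    using independent_extends_within[OF Z2(2) sub] by blast
  have eq: "?S \<union> Z2 \<union> Z1 = ?S \<union> (Z1 \<union> Z2)" by blast
  have wZ2: "w z = 0" if "z \<in> Z2" for z using Z2(1,3) that by blast
  have wZ1: "w z \<in> span X" if "z \<in> Z1" for z using Z1(1,3) that by blast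
  have "v \<in> span (?S \<union> (Z1 \<union> Z2))" for v
  proof -
    obtain p q where pq: "w v = p + w q" "p \<in> span X" "q \<in> span X"
      using wim[of v] unfolding span_Un P.linear_span_image[OF w] by blast
    then have "w (v - q) \<in> span X" by (simp add: lin_rules[OF w])
    then have "v - q \<in> span (?S \<union> (Z1 \<union> Z2))" using Z1(4) eq by auto
    moreover have "q \<in> span (?S \<union> (Z1 \<union> Z2))" using pq(3) span_mono[of X "?S \<union> (Z1 \<union> Z2)"] by blast
    ultimately have "(v - q) + q \<in> span (?S \<union> (Z1 \<union> Z2))" by (rule span_add)
    then show ?thesis by simp
  qed
  then have sp: "span (?S \<union> (Z1 \<union> Z2)) = UNIV" by blast
  have "v = 0" if "v \<in> span Z1" "w v = 0" for v
    using independent_span_disjoint[OF Z1(2,3)] Z2(4) that by blast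
  then have inj: "inj_on w (span Z1)" using P.linear_inj_on_iff_eq_0[OF w subspace_span] by blast
  have iZ1: "independent Z1" using independent_mono[OF Z1(2)] by blast
  have "independent (w ` Z1)" using P.linear_independent_injective_image[OF w iZ1 inj] .
  moreover have "inj_on w Z1" using inj_on_subset[OF inj span_superset] .
  moreover have "?S \<inter> (Z1 \<union> Z2) = {}" "Z1 \<inter> Z2 = {}" using Z1(3) Z2(3) by blast+
  moreover have "independent (?S \<union> (Z1 \<union> Z2))" using Z1(2) eq by simp
  ultimately show ?thesis using sp wZ1 wZ2 by (intro exI[of _ Z1] exI[of _ Z2]) simp
qed

text \<open>\<open>D\<close> is the compression of \<open>w\<close> to the span of the image of
  \<open>X\<close>, transported to \<open>span X\<close> along \<open>w\<close>.\<close>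

lemma ex_compression_on:
  assumes w: "lin w" and ind: "independent X" and wim: "\<And>v. w v \<in> span (X \<union> w ` X)"
  shows "\<exists>D. lin D \<and> (\<forall>x\<in>span X. D x \<in> span X \<and> w (w x) - w (D x) \<in> span X)"
proof -
  have "\<exists>d\<in>span X. w (w x) - w d \<in> span X" for x
  proof -
    obtain p q where pq: "w (w x) = p + w q" "p \<in> span X" "q \<in> span X"
      using wim[of "w x"] unfolding span_Un P.linear_span_image[OF w] by blast
    then show ?thesis by (intro bexI[of _ q]) simp_all
  qed
  then obtain d where d: "\<And>x. d x \<in> span X" "\<And>x. w (w x) - w (d x) \<in> span X" by metis
  obtain D where D: "lin D" "\<And>x. x \<in> X \<Longrightarrow> D x = d x" using ex_lin[OF ind, of d] by blast
  have "D x \<in> span X" if "x \<in> span X" for x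
    by (rule lin_span_into[OF D(1) subspace_span _ that]) (simp add: D(2) d(1))
  moreover have "w (w x) - w (D x) \<in> span X" if "x \<in> span X" for x
    by (rule lin_span_into[OF lin_diff[OF lin_compose[OF w w] lin_compose[OF w D(1)]] subspace_span _ that])
      (simp add: D(2) d(2))
  ultimately show ?thesis using D(1) by blast
qed

text \<open>For nonzero \<open>l\<close>, \<open>T = l + w - c\<close> is nilpotent on
  \<open>?S\<close>, and the remaining vectors form pairs \<open>z\<close>, \<open>f z\<close> on
  which \<open>T\<close> is, modulo \<open>?S\<close>, a block of size two with eigenvalue
  \<open>l\<close>. The vectors of \<open>C\<close> are second members of such pairs; all first
  members come from \<open>Z1\<close> and the kernel.\<close>

lemma nil_split_sum_sqz3:
  assumes w: "lin w" and injw: "inj_on w X" and X: "finite X"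
    and ind: "independent (X \<union> w ` X \<union> (Z1 \<union> Z2))" and sp: "span (X \<union> w ` X \<union> (Z1 \<union> Z2)) = UNIV"
    and d1: "X \<inter> w ` X = {}" and d2: "(X \<union> w ` X) \<inter> (Z1 \<union> Z2) = {}" and d3: "Z1 \<inter> Z2 = {}"
    and wim: "\<And>v. w v \<in> span (X \<union> w ` X)" and wZ1: "\<And>z. z \<in> Z1 \<Longrightarrow> w z \<in> span X"
    and wZ2: "\<And>z. z \<in> Z2 \<Longrightarrow> w z = 0" and Z1: "finite Z1" and Z2: "infinite Z2"
    and D: "\<And>x. x \<in> span X \<Longrightarrow> w (w x) - w (D x) \<in> span X"
    and s: "nil_split (span X) D A C U L t"
    and l: "l + l = 0" and C: "C = {} \<or> (t = l \<and> l \<noteq> 0)"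
  shows "sum_sqz3 (\<lambda>v. l *s v + w v)"
proof (cases "l = 0")
  case True
  then have "C = {}" using C by blast
  moreover obtain p where "\<And>v. p v \<in> span C" "sum_sqz3 (\<lambda>v. w v - p v)"
    using nil_split_sum_sqz3_diff[OF w injw ind sp d1 d2 wim D s] by blast
  ultimately show ?thesis using True by simp
next
  case l0: False
  note s = nil_splitD[OF s]
  let ?B = "X \<union> w ` X \<union> (Z1 \<union> Z2)"
  have ll: "l *s v + l *s v = 0" for v using l by (metis scale_left_distrib scale_zero_left)
  have CX: "span C \<subseteq> span X" and AX: "span A \<subseteq> span X"
    unfolding s(5)[symmetric] by (rule span_mono; blast)+
  have iC: "independent C" using independent_mono[OF s(4)] by blast
  have fC: "finite C" using independent_finite_span[OF iC _ X] CX span_superset[of C] by blast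
  obtain P Q f where PQ: "Z2 = P \<union> Q" "P \<inter> Q = {}" and f: "bij_betw f (Z1 \<union> P) (C \<union> Q)"
    using pairing_exists[OF Z2 Z1 fC] by blast
  let ?P = "Z1 \<union> P"
  \<comment> \<open>Since \<open>2 l = 0\<close>, shifting both parts by \<open>l\<close> keeps
    their sum equal to \<open>D\<close>; adding \<open>l\<close> to \<open>w\<close> later restores
    \<open>U\<close> and \<open>L\<close>.\<close>
  define R where "R = (\<lambda>x. U x - l *s x)"
  define S where "S = (\<lambda>x. L x - l *s x)"
  have R: "lin R" and S: "lin S" unfolding R_def S_def by (rule lin_diff[OF _ lin_scale[OF lin_ident]], rule s)+
  have RS: "D x = R x + S x \<and> R x \<in> span X \<and> S x \<in> span X" if x: "x \<in> span X" for x
  proof -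
    have "R x + S x = U x + L x - (l *s x + l *s x)" by (simp add: R_def S_def algebra_simps)
    then have "D x = R x + S x" using s(6)[OF x] by (simp add: ll)
    then show ?thesis unfolding R_def S_def using s(7,8)[OF x] x by (simp add: span_diff span_scale)
  qed
  \<comment> \<open>On first members \<open>c\<close> removes \<open>w z\<close> and leaves
    \<open>T z = l z + f z\<close>. On \<open>Q\<close> both \<open>c\<close> and \<open>w\<close>
    vanish, so \<open>T\<close> acts as \<open>l\<close>.\<close>
  define g where "g = (\<lambda>z. if z \<in> ?P then w z - f z else 0)"
  have fim: "f z \<in> C \<union> Q" if "z \<in> ?P" for z using bij_betw_apply[OF f that] .
  have gX: "g z \<in> span (X \<union> Q)" if z: "z \<in> Z1 \<union> Z2" for z
  proof (cases "z \<in> ?P")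
    case True
    have up: "span X \<subseteq> span (X \<union> Q)" "span Q \<subseteq> span (X \<union> Q)" by (rule span_mono; blast)+
    have "w z \<in> span X" using wZ1 wZ2 PQ True span_zero by auto
    moreover have "f z \<in> span (X \<union> Q)" using fim[OF True] CX up span_base by blast
    ultimately show ?thesis unfolding g_def using True up by (auto intro: span_diff)
  next
    case False then show ?thesis by (simp add: g_def span_zero)
  qed
  have gQ: "g z = 0" if "z \<in> Q" for z using that PQ d3 by (auto simp: g_def)
  have QZ: "Q \<subseteq> Z1 \<union> Z2" using PQ by blast
  obtain c where c: "lin c" "square_zero c" "\<And>x. x \<in> span X \<Longrightarrow> c x = 0"
    "\<And>x. x \<in> span X \<Longrightarrow> w (w x - R x) - c (w x - R x) = w (S x) - R (S x)" "\<And>z. z \<in> Z1 \<union> Z2 \<Longrightarrow> c z = g z"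
  proof -
    have "\<exists>c. lin c \<and> square_zero c \<and> (\<forall>x\<in>span X. c x = 0) \<and>
       (\<forall>x\<in>span X. w (w x - R x) - c (w x - R x) = w (S x) - R (S x)) \<and> (\<forall>z\<in>Z1 \<union> Z2. c z = g z)"
      by (rule ex_square_zero_correction[OF w injw ind sp d1 d2 D R S RS QZ gX gQ])
    then show thesis using that by blast
  qed
  define T where "T = (\<lambda>v. (l *s v + w v) - c v)"
  have T: "lin T" unfolding T_def by (rule lin_diff[OF lin_add[OF lin_scale[OF lin_ident] w] c(1)])
  define y where "y = (\<lambda>x. w x - R x)"
  have y: "lin y" unfolding y_def by (rule lin_diff[OF w R])
  have TX: "T x = U x + y x" if "x \<in> span X" for x
    unfolding T_def y_def R_def using c(3)[OF that] by (simp add: ll algebra_simps)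
  have Ty: "T (y x) = y (L x)" if x: "x \<in> span X" for x
  proof -
    have "T (y x) = l *s y x + (w (S x) - R (S x))" using c(4)[OF x] unfolding T_def y_def by (simp add: algebra_simps)
    also have "\<dots> = y (l *s x + S x)" by (simp add: y_def lin_rules[OF w] lin_rules[OF R] scale_right_diff_distrib algebra_simps)
    also have "l *s x + S x = L x" by (simp add: S_def)
    finally show ?thesis .
  qed
  let ?S = "span (span A \<union> y ` span X)"
  have TA: "T v = U v + y v" if "v \<in> span A" for v using TX AX that by blast
  note nil = block_triangular_nilp_on[OF T y s(1) subspace_span AX subspace_span TA Ty s(10,11,8,9)]
  have Sy: "y x \<in> ?S" if "x \<in> span X" for x using that by (simp add: span_base)
  have SA: "x \<in> ?S" if "x \<in> span A" for x using that by (simp add: span_base)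
  have TZ: "T z - l *s z - f z = 0" if "z \<in> ?P" for z
    using c(5)[of z] that PQ unfolding T_def g_def by auto
  have TC: "T z - l *s z \<in> ?S" if z: "z \<in> C" for z
  proof -
    have zX: "z \<in> span X" using CX span_base[OF z] by blast
    have "U z - l *s z \<in> span A" using s(12)[OF z] C z by auto
    then have "(U z - l *s z) + y z \<in> ?S" by (rule span_add[OF SA Sy[OF zX]])
    then show ?thesis unfolding TX[OF zX] by (simp add: algebra_simps)
  qed
  have TQ: "T z - l *s z = 0" if z: "z \<in> Q" for z
    using c(5)[of z] gQ[OF z] wZ2[of z] z PQ(1) unfolding T_def by auto
  have iP: "independent ?P" using independent_mono[OF ind] PQ(1) by blast
  \<comment> \<open>The map \<open>r\<close> is prescribed on \<open>C\<close> and
    \<open>Z1 \<union> Z2\<close>; its values on the image of \<open>X\<close> are chosen so that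
    every \<open>y x\<close> is killed.\<close>
  have E: "\<exists>r. lin r \<and> (\<forall>v\<in>?S. r v = 0) \<and> (\<forall>z\<in>C. r z = \<rho> z) \<and> (\<forall>z\<in>Z1 \<union> Z2. r z = \<pi> z)" for \<rho> \<pi>
  proof -
    obtain q where q: "lin q" "\<And>b. b \<in> A \<union> C \<Longrightarrow> q b = (if b \<in> A then 0 else \<rho> b)"
      using ex_lin[OF s(4), of "\<lambda>b. if b \<in> A then 0 else \<rho> b"] by blast
    obtain r where r: "lin r" "\<And>b. b \<in> ?B \<Longrightarrow> r b = (if b \<in> X then q b else if b \<in> Z1 \<union> Z2 then \<pi> b else q (R (inv_into X w b)))"
      using ex_lin[OF ind, of "\<lambda>b. if b \<in> X then q b else if b \<in> Z1 \<union> Z2 then \<pi> b else q (R (inv_into X w b))"] by blast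
    have rX: "r x = q x" if "x \<in> span X" for x
      by (rule lin_eq_on_span[OF r(1) q(1) _ that]) (simp add: r(2))
    have rw: "r (w x) = q (R x)" if "x \<in> span X" for x
    proof (rule lin_eq_on_span[OF lin_compose[OF r(1) w] lin_compose[OF q(1) R] _ that])
      fix b assume b: "b \<in> X"
      then have "w b \<notin> X" "w b \<notin> Z1 \<union> Z2" using d1 d2 by auto
      then show "r (w b) = q (R b)" using r(2)[of "w b"] b inv_into_f_f[OF injw b] by simp
    qed
    have ry: "r (y x) = 0" if x: "x \<in> span X" for x
      unfolding y_def using rw[OF x] rX RS[OF x] by (simp add: lin_rules[OF r(1)])
    have qA: "q v = 0" if "v \<in> span A" for v
      by (rule lin_eq_on_span[OF q(1) lin_zero _ that]) (simp add: q(2))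
    have "r v = 0" if v: "v \<in> ?S" for v
      by (rule lin_eq_on_span[OF r(1) lin_zero _ v]) (use qA AX rX ry in auto)
    moreover have "r z = \<rho> z" if z: "z \<in> C" for z
    proof -
      have "z \<in> span X" "z \<notin> A" using CX span_base[OF z] z s(3) by blast+
      then show ?thesis using rX[of z] q(2)[of z] z by simp
    qed
    moreover have "r z = \<pi> z" if z: "z \<in> Z1 \<union> Z2" for z using r(2)[of z] z d2 by auto
    ultimately show ?thesis using r(1) by blast
  qed
  obtain r1 where r1: "lin r1" "\<forall>v\<in>?S. r1 v = 0" "\<forall>z\<in>C. r1 z = 0" "\<forall>z\<in>Z1 \<union> Z2. r1 z = (if z \<in> ?P then z else 0)"
    using E[of "\<lambda>_. 0" "\<lambda>z. if z \<in> ?P then z else 0"] by blast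
  obtain r2 where r2: "lin r2" "\<forall>v\<in>?S. r2 v = 0" "\<forall>z\<in>C. r2 z = inv_into ?P f z"
    "\<forall>z\<in>Z1 \<union> Z2. r2 z = (if z \<in> ?P then 0 else inv_into ?P f z)"
    using E[of "inv_into ?P f" "\<lambda>z. if z \<in> ?P then 0 else inv_into ?P f z"] by blast
  have "sum_sqz2 T"
  proof (rule nilpotent_plus_pairs_sum_sqz2[OF T subspace_span nil(2,1) l0 l _ _ iP _ r1(1) _ _ r2(1)])
    show "T p - l *s p - f p \<in> ?S" if "p \<in> ?P" for p using TZ[OF that] span_zero by simp
    show "T (f p) - l *s f p \<in> ?S" if p: "p \<in> ?P" for p
    proof (cases "f p \<in> C")
      case True then show ?thesis by (rule TC)
    next
      case False
      then have "f p \<in> Q" using fim[OF p] by blast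
      then show ?thesis using TQ span_zero by simp
    qed
    show "r1 v = 0" if "v \<in> ?S" for v using r1(2) that by blast
    show "r1 p = p" if "p \<in> ?P" for p using r1(4) that PQ(1) by auto
    show "r2 v = 0" if "v \<in> ?S" for v using r2(2) that by blast
    show "r2 p = 0" if "p \<in> ?P" for p using r2(4) that PQ(1) by auto
    show "r2 (f p) = p" if p: "p \<in> ?P" for p
    proof -
      have "r2 (f p) = inv_into ?P f (f p)"
        using fim[OF p] r2(3,4) PQ d3 by auto
      then show ?thesis using bij_betw_inv_into_left[OF f p] by simp
    qed
    show "span (?S \<union> ?P \<union> f ` ?P) = UNIV"
    proof -
      let ?R = "span (?S \<union> ?P \<union> f ` ?P)"
      have fP: "f ` ?P = C \<union> Q" using f by (simp add: bij_betw_def)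
      have "span (A \<union> C) \<subseteq> ?R"
      proof (rule span_minimal)
        show "A \<union> C \<subseteq> ?R" using SA span_base[of _ A] span_base[of _ "?S \<union> ?P \<union> f ` ?P"] fP by blast
      qed simp
      then have XR: "span X \<subseteq> ?R" using s(5) by simp
      have "w x \<in> ?R" if "x \<in> X" for x
      proof -
        have x: "x \<in> span X" using that by (rule span_base)
        have "y x \<in> ?R" using Sy[OF x] span_base[of _ "?S \<union> ?P \<union> f ` ?P"] by blast
        then have "y x + R x \<in> ?R" using RS[OF x] XR by (intro span_add) auto
        then show ?thesis by (simp add: y_def)
      qed
      moreover have "Z1 \<union> Z2 \<subseteq> ?R" using PQ(1) fP span_base[of _ "?S \<union> ?P \<union> f ` ?P"] by blast
      moreover have "X \<subseteq> ?R" using XR span_superset[of X] by blast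
      ultimately have "span ?B \<subseteq> ?R" by (intro span_minimal) auto
      then show ?thesis unfolding sp by blast
    qed
  qed
  then show ?thesis using sum_sqz3I[OF c(1,2)] unfolding T_def by simp
qed

text \<open>The trace decides which construction is available. If \<open>D\<close> is a scalar
  \<open>m\<close>, then \<open>card X\<close> times \<open>m\<close> is \<open>0\<close> and the
  cyclic shift applies, or it is a nonzero \<open>l\<close> and all of \<open>X\<close> serves as
  \<open>C\<close>. Otherwise \<open>D\<close> splits with one exceptional vector, whose diagonal
  entry is the trace.\<close>

lemma finite_rank_sum_sqz3:
  assumes w: "lin w" and injw: "inj_on w X" and X: "finite X"
    and ind: "independent (X \<union> w ` X \<union> (Z1 \<union> Z2))" and sp: "span (X \<union> w ` X \<union> (Z1 \<union> Z2)) = UNIV"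
    and d1: "X \<inter> w ` X = {}" and d2: "(X \<union> w ` X) \<inter> (Z1 \<union> Z2) = {}" and d3: "Z1 \<inter> Z2 = {}"
    and wim: "\<And>v. w v \<in> span (X \<union> w ` X)" and wZ1: "\<And>z. z \<in> Z1 \<Longrightarrow> w z \<in> span X"
    and wZ2: "\<And>z. z \<in> Z2 \<Longrightarrow> w z = 0" and Z1: "finite Z1" and Z2: "infinite Z2"
    and l: "l + l = 0" and trace: "fr_trace scale w \<in> {0, l}"
  shows "sum_sqz3 (\<lambda>v. l *s v + w v)"
proof -
  have iX: "independent X" using independent_mono[OF ind] by blast
  obtain D where D: "lin D" "\<And>x. x \<in> span X \<Longrightarrow> D x \<in> span X" "\<And>x. x \<in> span X \<Longrightarrow> w (w x) - w (D x) \<in> span X"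
    using ex_compression_on[OF w iX wim] by blast
  have fin: "sum_sqz3 (\<lambda>v. l *s v + w v)"
    if "nil_split (span X) D A C U L t" "C = {} \<or> (t = l \<and> l \<noteq> 0)" for A C U L t
    by (rule nil_split_sum_sqz3[OF w injw X ind sp d1 d2 d3 wim wZ1 wZ2 Z1 Z2 D(3) that(1) l that(2)])
  have tr: "fr_trace scale w = of_nat (card C) * t" if "nil_split (span X) D A C U L t" for A C U L t
    by (rule nil_split_trace[OF w injw X ind sp d1 d2 wim D(3) that])
  show ?thesis
  proof (cases "\<exists>m. \<forall>v\<in>span X. D v = m *s v")
    case True
    then obtain m where m: "\<And>v. v \<in> span X \<Longrightarrow> D v = m *s v" by blast
    have s: "nil_split (span X) D {} X (\<lambda>v. m *s v) (\<lambda>v. 0) m"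
      unfolding nil_split_def using m iX lin_scale[OF lin_ident] lin_zero
      by (auto simp: span_zero span_scale nilp_on_def intro: exI[of _ 1] exI[of _ 0])
    have tm: "of_nat (card X) * m \<in> {0, l}" using tr[OF s] trace by simp
    show ?thesis
    proof (cases "of_nat (card X) * m = 0")
      case True
      obtain P Q f where PQ: "Z2 = P \<union> Q" "P \<inter> Q = {}" and f: "bij_betw f (Z1 \<union> P) ({} \<union> Q)"
        using pairing_exists[OF Z2 Z1 finite.emptyI] by blast
      have eq: "(Z1 \<union> P) \<union> Q = Z1 \<union> Z2" using PQ by blast
      show ?thesis
      proof (rule scalar_compression_sum_sqz3[OF w injw X, of "Z1 \<union> P" Q f m])
        show "independent (X \<union> w ` X \<union> (Z1 \<union> P \<union> Q))" "span (X \<union> w ` X \<union> (Z1 \<union> P \<union> Q)) = UNIV"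
          "(X \<union> w ` X) \<inter> (Z1 \<union> P \<union> Q) = {}" unfolding eq using ind sp d2 by auto
        show "bij_betw f (Z1 \<union> P) Q" using f by simp
        show "(Z1 \<union> P) \<inter> Q = {}" using PQ d3 by blast
        show "w k \<in> span X" if "k \<in> Z1 \<union> P" for k using that wZ1 wZ2 PQ span_zero by auto
        show "w k = 0" if "k \<in> Q" for k using that wZ2 PQ by blast
        fix n assume "n \<in> w ` X"
        then obtain x where x: "x \<in> X" "n = w x" by blast
        then show "w n - m *s n \<in> span X" using D(3)[of x] m[of x] span_base by (simp add: lin_rules[OF w])
      qed (use d1 True l in auto)
    next
      case False
      then have ml: "of_nat (card X) * m = l" "l \<noteq> 0" using tm by auto
      \<comment> \<open>A nonzero \<open>l\<close> with \<open>2 l = 0\<close> forces characteristic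
        two. Then \<open>card X\<close> times \<open>m\<close> is \<open>0\<close> or
        \<open>m\<close>, whence \<open>m = l\<close>.\<close>
      have "(1 + 1) * l = 0" using l by (simp add: distrib_right)
      then have "(1::'a) + 1 = 0" using ml(2) by (simp only: mult_eq_0_iff) simp
      then have "(1 + 1) * m = 0" by (simp only: mult_zero_left)
      then have "m + m = 0" by (simp add: distrib_right)
      then have "m = l" using tr_conv_if_two_zero[of m "card X"] ml by auto
      then show ?thesis using fin[OF s] ml by blast
    qed
  next
    case False
    have "X \<noteq> {}"
    proof
      assume "X = {}"
      then have "\<forall>v\<in>span X. D v = 0 *s v" using lin_rules(5)[OF D(1)] by simp
      then show False using False by blast
    qed
    then obtain A x U L t where s: "nil_split (span X) D A {x} U L t"
      using nonscalar_nil_split[OF X iX _ D(1,2)] False by blast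
    have t: "t \<in> {0, l}" using tr[OF s] trace by simp
    show ?thesis
    proof (cases "t = 0")
      \<comment> \<open>With \<open>t = 0\<close> the exceptional vector joins \<open>A\<close>,
        leaving \<open>C\<close> empty.\<close>
      case True
      note s' = nil_splitD[OF s]
      have AX: "span A \<subseteq> span X" unfolding s'(5)[symmetric] by (rule span_mono) blast
      have UA: "U v \<in> span A" if v: "v \<in> span X" for v
      proof (rule lin_span_into[OF s'(1) subspace_span])
        show "v \<in> span (A \<union> {x})" using v s'(5) by simp
        show "U b \<in> span A" if "b \<in> A \<union> {x}" for b
          using that s'(10)[OF span_base] s'(12)[of b] True by auto
      qed
      have nU: "nilp_on U (span X)" by (rule nilp_on_extend[OF s'(1,11) UA])
      have "nil_split (span X) D (A \<union> {x}) {} U L t"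
        unfolding nil_split_def using s'(1,2,4-9) nU by simp
      then show ?thesis by (rule fin) blast
    next
      case False
      then have "t = l" "l \<noteq> 0" using t by auto
      then show ?thesis using fin[OF s] by blast
    qed
  qed
qed

section \<open>Arbitrary rank\<close>

text \<open>Only half of \<open>X\<close> is kept as the doubling set. The other half, its image and
  \<open>Z1\<close> form the wandering basis, whose product with the natural numbers is equipotent
  to the image of \<open>X1\<close>, as the shift construction demands.\<close>

lemma infinite_rank_sum_sqz3:
  assumes w: "lin w" and injw: "inj_on w X" and X: "infinite X"
    and ind: "independent (X \<union> w ` X \<union> (Z1 \<union> Z2))" and sp: "span (X \<union> w ` X \<union> (Z1 \<union> Z2)) = UNIV"
    and d1: "X \<inter> w ` X = {}" and d2: "(X \<union> w ` X) \<inter> (Z1 \<union> Z2) = {}" and d3: "Z1 \<inter> Z2 = {}"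
    and Z1: "(card_of Z1, card_of X) \<in> ordLeq" and Z2: "Z2 = {} \<or> infinite Z2"
    and wZ2: "\<And>z. z \<in> Z2 \<Longrightarrow> w z = 0"
    and wN: "\<And>n. n \<in> w ` X \<union> Z1 \<Longrightarrow> w n \<in> span (X \<union> w ` X \<union> Z1)"
    and l: "l + l = 0"
  shows "sum_sqz3 (\<lambda>v. l *s v + w v)"
proof -
  obtain X1 X2 where X12: "X = X1 \<union> X2" "X1 \<inter> X2 = {}" and
    iso: "(card_of X1, card_of X) \<in> ordIso" "(card_of X2, card_of X) \<in> ordIso"
    using infinite_split[OF X] by blast
  let ?Z = "X2 \<union> w ` X2 \<union> Z1"
  have inj1: "inj_on w X1" using inj_on_subset[OF injw] X12(1) by blast
  have wd: "w ` X1 \<inter> w ` X2 = {}"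
    using inj_on_image_Int[OF injw, of X1 X2] X12 by auto
  have wX: "w ` X = w ` X1 \<union> w ` X2" using X12(1) by blast
  have le2: "(card_of X2, card_of X) \<in> ordLeq" using iso(2) ordIso_iff_ordLeq by blast
  have "(card_of ?Z, card_of X) \<in> ordLeq"
    by (intro ordLeq_Un_infinite[OF X] le2 Z1 ordLeq_transitive[OF card_of_image le2])
  moreover have "(card_of X, card_of ?Z) \<in> ordLeq"
    by (rule ordIso_ordLeq_trans[OF ordIso_symmetric[OF iso(2)] card_of_mono1]) blast
  ultimately have ZX: "(card_of ?Z, card_of X) \<in> ordIso" by (simp add: ordIso_iff_ordLeq)
  then have iZ: "infinite ?Z" using card_of_ordIso_finite X by blast
  have "(card_of (UNIV :: nat set), card_of ?Z) \<in> ordLeq" using iZ infinite_iff_card_of_nat by blast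
  from card_of_Times_infinite[OF iZ _ this]
  have "(card_of (?Z \<times> (UNIV :: nat set)), card_of ?Z) \<in> ordIso" by blast
  from ordIso_transitive[OF this ZX]
  have "(card_of (?Z \<times> (UNIV :: nat set)), card_of X1) \<in> ordIso"
    by (rule ordIso_transitive[OF _ ordIso_symmetric[OF iso(1)]])
  moreover have "(card_of X1, card_of (w ` X1)) \<in> ordIso"
    using card_of_ordIsoI[OF inj_on_imp_bij_betw[OF inj1]] .
  ultimately have "(card_of (?Z \<times> (UNIV :: nat set)), card_of (w ` X1)) \<in> ordIso" by (rule ordIso_transitive)
  from ordIso_bij[OF this] obtain g where g: "bij_betw g (?Z \<times> (UNIV :: nat set)) (w ` X1)" ..
  have "\<exists>K1 K2 \<kappa>. Z2 = K1 \<union> K2 \<and> K1 \<inter> K2 = {} \<and> bij_betw \<kappa> K1 K2"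
  proof (cases "Z2 = {}")
    case True then show ?thesis by (intro exI[of _ "{}"]) auto
  next
    case False
    then have "infinite Z2" using Z2 by blast
    from pairing_exists[OF this finite.emptyI finite.emptyI] show ?thesis by simp
  qed
  then obtain K1 K2 \<kappa> where K: "Z2 = K1 \<union> K2" "K1 \<inter> K2 = {}" "bij_betw \<kappa> K1 K2" by blast
  have eqN: "X1 \<union> (w ` X1 \<union> ?Z) = X \<union> w ` X \<union> Z1" using X12(1) wX by blast
  have eq: "X1 \<union> (w ` X1 \<union> ?Z) \<union> (K1 \<union> K2) = X \<union> w ` X \<union> (Z1 \<union> Z2)" using X12(1) wX K(1) by blast
  obtain Y1 Y2 where Y: "Y1 = w ` X1" "Y2 = w ` X2" by blast
  have dY: "X \<inter> (Y1 \<union> Y2) = {}" "(X \<union> (Y1 \<union> Y2)) \<inter> (Z1 \<union> Z2) = {}" "Y1 \<inter> Y2 = {}"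
    unfolding Y wX[symmetric] by (rule d1 d2 wd)+
  have dj: "X1 \<inter> (Y1 \<union> (X2 \<union> Y2 \<union> Z1)) = {}" "Y1 \<inter> (X2 \<union> Y2 \<union> Z1) = {}"
    using dY X12 by blast+
  show ?thesis
  proof (rule shift_sum_sqz3[OF w inj1 _ _ _ _ _ K(2,3) _ _ g l])
    show "independent (X1 \<union> (w ` X1 \<union> ?Z) \<union> (K1 \<union> K2))" unfolding eq by (rule ind)
    show "span (X1 \<union> (w ` X1 \<union> ?Z) \<union> (K1 \<union> K2)) = UNIV" unfolding eq by (rule sp)
    show "X1 \<inter> (w ` X1 \<union> ?Z) = {}" "w ` X1 \<inter> ?Z = {}" using dj unfolding Y .
    show "(X1 \<union> (w ` X1 \<union> ?Z)) \<inter> (K1 \<union> K2) = {}" unfolding eqN using d2 d3 K(1) by blast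
    show "w k = 0" if "k \<in> K1 \<union> K2" for k using that wZ2 K(1) by blast
    show "w n \<in> span (X1 \<union> (w ` X1 \<union> ?Z))" if n: "n \<in> w ` X1 \<union> ?Z" for n
    proof (cases "n \<in> X")
      case True
      then show ?thesis unfolding eqN by (intro span_base) blast
    next
      case False
      then have "n \<in> w ` X \<union> Z1" using n X12(1) wX by blast
      then show ?thesis unfolding eqN by (rule wN)
    qed
  qed
qed

section \<open>Maximal doubling sets and scalars modulo a subspace\<close>

definition doubling_set :: "('b \<Rightarrow> 'b) \<Rightarrow> 'b set \<Rightarrow> bool" where
  "doubling_set u X \<longleftrightarrow> inj_on u X \<and> X \<inter> u ` X = {} \<and> independent (X \<union> u ` X)"

text \<open>By Zorn's lemma: a vector \<open>x\<close> outside the span, with \<open>u x\<close>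
  independent of \<open>x\<close> modulo the span, could be added to \<open>X\<close>.\<close>

lemma ex_maximal_doubling_set:
  assumes u: "lin u"
  shows "\<exists>X. doubling_set u X \<and> (\<forall>x. x \<notin> span (X \<union> u ` X) \<longrightarrow> u x \<in> span (insert x (X \<union> u ` X)))"
proof -
  let ?A = "{X. doubling_set u X}"
  have "\<Union>\<C> \<in> ?A" if ch: "subset.chain ?A \<C>" for \<C>
  proof -
    have dbl: "doubling_set u X" if "X \<in> \<C>" for X using ch that unfolding subset_chain_def by blast
    have tot: "X \<subseteq> Y \<or> Y \<subseteq> X" if "X \<in> \<C>" "Y \<in> \<C>" for X Y using ch that unfolding subset_chain_def by blast
    have join: "\<exists>X\<in>\<C>. x \<in> X \<and> y \<in> X" if "x \<in> \<Union>\<C>" "y \<in> \<Union>\<C>" for x y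
      using that tot by (metis UnionE subsetD)
    have "inj_on u (\<Union>\<C>)"
    proof
      fix x y assume "x \<in> \<Union>\<C>" "y \<in> \<Union>\<C>" and eq: "u x = u y"
      then obtain X where X: "X \<in> \<C>" "x \<in> X" "y \<in> X" using join by meson
      then show "x = y" using dbl[OF X(1)] eq unfolding doubling_set_def inj_on_def by blast
    qed
    moreover have "\<Union>\<C> \<inter> u ` \<Union>\<C> = {}"
    proof (rule ccontr)
      assume "\<Union>\<C> \<inter> u ` \<Union>\<C> \<noteq> {}"
      then obtain x where x: "x \<in> \<Union>\<C>" "u x \<in> \<Union>\<C>" by blast
      then obtain X where X: "X \<in> \<C>" "x \<in> X" "u x \<in> X" using join by meson
      then show False using dbl[OF X(1)] unfolding doubling_set_def by blast
    qed
    moreover have "independent (\<Union>((\<lambda>X. X \<union> u ` X) ` \<C>))"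
    proof (rule independent_Union_directed)
      fix c d assume "c \<in> (\<lambda>X. X \<union> u ` X) ` \<C>" "d \<in> (\<lambda>X. X \<union> u ` X) ` \<C>"
      then obtain X Y where "X \<in> \<C>" "Y \<in> \<C>" "c = X \<union> u ` X" "d = Y \<union> u ` Y" by blast
      then show "c \<subseteq> d \<or> d \<subseteq> c" using tot[of X Y] by blast
    next
      fix c assume "c \<in> (\<lambda>X. X \<union> u ` X) ` \<C>"
      then show "independent c" using dbl unfolding doubling_set_def by blast
    qed
    moreover have "\<Union>((\<lambda>X. X \<union> u ` X) ` \<C>) = \<Union>\<C> \<union> u ` \<Union>\<C>" by blast
    ultimately show ?thesis unfolding doubling_set_def by simp
  qed
  from subset_Zorn'[OF this] obtain X where X: "doubling_set u X"
    and max: "\<And>Y. doubling_set u Y \<Longrightarrow> X \<subseteq> Y \<Longrightarrow> Y = X" by auto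
  have "u x \<in> span (insert x (X \<union> u ` X))" if x: "x \<notin> span (X \<union> u ` X)" for x
  proof (rule ccontr)
    let ?S = "X \<union> u ` X"
    assume nu: "u x \<notin> span (insert x ?S)"
    have iS: "independent ?S" and inj: "inj_on u X" and dis: "X \<inter> u ` X = {}" using X unfolding doubling_set_def by auto
    have xS: "x \<notin> ?S" using x by (rule contrapos_nn) (rule span_base)
    have uS: "u x \<notin> insert x ?S" using nu by (rule contrapos_nn) (rule span_base)
    have ind: "independent (insert (u x) (insert x ?S))"
      by (intro independent_insertI nu x iS)
    have eq: "insert (u x) (insert x ?S) = insert x X \<union> u ` insert x X" by blast
    have inj': "inj_on u (insert x X)" using inj uS by (auto simp: inj_on_insert)
    have dis': "insert x X \<inter> u ` insert x X = {}" using dis xS uS by auto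
    have "doubling_set u (insert x X)"
      unfolding doubling_set_def by (intro conjI inj' dis' ind[unfolded eq])
    then have "insert x X = X" by (rule max) blast
    then show False using xS by blast
  qed
  then show ?thesis using X by blast
qed

text \<open>In the quotient by \<open>S\<close>, a map that is scalar at each vector is scalar.
  Vectors independent modulo \<open>S\<close> are compared through their sum, dependent ones through
  a third vector, which exists because the codimension exceeds one.\<close>

lemma scalar_modulo:
  assumes u: "lin u" and S: "subspace S"
    and loc: "\<And>x. x \<notin> S \<Longrightarrow> \<exists>r. u x - r *s x \<in> S"
    and codim: "\<And>x. \<exists>y. y \<notin> span (insert x S)"
  shows "\<exists>r. \<forall>x. u x - r *s x \<in> S"
proof -
  note sS = subspaceD[OF S]
  have sp: "span S = S" using S by simp
  obtain r where r: "\<And>x. x \<notin> S \<Longrightarrow> u x - r x *s x \<in> S" using loc by metis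
  have eq: "r x = r y" if x: "x \<notin> S" and y: "y \<notin> span (insert x S)" for x y
  proof -
    have yS: "y \<notin> S" using y span_base[of y "insert x S"] by blast
    have xyS: "x + y \<notin> S"
    proof
      assume "x + y \<in> S"
      then have "(x + y) - x \<in> span (insert x S)" by (intro span_diff span_base) auto
      then show False using y by simp
    qed
    define a where "a = r (x + y)"
    have "(u (x + y) - a *s (x + y)) - (u x - r x *s x) - (u y - r y *s y) \<in> S"
      unfolding a_def by (rule sS(3)[OF sS(3)[OF r[OF xyS] r[OF x]] r[OF yS]])
    then have c: "(r y - a) *s y + (r x - a) *s x \<in> S"
      by (simp add: lin_rules[OF u] scale_right_distrib scale_left_diff_distrib algebra_simps)
    have ya: "r y = a"
    proof (rule ccontr)
      assume ne: "r y \<noteq> a"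
      have "((r y - a) *s y + (r x - a) *s x) - (r x - a) *s x \<in> span (insert x S)"
        using c by (intro span_diff span_scale span_base) auto
      then have "(r y - a) *s y \<in> span (insert x S)" by simp
      then show False using span_cong_scaled[OF subspace_span, of "r y - a"] y ne by simp
    qed
    have xa: "r x = a"
    proof (rule ccontr)
      assume ne: "r x \<noteq> a"
      have "(r x - a) *s x \<in> S" using c ya by simp
      then show False using span_cong_scaled[OF S, of "r x - a"] x ne by simp
    qed
    show ?thesis using ya xa by simp
  qed
  obtain x0 where x0: "x0 \<notin> S" using codim[of 0] sp span_superset[of "insert 0 S"] by blast
  have out: "r x = r x0" if x: "x \<notin> S" for x
  proof (cases "x \<in> span (insert x0 S)")
    case False
    then show ?thesis using eq[OF x0] by simp
  next
    case True
    obtain y where y: "y \<notin> span (insert x0 S)" using codim by blast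
    have "insert x S \<subseteq> span (insert x0 S)" using True span_superset[of "insert x0 S"] by blast
    then have "span (insert x S) \<subseteq> span (insert x0 S)" by (rule span_minimal) simp
    then have "y \<notin> span (insert x S)" using y by blast
    then show ?thesis using eq[OF x] eq[OF x0 y] by simp
  qed
  have "u x - r x0 *s x \<in> S" for x
  proof (cases "x \<in> S")
    case False
    then show ?thesis using r[OF False] out[OF False] by simp
  next
    case True
    have n: "x + x0 \<notin> S"
    proof
      assume "x + x0 \<in> S"
      then have "(x + x0) - x \<in> S" using True by (rule sS(3))
      then show False using x0 by simp
    qed
    have "u (x + x0) - r x0 *s (x + x0) \<in> S" using r[OF n] out[OF n] by simp
    from sS(3)[OF this r[OF x0]] show ?thesis
      by (simp add: lin_rules[OF u] scale_right_distrib algebra_simps)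
  qed
  then show ?thesis by blast
qed

section \<open>Assembly of the equivalence\<close>

lemma spanning_set_not_small:
  assumes C: "independent C" and S: "C \<subseteq> span S" "(card_of S, card_of C) \<in> ordLess" and inf: "infinite C"
  shows False
proof (cases "finite S")
  case True
  then show ?thesis using independent_finite_span[OF C S(1)] inf by blast
next
  case False
  from independent_card_ordLeq[OF C S(1) False] show ?thesis
    using S(2) not_ordLess_ordLeq by blast
qed

lemma independent_small:
  assumes T: "independent T" "T \<subseteq> span S" and S: "(card_of S, card_of C) \<in> ordLess" and C: "infinite C"
  shows "(card_of T, card_of C) \<in> ordLess"
proof (cases "finite S")
  case True
  then show ?thesis using finite_ordLess_infinite_card[OF independent_finite_span[OF T] C] by blast
next
  case False
  show ?thesis by (rule ordLeq_ordLess_trans[OF independent_card_ordLeq[OF T False] S])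
qed

text \<open>A maximal doubling set \<open>X\<close> of \<open>w\<close> is small because its image
  is independent inside a small span. So \<open>w\<close> is scalar modulo the span of
  \<open>X\<close> and its image, the scalar is zero, and finite and infinite \<open>X\<close> are
  covered by the two constructions.\<close>

lemma sum_sqz3_of_small_rank:
  assumes C: "independent C" "span C = UNIV" "infinite C"
    and w: "lin w" and B: "(card_of B, card_of C) \<in> ordLess" "\<And>v. w v \<in> span B"
    and l: "l + l = 0"
    and tr: "\<And>S. finite S \<Longrightarrow> span S = range w \<Longrightarrow> fr_trace scale w \<in> {0, l}"
  shows "sum_sqz3 (\<lambda>v. l *s v + w v)"
proof -
  obtain X where X: "doubling_set w X" and max: "\<And>x. x \<notin> span (X \<union> w ` X) \<Longrightarrow> w x \<in> span (insert x (X \<union> w ` X))"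
    using ex_maximal_doubling_set[OF w] by blast
  let ?S = "X \<union> w ` X"
  have inj: "inj_on w X" and dis: "X \<inter> w ` X = {}" and ind: "independent ?S" using X unfolding doubling_set_def by auto
  note small_Un = card_of_Un_ordLess_infinite[OF C(3)]
  have "independent (w ` X)" using independent_mono[OF ind] by blast
  then have "(card_of (w ` X), card_of C) \<in> ordLess" by (rule independent_small[OF _ _ B(1) C(3)]) (use B(2) in blast)
  moreover from this have sX: "(card_of X, card_of C) \<in> ordLess"
    using ordIso_ordLess_trans[OF card_of_ordIsoI[OF inj_on_imp_bij_betw[OF inj]]] by blast
  ultimately have sS: "(card_of ?S, card_of C) \<in> ordLess" using small_Un by blast
  have not_all: "\<not> (\<forall>v. v \<in> span T)" if "(card_of T, card_of C) \<in> ordLess" for T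
    using spanning_set_not_small[OF C(1) _ that C(3)] by blast
  have loc: "\<exists>r. w x - r *s x \<in> span ?S" if "x \<notin> span ?S" for x
    using max[OF that] span_breakdown_eq by blast
  have codim: "\<exists>y. y \<notin> span (insert x (span ?S))" for x
  proof -
    have "(card_of (insert x ?S), card_of C) \<in> ordLess"
      using small_Un[OF finite_ordLess_infinite_card[OF _ C(3)] sS, of "{x}"] by simp
    moreover have "span (insert x (span ?S)) \<subseteq> span (insert x ?S)"
      by (rule span_minimal) (use span_base[of x "insert x ?S"] span_mono[of ?S "insert x ?S"] in blast)+
    ultimately show ?thesis using not_all by blast
  qed
  obtain r where r: "\<And>x. w x - r *s x \<in> span ?S" using scalar_modulo[OF w subspace_span loc codim] by blast
  \<comment> \<open>For nonzero \<open>r\<close> every vector would lie in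
    \<open>span (B \<union> ?S)\<close>, although \<open>B\<close> and \<open>?S\<close> are
    small.\<close>
  have "r = 0"
  proof (rule ccontr)
    assume r0: "r \<noteq> 0"
    have "v \<in> span (B \<union> ?S)" for v
    proof -
      have "w v \<in> span (B \<union> ?S)" "w v - r *s v \<in> span (B \<union> ?S)"
        using B(2)[of v] r[of v] span_mono[of B "B \<union> ?S"] span_mono[of ?S "B \<union> ?S"] by blast+
      then have "w v - (w v - r *s v) \<in> span (B \<union> ?S)" by (rule span_diff)
      then show ?thesis using span_cong_scaled[OF subspace_span r0] by simp
    qed
    then show False using not_all[OF small_Un[OF B(1) sS]] by blast
  qed
  then have wim: "w v \<in> span ?S" for v using r[of v] by simp
  obtain Z1 Z2 where Z: "independent (?S \<union> (Z1 \<union> Z2))" "span (?S \<union> (Z1 \<union> Z2)) = UNIV"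
    "?S \<inter> (Z1 \<union> Z2) = {}" "Z1 \<inter> Z2 = {}" and wZ1: "\<And>z. z \<in> Z1 \<Longrightarrow> w z \<in> span X"
    and wZ2: "\<And>z. z \<in> Z2 \<Longrightarrow> w z = 0" and iZ1: "independent (w ` Z1)" "inj_on w Z1"
    using ex_adapted_basis[OF w ind wim] by metis
  have wZ1X: "w ` Z1 \<subseteq> span X" using wZ1 by blast
  have Zw: "(card_of Z1, card_of (w ` Z1)) \<in> ordIso" by (rule card_of_ordIsoI[OF inj_on_imp_bij_betw[OF iZ1(2)]])
  have sZ1: "(card_of Z1, card_of C) \<in> ordLess"
    by (rule ordIso_ordLess_trans[OF Zw independent_small[OF iZ1(1) wZ1X sX C(3)]])
  \<comment> \<open>A finite \<open>Z2\<close> would make the whole adapted basis smaller than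
    \<open>C\<close>.\<close>
  have Z2: "infinite Z2"
  proof
    assume "finite Z2"
    from small_Un[OF sS small_Un[OF sZ1 finite_ordLess_infinite_card[OF this C(3)]]] Z(2) show False
      using not_all by blast
  qed
  show ?thesis
  proof (cases "finite X")
    case True
    have fZ1: "finite Z1"
      using independent_finite_span[OF iZ1(1) wZ1X True] finite_imageD[OF _ iZ1(2)] by blast
    obtain A where A: "A \<subseteq> range w" "independent A" "range w \<subseteq> span A" by (rule maximal_independent_subset)
    have "A \<subseteq> span ?S" using A(1) wim by blast
    then have fA: "finite A" using independent_finite_span[OF A(2)] True by blast
    have "span A = range w" using A span_minimal[OF A(1) P.linear_subspace_image[OF w subspace_UNIV]] by blast
    then have tr0: "fr_trace scale w \<in> {0, l}" by (rule tr[OF fA])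
    show ?thesis by (rule finite_rank_sum_sqz3[OF w inj True Z(1,2) dis Z(3,4) wim wZ1 wZ2 fZ1 Z2 l tr0])
  next
    case False
    have Z1X: "(card_of Z1, card_of X) \<in> ordLeq"
      by (rule ordIso_ordLeq_trans[OF Zw independent_card_ordLeq[OF iZ1(1) wZ1X False]])
    have "w n \<in> span (?S \<union> Z1)" for n using wim[of n] span_mono[of ?S "?S \<union> Z1"] by blast
    then show ?thesis
      by (intro infinite_rank_sum_sqz3[OF w inj False Z(1,2) dis Z(3,4) Z1X _ wZ2 _ l]) (use Z2 in auto)
  qed
qed

text \<open>Dichotomy by the size of a maximal doubling set. A small one leaves \<open>u\<close>
  scalar modulo a small subspace; one at least as large as \<open>C\<close> dominates every
  complementary basis, and the shift construction applies with \<open>l = 0\<close>.\<close>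

lemma sum_sqz3_or_dominant:
  assumes C: "independent C" "span C = UNIV" "infinite C" and u: "lin u"
  shows "sum_sqz3 u \<or> (\<exists>l B. (card_of B, card_of C) \<in> ordLess \<and> (\<forall>v. u v - l *s v \<in> span B))"
proof -
  obtain X where X: "doubling_set u X" and max: "\<And>x. x \<notin> span (X \<union> u ` X) \<Longrightarrow> u x \<in> span (insert x (X \<union> u ` X))"
    using ex_maximal_doubling_set[OF u] by blast
  let ?S = "X \<union> u ` X"
  have inj: "inj_on u X" and dis: "X \<inter> u ` X = {}" and ind: "independent ?S" using X unfolding doubling_set_def by auto
  note small_Un = card_of_Un_ordLess_infinite[OF C(3)]
  show ?thesis
  proof (cases "(card_of X, card_of C) \<in> ordLess")
    case True
    have sS: "(card_of ?S, card_of C) \<in> ordLess"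
      by (rule small_Un[OF True ordLeq_ordLess_trans[OF card_of_image True]])
    have loc: "\<exists>r. u x - r *s x \<in> span ?S" if "x \<notin> span ?S" for x
      using max[OF that] span_breakdown_eq by blast
    have codim: "\<exists>y. y \<notin> span (insert x (span ?S))" for x
    proof -
      have "(card_of (insert x ?S), card_of C) \<in> ordLess"
        using small_Un[OF finite_ordLess_infinite_card[OF _ C(3)] sS, of "{x}"] by simp
      moreover have "span (insert x (span ?S)) \<subseteq> span (insert x ?S)"
        by (rule span_minimal) (use span_base[of x "insert x ?S"] span_mono[of ?S "insert x ?S"] in blast)+
      ultimately show ?thesis using spanning_set_not_small[OF C(1) _ _ C(3), of "insert x ?S"] by blast
    qed
    obtain r where "\<And>x. u x - r *s x \<in> span ?S" using scalar_modulo[OF u subspace_span loc codim] by blast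
    then show ?thesis using sS by blast
  next
    case False
    then have CX: "(card_of C, card_of X) \<in> ordLeq"
      using not_ordLess_iff_ordLeq card_of_Well_order by blast
    have iX: "infinite X" using card_of_ordLeq_infinite[OF CX C(3)] .
    obtain Z where Z: "independent (?S \<union> Z)" "?S \<inter> Z = {}" "span (?S \<union> Z) = UNIV"
      using independent_extends[OF ind] by blast
    have iZ: "independent Z" using independent_mono[OF Z(1)] by blast
    have "Z \<subseteq> span C" using C(2) by simp
    from ordLeq_transitive[OF independent_card_ordLeq[OF iZ this C(3)] CX]
    have ZX: "(card_of Z, card_of X) \<in> ordLeq" .
    have "sum_sqz3 (\<lambda>v. 0 *s v + u v)"
      by (rule infinite_rank_sum_sqz3[OF u inj iX, of Z "{}"]) (use Z dis ZX in auto)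
    then show ?thesis by simp
  qed
qed

text \<open>Fixes one basis \<open>C\<close> for all comparisons and allows any small set whose span
  contains the image in place of a basis of the image.\<close>

lemma rank_less_dim_iff:
  assumes C: "independent C" "span C = UNIV" "infinite C" and w: "lin w"
  shows "rank_less_dim scale w \<longleftrightarrow> (\<exists>B. (card_of B, card_of C) \<in> ordLess \<and> (\<forall>v. w v \<in> span B))"
proof
  assume "rank_less_dim scale w"
  then obtain B C' where B: "span B = range w" and C': "independent C'" "span C' = UNIV"
    and less: "(card_of B, card_of C') \<in> ordLess"
    unfolding rank_less_dim_def is_basis_of_def by blast
  have "infinite C'"
    using independent_finite_span[OF C(1), of C'] C(3) C'(2) by auto
  have "(card_of C', card_of C) \<in> ordLeq"
    by (rule independent_card_ordLeq[OF C'(1) _ C(3)]) (simp add: C(2))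
  then have "(card_of B, card_of C) \<in> ordLess" by (rule ordLess_ordLeq_trans[OF less])
  then show "\<exists>B. (card_of B, card_of C) \<in> ordLess \<and> (\<forall>v. w v \<in> span B)" using B by blast
next
  assume "\<exists>B. (card_of B, card_of C) \<in> ordLess \<and> (\<forall>v. w v \<in> span B)"
  then obtain B where B: "(card_of B, card_of C) \<in> ordLess" "\<And>v. w v \<in> span B" by blast
  obtain A where A: "A \<subseteq> range w" "independent A" "range w \<subseteq> span A" by (rule maximal_independent_subset)
  have "span A = range w" using A span_minimal[OF A(1) P.linear_subspace_image[OF w subspace_UNIV]] by blast
  then have "is_basis_of scale A (range w)" unfolding is_basis_of_def using A by blast
  moreover have "is_basis_of scale C UNIV" unfolding is_basis_of_def using C by blast
  moreover have "(card_of A, card_of C) \<in> ordLess"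
    by (rule independent_small[OF A(2) _ B(1) C(3)]) (use A(1) B(2) in blast)
  ultimately show "rank_less_dim scale w" unfolding rank_less_dim_def by blast
qed

text \<open>The spanning-set bound excludes small perturbations of \<open>l\<close> with
  \<open>2 l\<close> nonzero; otherwise the trace obstruction remains. Conversely, a map not covered
  by the dichotomy has a dominant eigenvalue \<open>l\<close>; excluding (ii) gives
  \<open>2 l = 0\<close>, and excluding (i) then supplies the trace condition.\<close>

lemma sum_sqz3_iff:
  assumes inf: "infinite_dimensional scale" and u: "lin u"
  shows "sum_sqz3 u \<longleftrightarrow> \<not> ((\<exists>l w. lin w \<and> finite_rank scale w \<and> fr_trace scale w \<notin> {0, l} \<and> u = (\<lambda>x. scale l x + w x))
     \<or> ((2::'a) \<noteq> 0 \<and> (\<exists>l. l \<noteq> 0 \<and> dominant_eigenvalue scale u l)))"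
proof -
  obtain C where C: "independent C" "span C = UNIV"
    using independent_extends[OF independent_empty] by auto
  have iC: "infinite C" using inf C(2) unfolding infinite_dimensional_def by blast
  note C = C iC
  have no_dom: False if s: "sum_sqz3 u" and l: "l \<noteq> 0" "(2::'a) \<noteq> 0" and B: "(card_of B, card_of C) \<in> ordLess"
    "\<And>v. u v - l *s v \<in> span B" for l B
  proof -
    define w where "w = (\<lambda>v. u v - l *s v)"
    have w: "lin w" unfolding w_def by (rule lin_diff[OF u lin_scale[OF lin_ident]])
    have "u = (\<lambda>v. l *s v + w v)" by (simp add: w_def)
    then have "sum_sqz3 (\<lambda>v. l *s v + w v)" using s by simp
    then obtain S where S: "span S = UNIV" "finite B \<longrightarrow> finite S" "infinite B \<longrightarrow> (card_of S, card_of B) \<in> ordLeq"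
      using sum_sqz3_spanning_set[OF w _ l, of B] B(2) unfolding w_def by blast
    have "(card_of S, card_of C) \<in> ordLess"
    proof (cases "finite B")
      case True then show ?thesis using S(2) finite_ordLess_infinite_card iC by blast
    next
      case False then show ?thesis using ordLeq_ordLess_trans[OF _ B(1)] S(3) by blast
    qed
    then show False using spanning_set_not_small[OF C(1) _ _ iC] S(1) by blast
  qed
  have double: "l \<noteq> 0 \<and> (2::'a) \<noteq> 0" if "l + l \<noteq> 0" for l :: 'a
    using that by (metis add.right_neutral mult_2 mult_zero_left)
  show ?thesis
  proof
    assume s: "sum_sqz3 u"
    have "False" if w: "lin w" "finite_rank scale w" "fr_trace scale w \<notin> {0, l}" "u = (\<lambda>x. l *s x + w x)" for l w
    proof -
      obtain S where S: "finite S" "span S = range w" using w(2) unfolding finite_rank_def by blast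
      show False
      proof (cases "l + l = 0")
        case True
        have "fr_trace scale w \<in> {0, l}"
          by (rule sum_sqz3_trace[OF w(1) S(1) _ True]) (use S(2) s w(4) in auto)
        then show False using w(3) by blast
      next
        case False
        \<comment> \<open>With \<open>2 l\<close> nonzero, situation (i) falls under the same bound,
          since finite rank is smaller than the dimension.\<close>
        show False
          by (rule no_dom[OF s, of l S]) (use double[OF False] finite_ordLess_infinite_card[OF S(1) iC] S(2) w(4) in auto)
      qed
    qed
    moreover have False if l: "(2::'a) \<noteq> 0" "l \<noteq> 0" "dominant_eigenvalue scale u l" for l
    proof -
      have "lin (\<lambda>x. u x - l *s x)" by (rule lin_diff[OF u lin_scale[OF lin_ident]])
      then obtain B where "(card_of B, card_of C) \<in> ordLess" "\<And>v. u v - l *s v \<in> span B"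
        using l(3) rank_less_dim_iff[OF C] unfolding dominant_eigenvalue_def by blast
      then show False using no_dom[OF s l(2,1)] by blast
    qed
    ultimately show "\<not> ((\<exists>l w. lin w \<and> finite_rank scale w \<and> fr_trace scale w \<notin> {0, l} \<and> u = (\<lambda>x. scale l x + w x))
     \<or> ((2::'a) \<noteq> 0 \<and> (\<exists>l. l \<noteq> 0 \<and> dominant_eigenvalue scale u l)))" by blast
  next
    assume n: "\<not> ((\<exists>l w. lin w \<and> finite_rank scale w \<and> fr_trace scale w \<notin> {0, l} \<and> u = (\<lambda>x. scale l x + w x))
     \<or> ((2::'a) \<noteq> 0 \<and> (\<exists>l. l \<noteq> 0 \<and> dominant_eigenvalue scale u l)))"
    show "sum_sqz3 u"
    proof (rule ccontr)
      assume ns: "\<not> sum_sqz3 u"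
      then obtain l B where B: "(card_of B, card_of C) \<in> ordLess" "\<And>v. u v - l *s v \<in> span B"
        using sum_sqz3_or_dominant[OF C u] by blast
      define w where "w = (\<lambda>v. u v - l *s v)"
      have w: "lin w" unfolding w_def by (rule lin_diff[OF u lin_scale[OF lin_ident]])
      have uw: "u = (\<lambda>v. l *s v + w v)" by (simp add: w_def)
      have wB: "w v \<in> span B" for v unfolding w_def by (rule B(2))
      have "dominant_eigenvalue scale u l"
        unfolding dominant_eigenvalue_def using rank_less_dim_iff[OF C w] B(1) wB unfolding w_def by blast
      then have l: "l + l = 0" using n double by blast
      have "fr_trace scale w \<in> {0, l}" if "finite S" "span S = range w" for S
        using n w uw that unfolding finite_rank_def by blast
      then have "sum_sqz3 (\<lambda>v. l *s v + w v)" by (rule sum_sqz3_of_small_rank[OF C w B(1) wB l])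
      then show False using ns uw by simp
    qed
  qed
qed

end

theorem theorem5:
  fixes s :: "'a::field \<Rightarrow> 'b::ab_group_add \<Rightarrow> 'b" and u :: "'b \<Rightarrow> 'b"
  assumes "vector_space s"
    and "infinite_dimensional s"
    and "Vector_Spaces.linear s s u"
  shows "(\<exists>a b c. Vector_Spaces.linear s s a \<and> Vector_Spaces.linear s s b \<and> Vector_Spaces.linear s s c
            \<and> square_zero a \<and> square_zero b \<and> square_zero c \<and> u = (\<lambda>x. a x + b x + c x))
    \<longleftrightarrow> \<not> ((\<exists>l w. Vector_Spaces.linear s s w \<and> finite_rank s w \<and> fr_trace s w \<notin> {0, l}
                     \<and> u = (\<lambda>x. s l x + w x))
          \<or> ((2::'a) \<noteq> 0 \<and> (\<exists>l. l \<noteq> 0 \<and> dominant_eigenvalue s u l)))"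
proof -
  interpret endo_space s using assms(1) by (simp add: endo_space_def)
  show ?thesis using sum_sqz3_iff[OF assms(2,3)] unfolding sum_sqz3_def .
qed
end
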